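(* Let $m,d\ge 0$ be integers and let $S_{m,d}(\mathcal{CH})$ be the sparse paving matroid of rank $d$ on the ground set $[m+d]$ whose set of circuit-hyperplanes is $\mathcal{CH}$. For an integer $i\ge 0$ let $c^i_{m,d}(\mathcal{CH})$ be the coefficient of $t^i$ in the Kazhdan--Lusztig polynomial $P_{S_{m,d}(\mathcal{CH})}(t)$. Then $$c^i_{m,d}(\mathcal{CH})=\operatorname{skyt}(m+1,i,d-2i+1)-|\mathcal{CH}|\cdot\overline{\operatorname{skyt}}(i,d-2i+1).$$ Moreover, $c^i_{m,d}(\mathcal{CH})\ge 0$.
   Context: $[n]=\{1,\dots,n\}$ and $\binom{[n]}{d}$ is the set of $d$-element subsets of $[n]$. Sparse paving matroids: a matroid $M$ of rank $d$ on the ground set $[m+d]$ with set of bases $\mathcal B\subseteq\binom{[m+d]}{d}$ is sparse paving if, with $\mathcal{CH}:=\binom{[m+d]}{d}\setminus\mathcal B$, any two distinct $C,C'\in\mathcal{CH}$ satisfy $|C\triangle C'|\ge 4$ (symmetric difference); then $\mathcal{CH}$ is exactly the set of circuit-hyperplanes of $M$. This matroid is denoted $S_{m,d}(\mathcal{CH})$. (Since $S_{m,d}(\mathcal{CH})$ is a matroid, $\mathcal B\neq\emptyset$.) Kazhdan--Lusztig polynomials: for a matroid $M$ with rank function $\operatorname{rk}$ and lattice of flats $L(M)$ with minimum $\hat 0$, the characteristic polynomial is $\chi_M(t)=\sum_{F\in L(M)}\mu_{L(M)}(\hat 0,F)\,t^{\operatorname{rk}M-\operatorname{rk}F}$, $\mu$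 being the Möbius function. For a flat $F$, the localization $M^F$ is the matroid on $F$ whose independent sets are the subsets of $F$ independent in $M$; the contraction $M_F$ is the matroid on the complement of $F$ whose independent sets are the subsets whose union with a basis of $F$ is independent in $M$. The Kazhdan--Lusztig polynomials $P_M(t)\in\mathbb Z[t]$ are the unique family (known to exist, by Elias--Proudfoot--Wakefield) such that: (1) if $\operatorname{rk}M=0$ then $P_M(t)=1$; (2) if $\operatorname{rk}M>0$ then $\deg P_M(t)<\frac12\operatorname{rk}M$; (3) $t^{\operatorname{rk}M}P_M(t^{-1})=\sum_{F\text{ flat}}\chi_{M^F}(t)P_{M_F}(t)$. Tableaux: for $a,b\ge 2$ and $i\ge 1$ consider the shape consisting, from left to right, of a column of height $a$, then $i-1$ columns of height $2$, then a column of height $b$, placed so that the top two cells of the left-most column, the two cells of each middle column, and the bottom two cells of the right-most column lie in the same two consecutive rows (so the left column extends downward from these rows and the right column extends upward). $\operatorname{Skyt}(a,i,b)$ is the set of fillings of this shape using each number in $\{1,\dots,a+b+2i-2\}$ exactly once, with entries strictly increasing left to right in rows and top to bottom in columns, and $\operatorname{skyt}(a,i,b)=|\operatorname{Skyt}(a,i,b)|$. $\overline{\operatorname{Skyt}}(i,b)$ is the subset of $\operatorname{Skyt}(2,i,b)$ of fillings with $1$ at the top of the left-most column, and $\overline{\operatorname{skyt}}(i,b)$ is its cardinality. Conventions: $\operatorname{skyt}(a,0,b)=1$; if $i>0$ and at least one of $a,b$ is less than $2$ then $\operatorname{skyt}(a,i,b)=0$; $\overline{\operatorname{skyt}}(0,b)=0$;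 and (as a subset count) $\overline{\operatorname{skyt}}(i,b)=0$ if $i>0$ and $b<2$. *)

theory Defs
  imports "HOL-Computational_Algebra.Polynomial" "HOL-Library.FuncSet"
begin

section \<open>Matroids\<close>

datatype 'a set_system = Set_System (ground: "'a set") (indep: "'a set set")

definition matroid :: "'a set_system \<Rightarrow> bool" where
  "matroid M \<longleftrightarrow>
     finite (ground M) \<and>
     (\<forall>X\<in>indep M. X \<subseteq> ground M) \<and>
     {} \<in> indep M \<and>
     (\<forall>X\<in>indep M. \<forall>Y. Y \<subseteq> X \<longrightarrow> Y \<in> indep M) \<and>
     (\<forall>X\<in>indep M. \<forall>Y\<in>indep M. card X < card Y \<longrightarrow> (\<exists>y\<in>Y - X. insert y X \<in> indep M))"

definition rk :: "'a set_system \<Rightarrow> 'a set \<Rightarrow> nat" where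
  "rk M A = Max (card ` {X \<in> indep M. X \<subseteq> A})"

abbreviation rank :: "'a set_system \<Rightarrow> nat" where
  "rank M \<equiv> rk M (ground M)"

definition basis_of :: "'a set_system \<Rightarrow> 'a set \<Rightarrow> 'a set \<Rightarrow> bool" where
  "basis_of M A B \<longleftrightarrow> B \<in> indep M \<and> B \<subseteq> A \<and> (\<forall>x\<in>A - B. insert x B \<notin> indep M)"

definition bases :: "'a set_system \<Rightarrow> 'a set set" where
  "bases M = {B. basis_of M (ground M) B}"

definition flats :: "'a set_system \<Rightarrow> 'a set set" where
  "flats M = {F. F \<subseteq> ground M \<and> (\<forall>x\<in>ground M - F. rk M F < rk M (insert x F))}"

definition localization :: "'a set_system \<Rightarrow> 'a set \<Rightarrow> 'a set_system" where
  "localization M F = Set_System F {X \<in> indep M. X \<subseteq> F}"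

definition contraction :: "'a set_system \<Rightarrow> 'a set \<Rightarrow> 'a set_system" where
  "contraction M F =
     Set_System (ground M - F) {X. X \<subseteq> ground M - F \<and> (\<exists>B. basis_of M F B \<and> X \<union> B \<in> indep M)}"


section \<open>Characteristic polynomial\<close>

text \<open>The Moebius function of a family of sets \<open>L\<close> ordered by inclusion. The finiteness test
  serves termination only.\<close>

function moebius :: "'a set set \<Rightarrow> 'a set \<Rightarrow> 'a set \<Rightarrow> int" where
  "moebius L X Y =
     (if X = Y then 1
      else if finite L \<and> X \<subset> Y then - (\<Sum>Z\<in>{Z \<in> L. X \<subseteq> Z \<and> Z \<subset> Y}. moebius L X Z)
      else 0)"
  by auto
termination
proof (relation "measure (\<lambda>(L, X, Y). card {Z \<in> L. Z \<subset> Y})", goal_cases)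
  case 1
  then show ?case by simp
next
  case (2 L X Y Z)
  then have "{W \<in> L. W \<subset> Z} \<subset> {W \<in> L. W \<subset> Y}" by auto
  with 2 have "card {W \<in> L. W \<subset> Z} < card {W \<in> L. W \<subset> Y}"
    by (intro psubset_card_mono) auto
  then show ?case by simp
qed

declare moebius.simps [simp del]

text \<open>The minimum of the lattice of flats is the intersection of all flats (the set of loops).\<close>

definition charpoly :: "'a set_system \<Rightarrow> int poly" where
  "charpoly M =
     (\<Sum>F\<in>flats M. monom (moebius (flats M) (\<Inter>(flats M)) F) (rank M - rk M F))"


section \<open>Kazhdan--Lusztig polynomials\<close>

text \<open>\<open>rev_poly n p\<close> is $t^n p(t^{-1})$, provided that \<open>degree p \<le> n\<close>. In the definition
  of \<open>kl_family\<close> this proviso is guaranteed by the first two conditions.\<close>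

definition rev_poly :: "nat \<Rightarrow> int poly \<Rightarrow> int poly" where
  "rev_poly n p = monom 1 (n - degree p) * reflect_poly p"

definition kl_family :: "('a set_system \<Rightarrow> int poly) \<Rightarrow> bool" where
  "kl_family P \<longleftrightarrow>
     (\<forall>M. matroid M \<longrightarrow>
        (rank M = 0 \<longrightarrow> P M = 1) \<and>
        (rank M > 0 \<longrightarrow> 2 * degree (P M) < rank M) \<and>
        rev_poly (rank M) (P M) =
          (\<Sum>F\<in>flats M. charpoly (localization M F) * P (contraction M F)))"

text \<open>A family as above exists and is unique on matroids (Elias, Proudfoot and Wakefield); its
  values on set systems that are not matroids are irrelevant, so the description is of the
  individual value rather than of the whole family.\<close>

definition kl_poly :: "'a set_system \<Rightarrow> int poly" where
  "kl_poly M = (THE p. \<exists>P. kl_family P \<and> P M = p)"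


section \<open>Sparse paving matroids\<close>

text \<open>\<open>sparse_paving m d CH M\<close> says that \<open>M\<close> is the sparse paving matroid
  $S_{m,d}(\mathcal{CH})$.\<close>

definition sparse_paving :: "nat \<Rightarrow> nat \<Rightarrow> nat set set \<Rightarrow> nat set_system \<Rightarrow> bool" where
  "sparse_paving m d CH M \<longleftrightarrow>
     matroid M \<and> ground M = {1..m + d} \<and> rank M = d \<and>
     CH = {C. C \<subseteq> {1..m + d} \<and> card C = d} - bases M \<and>
     (\<forall>C\<in>CH. \<forall>C'\<in>CH. C \<noteq> C' \<longrightarrow> card (sym_diff C C') \<ge> 4)"


section \<open>Skew tableaux\<close>

text \<open>A cell is a pair (row, column). Rows are numbered downwards, and the two common rows are
  0 and 1: the left column (column 0) occupies rows 0 to \<open>a - 1\<close>, the right column (column \<open>i\<close>)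
  rows \<open>2 - b\<close> to 1.\<close>

definition skew_shape :: "int \<Rightarrow> nat \<Rightarrow> int \<Rightarrow> (int \<times> nat) set" where
  "skew_shape a i b = {0..a - 1} \<times> {0} \<union> {0..1} \<times> {1..<i} \<union> {2 - b..1} \<times> {i}"

definition Skyt :: "int \<Rightarrow> nat \<Rightarrow> int \<Rightarrow> (int \<times> nat \<Rightarrow> nat) set" where
  "Skyt a i b =
     {T \<in> extensional (skew_shape a i b).
        bij_betw T (skew_shape a i b) {1..nat (a + b + 2 * int i - 2)} \<and>
        (\<forall>r c c'. (r, c) \<in> skew_shape a i b \<and> (r, c') \<in> skew_shape a i b \<and> c < c' \<longrightarrow>
           T (r, c) < T (r, c')) \<and>
        (\<forall>r r' c. (r, c) \<in> skew_shape a i b \<and> (r', c) \<in> skew_shape a i b \<and> r < r' \<longrightarrow>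
           T (r, c) < T (r', c))}"

definition Skyt_bar :: "nat \<Rightarrow> int \<Rightarrow> (int \<times> nat \<Rightarrow> nat) set" where
  "Skyt_bar i b = {T \<in> Skyt 2 i b. T (0, 0) = 1}"

text \<open>The sets above are meant for \<open>a, b \<ge> 2\<close> and \<open>i \<ge> 1\<close>; outside this range the numbers are
  fixed by convention.\<close>

definition skyt :: "int \<Rightarrow> nat \<Rightarrow> int \<Rightarrow> nat" where
  "skyt a i b = (if i = 0 then 1 else if a < 2 \<or> b < 2 then 0 else card (Skyt a i b))"

definition skyt_bar :: "nat \<Rightarrow> int \<Rightarrow> nat" where
  "skyt_bar i b = (if i = 0 \<or> b < 2 then 0 else card (Skyt_bar i b))"

end

(*
By the Elias--Proudfoot--Wakefield recursion, the coefficient of t^i in P_M is read off as the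
coefficient of t^(d-i) in the sum over the flats other than the flat of loops. A flat of rank at
most d-2 of a sparse paving matroid is an independent set, its contraction is again sparse paving
of the same corank m, and a circuit-hyperplane merges d hyperplanes into one. Hence, by induction on
the rank, P_M = U_{m,d} - |CH| Q_d, where U_{m,d} belongs to the uniform matroid and Q_d = U_{1,d} -
U_{1,d-1} is found by subtracting the recursions of U_{1,d} and of U_{1,d-1}.

The recursion for U_{m,d} becomes an identity between alternating sums of numbers of linear
extensions. Every step of its proof compares two incomparable elements of a poset, so that the number
of linear extensions splits into two summands, and all sums telescope.

For the nonnegativity, expanding the tableau number along the left column by hook lengths gives
a first-order recursion in m for it, from which (max m d + 1) U >= binomial(m+d, d) Q follows
coefficientwise by induction on m, except for m = d = 3. Since distinct circuit-hyperplanes share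
no (d-1)-subset and no (d+1)-superset, |CH| (max m d + 1) <= binomial(m+d, d). If m = d = 3, then
|CH| <= 4 suffices.
*)
theory Submission
  imports Defs
begin

section \<open>Linear extensions\<close>

text \<open>The polynomial Q_d is forced by the smallest example: for m = 1 and a single
  circuit-hyperplane the matroid is a circuit on d elements plus a coloop, and its polynomial is
  that of U_{1,d-1}. It does not depend on m because the terms changed by a circuit-hyperplane come
  from it and its subsets. The posets met in the telescoping are mostly not skew shapes, since their
  two rows may cross. So tableaux are replaced by labellings for arbitrary relations, and only the
  ends of each telescope have to be shapes or unions of chains. As \<open>kl_poly\<close> is a
  definite description over whole families, existence and uniqueness must be proved. Existence rests
  on an antisymmetry under reversal, that is, on characteristic polynomials of intervals and their
  reversals being inverse to each other in the incidence algebra. The term of the flat of loops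
  involves a matroid that differs from M if M has loops, so their two polynomials have to be
  identified. The estimate for nonnegativity has no slack: for m = 4, d = 3 the Fano plane has seven
  circuit-hyperplanes, and its coefficient of t is 14 - 7 * 2 = 0.\<close>

definition compatible :: "'a set \<Rightarrow> ('a \<times> 'a) set \<Rightarrow> ('a \<Rightarrow> nat) \<Rightarrow> bool" where
  "compatible S R f \<longleftrightarrow> (\<forall>x\<in>S. \<forall>y\<in>S. (x, y) \<in> R \<longrightarrow> f x < f y)"

definition linexts :: "'a set \<Rightarrow> ('a \<times> 'a) set \<Rightarrow> ('a \<Rightarrow> nat) set" where
  "linexts S R = {f \<in> extensional S. bij_betw f S {1..card S} \<and> compatible S R f}"

definition lin :: "'a set \<Rightarrow> ('a \<times> 'a) set \<Rightarrow> nat" where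
  "lin S R = card (linexts S R)"

lemma compatible_restrict [simp]: "compatible S R (restrict f S) = compatible S R f"
  by (simp add: compatible_def)

lemma bij_betw_restrict [simp]: "bij_betw (restrict f S) S T = bij_betw f S T"
  by (auto simp: bij_betw_def inj_on_def)

lemma compatible_insert:
  "\<lbrakk>x \<in> S; y \<in> S\<rbrakk> \<Longrightarrow> compatible S (insert (x, y) R) f \<longleftrightarrow> f x < f y \<and> compatible S R f"
  by (auto simp: compatible_def)

lemma finite_linexts:
  assumes "finite S" shows "finite (linexts S R)"
proof (rule finite_subset)
  show "linexts S R \<subseteq> PiE S (\<lambda>_. {1..card S})"
    by (auto simp: linexts_def bij_betw_def PiE_def)
  show "finite (PiE S (\<lambda>_. {1..card S}))" using assms by (intro finite_PiE) auto
qed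

text \<open>Labellings are bijections, so the constraints need only agree on injective
  \<open>f\<close>. The relations may thus differ by consequences of each other and by pairs outside
  of the set.\<close>

lemma lin_cong:
  assumes "S = S'" "\<And>f. inj_on f S' \<Longrightarrow> compatible S' R f \<longleftrightarrow> compatible S' R' f"
  shows "lin S R = lin S' R'"
proof -
  have "linexts S R = linexts S' R'"
    unfolding linexts_def using assms by (auto simp: bij_betw_def)
  thus ?thesis by (simp add: lin_def)
qed

text \<open>Distinct elements carry distinct labels. If \<open>R\<close> already decides between
  \<open>x\<close> and \<open>y\<close>, one of the summands is 0.\<close>

lemma lin_split:
  assumes "finite S" "x \<in> S" "y \<in> S" "x \<noteq> y"
  shows "lin S R = lin S (insert (x, y) R) + lin S (insert (y, x) R)"
proof -
  have "f x \<noteq> f y" if "f \<in> linexts S R" for f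
    using that assms by (auto simp: linexts_def bij_betw_def inj_on_def)
  hence "linexts S R = linexts S (insert (x, y) R) \<union> linexts S (insert (y, x) R)"
    using assms by (auto simp: linexts_def compatible_insert nat_neq_iff)
  moreover have "linexts S (insert (x, y) R) \<inter> linexts S (insert (y, x) R) = {}"
    using assms by (auto simp: linexts_def compatible_insert)
  ultimately show ?thesis
    using finite_linexts[OF assms(1)] by (simp add: lin_def card_Un_disjoint)
qed

lemma lin_iso:
  assumes \<pi>: "bij_betw \<pi> S S'"
    and R: "\<And>f. inj_on f S' \<Longrightarrow> compatible S R (f \<circ> \<pi>) \<longleftrightarrow> compatible S' R' f"
  shows "lin S R = lin S' R'"
proof -
  have card: "card S = card S'" using \<pi> by (rule bij_betw_same_card)
  have inv: "bij_betw (inv_into S \<pi>) S' S" using \<pi> by (rule bij_betw_inv_into)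
  let ?h = "\<lambda>f. restrict (f \<circ> \<pi>) S" and ?k = "\<lambda>f. restrict (f \<circ> inv_into S \<pi>) S'"
  have 1: "?h f \<in> linexts S R \<and> ?k (?h f) = f" if "f \<in> linexts S' R'" for f
  proof
    have b: "bij_betw f S' {1..card S'}" using that by (simp add: linexts_def)
    have "bij_betw (f \<circ> \<pi>) S {1..card S}" using bij_betw_trans[OF \<pi> b] card by simp
    moreover have "compatible S R (f \<circ> \<pi>)"
      using R[of f] b that by (simp add: linexts_def bij_betw_def)
    ultimately show "?h f \<in> linexts S R" by (simp add: linexts_def del: o_apply)
    show "?k (?h f) = f"
    proof
      fix x show "?k (?h f) x = f x"
        using that bij_betwE[OF inv] bij_betw_inv_into_right[OF \<pi>]
        by (cases "x \<in> S'") (auto simp: linexts_def extensional_def)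
    qed
  qed
  have 2: "?k f \<in> linexts S' R' \<and> ?h (?k f) = f" if "f \<in> linexts S R" for f
  proof
    have b: "bij_betw f S {1..card S}" using that by (simp add: linexts_def)
    have b': "bij_betw (f \<circ> inv_into S \<pi>) S' {1..card S'}" using bij_betw_trans[OF inv b] card
      by simp
    have "compatible S R (f \<circ> inv_into S \<pi> \<circ> \<pi>) = compatible S R f"
      using bij_betw_inv_into_left[OF \<pi>] by (auto simp: compatible_def)
    hence "compatible S' R' (f \<circ> inv_into S \<pi>)"
      using R[of "f \<circ> inv_into S \<pi>"] b' that by (simp add: linexts_def bij_betw_def)
    with b' show "?k f \<in> linexts S' R'" by (simp add: linexts_def del: o_apply)
    show "?h (?k f) = f"
    proof
      fix x show "?h (?k f) x = f x"
        using that bij_betwE[OF \<pi>] bij_betw_inv_into_left[OF \<pi>]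
        by (cases "x \<in> S") (auto simp: linexts_def extensional_def)
    qed
  qed
  have "bij_betw ?h (linexts S' R') (linexts S R)"
    by (rule bij_betw_byWitness[where f' = ?k]) (use 1 2 in blast)+
  thus ?thesis unfolding lin_def by (rule bij_betw_same_card[symmetric])
qed

lemma lin_rev:
  assumes "finite S" shows "lin S R = lin S (R\<inverse>)"
proof -
  let ?h = "\<lambda>f. restrict (\<lambda>x. Suc (card S) - f x) S"
  have sub: "?h f \<in> linexts S (R\<inverse>) \<and> ?h (?h f) = f"
    if f: "f \<in> linexts S R" for R and f :: "'a \<Rightarrow> nat"
  proof
    have b: "bij_betw f S {1..card S}" using f by (simp add: linexts_def)
    have le: "f x \<le> card S" if "x \<in> S" for x using bij_betwE[OF b] that by auto
    have "bij_betw (\<lambda>k. Suc (card S) - k) {1..card S} {1..card S}"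
      by (rule bij_betw_byWitness[where f' = "\<lambda>k. Suc (card S) - k"]) auto
    from bij_betw_trans[OF b this]
    have "bij_betw (?h f) S {1..card S}" by (simp add: comp_def)
    moreover have "compatible S (R\<inverse>) (\<lambda>x. Suc (card S) - f x)"
      unfolding compatible_def
    proof (intro ballI impI)
      fix x y assume xy: "x \<in> S" "y \<in> S" "(x, y) \<in> R\<inverse>"
      hence "f y < f x" using f by (auto simp: linexts_def compatible_def)
      thus "Suc (card S) - f x < Suc (card S) - f y" using le[OF xy(1)] by auto
    qed
    ultimately show "?h f \<in> linexts S (R\<inverse>)" by (simp add: linexts_def)
    have "Suc (card S) - (Suc (card S) - f x) = f x" if "x \<in> S" for x
      using le[OF that] by simp
    thus "?h (?h f) = f" using f by (auto simp: fun_eq_iff linexts_def extensional_def)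
  qed
  have "bij_betw ?h (linexts S R) (linexts S (R\<inverse>))"
  proof (rule bij_betw_byWitness[where f' = ?h])
    show "\<forall>f\<in>linexts S R. ?h (?h f) = f" using sub by blast
    show "\<forall>f\<in>linexts S (R\<inverse>). ?h (?h f) = f" using sub by blast
    show "?h ` linexts S R \<subseteq> linexts S (R\<inverse>)" using sub by blast
    show "?h ` linexts S (R\<inverse>) \<subseteq> linexts S R" using sub[of _ "R\<inverse>"] by auto
  qed
  thus ?thesis unfolding lin_def by (rule bij_betw_same_card)
qed

lemma card_linexts_top:
  assumes "finite S" "x \<in> S" "\<And>y. y \<in> S \<Longrightarrow> (x, y) \<notin> R"
  shows "card {f \<in> linexts S R. f x = card S} = lin (S - {x}) R"
proof -
  have cS: "card (S - {x}) = card S - 1" "card S > 0"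
    using assms by (auto simp: card_gt_0_iff)
  have int: "{1..card S} = insert (card S) {1..card S - 1}" using cS by auto
  have "bij_betw (\<lambda>f. restrict f (S - {x})) {f \<in> linexts S R. f x = card S} (linexts (S - {x}) R)"
  proof (rule bij_betw_byWitness[where f' = "\<lambda>f. f(x := card S)"], goal_cases)
    case 1
    show ?case by (auto simp: linexts_def fun_eq_iff extensional_def)
  next
    case 2
    show ?case by (auto simp: linexts_def fun_eq_iff extensional_def)
  next
    case 3
    have "{1..card S} - {card S} = {1..card S - 1}" using int by auto
    hence "bij_betw f (S - {x}) {1..card S - 1}" if "bij_betw f S {1..card S}" "f x = card S" for f
      using bij_betw_DiffI[OF that(1), of "{x}" "{card S}"] that assms cS
      by (simp add: bij_betw_def)
    hence "bij_betw (restrict f (S - {x})) (S - {x}) {1..card S - 1}"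
      if "bij_betw f S {1..card S}" "f x = card S" for f using that by simp
    thus ?case unfolding linexts_def cS
      by (auto simp: compatible_def simp del: restrict_apply) (auto)
  next
    case 4
    have "bij_betw (f(x := card S)) S {1..card S}" if b: "bij_betw f (S - {x}) {1..card S - 1}"
      for f
    proof -
      have "bij_betw (f(x := card S)) (S - {x}) {1..card S - 1}"
        using b by (auto simp: bij_betw_def inj_on_def)
      moreover have "bij_betw (f(x := card S)) {x} {card S}" by simp
      moreover have "{1..card S - 1} \<inter> {card S} = {}" using cS by auto
      ultimately have "bij_betw (f(x := card S)) ((S - {x}) \<union> {x}) ({1..card S - 1} \<union> {card S})"
        by (rule bij_betw_combine)
      thus ?thesis using int assms by (simp add: insert_absorb)
    qed
    moreover have "compatible S R (f(x := card S))"
      if b: "bij_betw f (S - {x}) {1..card S - 1}" and r: "compatible (S - {x}) R f" for f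
      unfolding compatible_def
    proof (intro ballI impI)
      fix y z assume yz: "y \<in> S" "z \<in> S" "(y, z) \<in> R"
      hence y: "y \<noteq> x" using assms by auto
      have "f y \<in> {1..card S - 1}" using bij_betwE[OF b] y yz by blast
      hence "f y < card S" using cS by auto
      thus "(f(x := card S)) y < (f(x := card S)) z" using y yz r by (auto simp: compatible_def)
    qed
    ultimately show ?case using assms by (auto simp: linexts_def cS extensional_def)
  qed
  thus ?thesis unfolding lin_def by (rule bij_betw_same_card)
qed

text \<open>The greatest label sits on an element without successor in \<open>S\<close>, and
  deleting this element leaves a labelling of the rest.\<close>

lemma lin_remove:
  assumes "finite S" "S \<noteq> {}"
  shows "lin S R = (\<Sum>x | x \<in> S \<and> (\<forall>y\<in>S. (x, y) \<notin> R). lin (S - {x}) R)"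
proof -
  let ?M = "{x \<in> S. \<forall>y\<in>S. (x, y) \<notin> R}"
  have "linexts S R = (\<Union>x\<in>?M. {f \<in> linexts S R. f x = card S})"
  proof (intro equalityI subsetI)
    fix f assume f: "f \<in> linexts S R"
    hence b: "bij_betw f S {1..card S}" by (simp add: linexts_def)
    have "card S \<in> {1..card S}" using assms by (simp add: Suc_le_eq card_gt_0_iff)
    then obtain x where x: "x \<in> S" "f x = card S"
      using b unfolding bij_betw_def by (metis imageE)
    have "(x, y) \<notin> R" if y: "y \<in> S" for y
    proof
      assume "(x, y) \<in> R"
      hence "f x < f y" using f x y by (auto simp: linexts_def compatible_def)
      thus False using bij_betwE[OF b] x y by fastforce
    qed
    thus "f \<in> (\<Union>x\<in>?M. {f \<in> linexts S R. f x = card S})" using x f by auto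
  qed auto
  hence "lin S R = card (\<Union>x\<in>?M. {f \<in> linexts S R. f x = card S})" by (simp add: lin_def)
  also have "\<dots> = (\<Sum>x\<in>?M. card {f \<in> linexts S R. f x = card S})"
  proof (rule card_UN_disjoint)
    show "\<forall>x\<in>?M. finite {f \<in> linexts S R. f x = card S}"
      using finite_linexts[OF assms(1), of R] by auto
    show "\<forall>x\<in>?M. \<forall>y\<in>?M. x \<noteq> y \<longrightarrow>
        {f \<in> linexts S R. f x = card S} \<inter> {f \<in> linexts S R. f y = card S} = {}"
      by (auto simp: linexts_def bij_betw_def inj_on_def)
  qed (use assms in simp)
  also have "\<dots> = (\<Sum>x\<in>?M. lin (S - {x}) R)"
    using card_linexts_top[OF assms(1), where R = R] by (intro sum.cong) auto
  finally show ?thesis .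
qed

text \<open>The relations used here are not transitive, so that \<open>x\<close> is greatest has to
  be expressed through all labellings instead of through pairs in \<open>R\<close>.\<close>

lemma lin_greatest:
  assumes "finite S" "x \<in> S" "\<And>y. y \<in> S \<Longrightarrow> (x, y) \<notin> R"
    and "\<And>f y. \<lbrakk>inj_on f S; compatible S R f; y \<in> S; y \<noteq> x\<rbrakk> \<Longrightarrow> f y < f x"
  shows "lin S R = lin (S - {x}) R"
proof -
  have "f x = card S" if f: "f \<in> linexts S R" for f
  proof -
    have b: "bij_betw f S {1..card S}" and r: "compatible S R f" using f by (auto simp: linexts_def)
    have "card S \<in> {1..card S}" using assms by (auto simp: Suc_le_eq card_gt_0_iff)
    then obtain y where y: "y \<in> S" "f y = card S" using b unfolding bij_betw_def by (metis imageE)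
    have "f x \<le> card S" using bij_betwE[OF b] assms(2) by auto
    moreover have "inj_on f S" using b by (simp add: bij_betw_def)
    ultimately show ?thesis using assms(4)[OF _ r y(1)] y by (cases "y = x") auto
  qed
  hence "{f \<in> linexts S R. f x = card S} = linexts S R" by auto
  with card_linexts_top[OF assms(1-3)] show ?thesis by (simp add: lin_def)
qed

text \<open>A labelling of the union is a shuffle of a labelling of \<open>S\<close> with the chain.
  By induction: the greatest label sits on the end of the chain or on a maximal element of
  \<open>S\<close>, and the two contributions add up by Pascal's rule. On the chain \<open>R\<close>
  contains the covering pairs only.\<close>

lemma lin_chain:
  assumes "finite S" "inj_on c {..<e}" "c ` {..<e} \<inter> S = {}"
    and "\<And>x j. \<lbrakk>x \<in> S; j < e\<rbrakk> \<Longrightarrow> (x, c j) \<notin> R \<and> (c j, x) \<notin> R"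
    and "\<And>j k. \<lbrakk>j < e; k < e\<rbrakk> \<Longrightarrow> (c j, c k) \<in> R \<longleftrightarrow> k = Suc j"
  shows "lin (S \<union> c ` {..<e}) R = (card S + e choose e) * lin S R"
  using assms
proof (induction "card S + e" arbitrary: S e rule: less_induct)
  case less
  note fin = \<open>finite S\<close> and IH = less.hyps and cross = less.prems(4) and chain = less.prems(5)
  let ?C = "c ` {..<e}"
  let ?max = "\<lambda>S. {x \<in> S. \<forall>y\<in>S. (x, y) \<notin> R}"
  show ?case
  proof (cases e)
    case 0
    thus ?thesis by simp
  next
    case (Suc e')
    have C: "?C = insert (c e') (c ` {..<e'})" by (auto simp: Suc lessThan_Suc)
    have e': "c e' \<notin> S" "c e' \<notin> c ` {..<e'}"
      using less.prems(2,3) Suc by (fastforce simp: inj_on_def)+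
    have mx: "?max (S \<union> ?C) = insert (c e') (?max S)"
    proof (intro equalityI subsetI)
      fix x assume x: "x \<in> ?max (S \<union> ?C)"
      show "x \<in> insert (c e') (?max S)"
      proof (cases "x \<in> S")
        case True
        thus ?thesis using x by auto
      next
        case False
        then obtain j where j: "j < e" "x = c j" using x by auto
        have "\<not> Suc j < e" using x j chain[of j "Suc j"] by auto
        thus ?thesis using j Suc by (auto simp: less_Suc_eq)
      qed
    next
      fix x assume "x \<in> insert (c e') (?max S)"
      thus "x \<in> ?max (S \<union> ?C)" using cross chain Suc by auto
    qed
    have "lin (S \<union> ?C) R = lin (S \<union> ?C - {c e'}) R + (\<Sum>x\<in>?max S. lin (S \<union> ?C - {x}) R)"
      using lin_remove[of "S \<union> ?C" R] fin e' C unfolding mx by simp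
    also have "S \<union> ?C - {c e'} = S \<union> c ` {..<e'}" using e' C by auto
    also have "lin \<dots> R = (card S + e' choose e') * lin S R"
    proof (rule IH)
      show "inj_on c {..<e'}" using less.prems(2) Suc by (auto intro: inj_on_subset)
      show "c ` {..<e'} \<inter> S = {}" using less.prems(3) C by auto
    qed (use less.prems(1,4,5) Suc in auto)
    also have "(\<Sum>x\<in>?max S. lin (S \<union> ?C - {x}) R) =
        (\<Sum>x\<in>?max S. (card S - 1 + e choose e) * lin (S - {x}) R)"
    proof (rule sum.cong[OF refl])
      fix x assume x: "x \<in> ?max S"
      have "S \<union> ?C - {x} = (S - {x}) \<union> ?C" using x less.prems(3) by auto
      moreover have "lin ((S - {x}) \<union> ?C) R = (card (S - {x}) + e choose e) * lin (S - {x}) R"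
      proof (rule IH)
        show "card (S - {x}) + e < card S + e" using card_Diff1_less[of S x] x fin by auto
      qed (use x less.prems in auto)
      moreover have "card (S - {x}) = card S - 1" using x fin by simp
      ultimately show "lin (S \<union> ?C - {x}) R = (card S - 1 + e choose e) * lin (S - {x}) R" by simp
    qed
    also have "\<dots> = (card S - 1 + e choose e) * (\<Sum>x\<in>?max S. lin (S - {x}) R)"
      by (simp add: sum_distrib_left)
    also have "\<dots> = (if S = {} then 0 else (card S - 1 + e choose e) * lin S R)"
      using lin_remove[OF fin, of R] by auto
    also have "(card S + e' choose e') * lin S R + \<dots> = (card S + e choose e) * lin S R"
    proof (cases "S = {}")
      case False
      then obtain s where "card S = Suc s" using fin by (cases "card S") auto
      thus ?thesis using False Suc by (simp add: algebra_simps)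
    qed (simp add: Suc)
    finally show ?thesis .
  qed
qed

lemma lin_empty [simp]: "lin {} R = 1"
proof -
  have "linexts {} R = {\<lambda>_. undefined}" by (auto simp: linexts_def compatible_def bij_betw_def)
  thus ?thesis by (simp add: lin_def)
qed

section \<open>Skew shapes as posets\<close>

text \<open>The cells \<open>Up j\<close> and \<open>Lo j\<close> with \<open>j \<le> k\<close> form the two common rows of a shape with last
  column \<open>k\<close>, the cells \<open>Up j\<close> with \<open>j > k\<close> continue this column upwards, and the cells \<open>Tl j\<close>
  continue column 0 downwards. Orders are given by generating relations whose pairs outside of
  the set of cells at hand are ignored, so the relations need not be bounded.\<close>

datatype cell = Up nat | Lo nat | Tl nat

definition cells :: "nat \<Rightarrow> nat \<Rightarrow> nat \<Rightarrow> cell set" where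
  "cells a b t = Up ` {..<a} \<union> Lo ` {..<b} \<union> Tl ` {..<t}"

lemma mem_cells [simp]:
  "Up j \<in> cells a b t \<longleftrightarrow> j < a" "Lo j \<in> cells a b t \<longleftrightarrow> j < b" "Tl j \<in> cells a b t \<longleftrightarrow> j < t"
  by (auto simp: cells_def)

lemma ball_cells:
  "(\<forall>x\<in>cells a b t. P x) \<longleftrightarrow> (\<forall>j<a. P (Up j)) \<and> (\<forall>j<b. P (Lo j)) \<and> (\<forall>j<t. P (Tl j))"
  by (auto simp: cells_def)

lemma finite_cells [simp]: "finite (cells a b t)"
  by (simp add: cells_def)

lemma card_cells [simp]: "card (cells a b t) = a + b + t"
proof -
  have "card (cells a b t) = card (Up ` {..<a} \<union> Lo ` {..<b}) + card (Tl ` {..<t})"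
    unfolding cells_def by (rule card_Un_disjoint) auto
  also have "card (Up ` {..<a} \<union> Lo ` {..<b}) = card (Up ` {..<a}) + card (Lo ` {..<b})"
    by (rule card_Un_disjoint) auto
  finally show ?thesis by (simp add: card_image inj_on_def)
qed

lemma compatible_Un: "compatible S (R \<union> R') f \<longleftrightarrow> compatible S R f \<and> compatible S R' f"
  by (auto simp: compatible_def)

lemma compatible_insert':
  "compatible S (insert (x, y) R) f \<longleftrightarrow> (x \<in> S \<longrightarrow> y \<in> S \<longrightarrow> f x < f y) \<and> compatible S R f"
  by (auto simp: compatible_def)

lemma compatible_Collect:
  "compatible S {(p j, q j) |j. P j} f \<longleftrightarrow> (\<forall>j. P j \<longrightarrow> p j \<in> S \<longrightarrow> q j \<in> S \<longrightarrow> f (p j) < f (q j))"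
  by (auto simp: compatible_def)

lemma compatible_empty: "compatible S {} f"
  by (auto simp: compatible_def)

definition tail_rel :: "(cell \<times> cell) set" where
  "tail_rel = insert (Lo 0, Tl 0) {(Tl j, Tl (Suc j)) |j. True}"

lemma compatible_tail_rel:
  "compatible S tail_rel f \<longleftrightarrow> (Lo 0 \<in> S \<longrightarrow> Tl 0 \<in> S \<longrightarrow> f (Lo 0) < f (Tl 0)) \<and>
     (\<forall>j. Tl j \<in> S \<longrightarrow> Tl (Suc j) \<in> S \<longrightarrow> f (Tl j) < f (Tl (Suc j)))"
  by (auto simp: tail_rel_def compatible_def)

lemmas compatible_simps =
  compatible_Un compatible_insert' compatible_Collect compatible_empty compatible_tail_rel

definition skew_rel :: "nat \<Rightarrow> nat \<Rightarrow> (cell \<times> cell) set" where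
  "skew_rel k v = {(Up j, Up (Suc j)) |j. j < k} \<union> {(Up (Suc j), Up j) |j. k \<le> j \<and> j < v}
     \<union> {(Lo j, Lo (Suc j)) |j. j < k} \<union> {(Up j, Lo j) |j. j \<le> k} \<union> tail_rel"

text \<open>The left column \<open>Up 0, Lo 0, Tl 0, ...\<close> has \<open>m + 1\<close> cells if
  \<open>m \<ge> 1\<close>, and the right column, from \<open>Up v\<close> down to
  \<open>Lo k\<close>, has \<open>v - k + 2\<close> cells.\<close>

definition sk :: "nat \<Rightarrow> nat \<Rightarrow> nat \<Rightarrow> nat" where
  "sk m k v = lin (cells (Suc v) (Suc k) (m - 1)) (skew_rel k v)"

section \<open>Tableaux as linear extensions\<close>

definition table_rel :: "((int \<times> nat) \<times> (int \<times> nat)) set" where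
  "table_rel = {((r, c), (r', c')). r = r' \<and> c < c' \<or> c = c' \<and> r < r'}"

lemma chain_less_nat:
  fixes g :: "nat \<Rightarrow> nat"
  assumes "\<And>j. \<lbrakk>a \<le> j; j < b\<rbrakk> \<Longrightarrow> g j < g (Suc j)" "a \<le> x" "x < y" "y \<le> b"
  shows "g x < g y"
  using assms(3,4)
proof (induction y rule: less_induct)
  case (less y)
  then obtain z where z: "y = Suc z" by (cases y) auto
  have "g z < g y" using assms less z by auto
  thus ?case using less z by (cases "x = z") (auto intro: less_trans[of _ "g z"])
qed

lemma chain_less_int:
  fixes g :: "int \<Rightarrow> nat"
  assumes "\<And>j. \<lbrakk>a \<le> j; j < b\<rbrakk> \<Longrightarrow> g j < g (j + 1)" "a \<le> x" "x < y" "y \<le> b"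
  shows "g x < g y"
proof -
  have "g (a + int (nat (x - a))) < g (a + int (nat (y - a)))"
    by (rule chain_less_nat[where g = "\<lambda>n. g (a + int n)" and a = 0 and b = "nat (b - a)"])
      (use assms(1)[of "a + int _"] assms(2-4) in \<open>auto simp: algebra_simps\<close>)
  thus ?thesis using assms by simp
qed

lemma finite_skew_shape [simp]: "finite (skew_shape a i b)"
  by (simp add: skew_shape_def)

lemma card_skew_shape:
  assumes "a \<ge> 1" "b \<ge> 0" "i \<ge> 1"
  shows "card (skew_shape a i b) = nat (a + b + 2 * int i - 2)"
proof -
  have "card (skew_shape a i b) = card ({0..a - 1} \<times> {0::nat} \<union> {0..1} \<times> {1..<i})
    + card ({2 - b..1} \<times> {i})"
    unfolding skew_shape_def using assms by (intro card_Un_disjoint) auto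
  also have "card ({0..a - 1} \<times> {0::nat} \<union> {0..1::int} \<times> {1..<i}) =
      card ({0..a - 1} \<times> {0::nat}) + card ({0..1::int} \<times> {1..<i})"
    by (intro card_Un_disjoint) auto
  finally show ?thesis using assms by (simp add: card_cartesian_product nat_add_distrib)
qed

lemma Skyt_eq_linexts:
  assumes "a \<ge> 1" "b \<ge> 0" "i \<ge> 1"
  shows "Skyt a i b = linexts (skew_shape a i b) table_rel"
proof -
  have "compatible (skew_shape a i b) table_rel T \<longleftrightarrow>
      (\<forall>r c c'. (r, c) \<in> skew_shape a i b \<and> (r, c') \<in> skew_shape a i b \<and> c < c' \<longrightarrow>
         T (r, c) < T (r, c')) \<and>
      (\<forall>r r' c. (r, c) \<in> skew_shape a i b \<and> (r', c) \<in> skew_shape a i b \<and> r < r' \<longrightarrow>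
         T (r, c) < T (r', c))" for T
    unfolding compatible_def table_rel_def by (auto simp del: split_paired_All)
  thus ?thesis
    unfolding Skyt_def linexts_def card_skew_shape[OF assms, symmetric] by blast
qed

text \<open>\<open>\<rho>\<close> and \<open>\<pi>\<close> translate between coordinates and cells.
  \<open>skew_rel\<close> only relates neighbours; the conditions on arbitrary pairs follow along
  chains of neighbours, which stay in the shape since its rows and columns are intervals.\<close>

lemma skyt_eq_sk:
  assumes "m \<ge> 1" "k \<ge> 1" "k \<le> v"
  shows "card (Skyt (int m + 1) k (int v - int k + 2)) = sk m k v"
proof -
  let ?S = "skew_shape (int m + 1) k (int v - int k + 2)" and ?C = "cells (Suc v) (Suc k) (m - 1)"
  define \<rho> :: "int \<times> nat \<Rightarrow> cell" where
    "\<rho> = (\<lambda>(r, c). if r \<ge> 2 then Tl (nat (r - 2)) else if r = 1 then Lo c else Up (c + nat (- r)))"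
  define \<pi> :: "cell \<Rightarrow> int \<times> nat" where
    "\<pi> x = (case x of Up j \<Rightarrow> if j \<le> k then (0, j) else (int k - int j, k) | Lo j \<Rightarrow> (1, j)
        | Tl j \<Rightarrow> (2 + int j, 0))" for x
  have \<pi>S: "\<forall>x\<in>?C. \<pi> x \<in> ?S" using assms by (auto simp: ball_cells skew_shape_def \<pi>_def)
  have \<rho>\<pi>: "\<forall>x\<in>?C. \<rho> (\<pi> x) = x"
    using assms by (auto simp: ball_cells \<rho>_def \<pi>_def nat_diff_distrib)
  have \<rho>: "bij_betw \<rho> ?S ?C"
  proof (rule bij_betw_byWitness[where f' = \<pi>])
    show "\<forall>x\<in>?S. \<pi> (\<rho> x) = x" using assms by (auto simp: skew_shape_def \<rho>_def \<pi>_def)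
    show "\<rho> ` ?S \<subseteq> ?C" using assms by (auto simp: skew_shape_def \<rho>_def)
  qed (use \<rho>\<pi> \<pi>S in auto)
  have "lin ?S table_rel = lin ?C (skew_rel k v)"
  proof (rule lin_iso[OF \<rho>])
    fix f :: "cell \<Rightarrow> nat"
    let ?g = "\<lambda>r c. f (\<rho> (r, c))"
    show "compatible ?S table_rel (f \<circ> \<rho>) = compatible ?C (skew_rel k v) f"
    proof
      assume L: "compatible ?S table_rel (f \<circ> \<rho>)"
      have "f x < f y" if xy: "x \<in> ?C" "y \<in> ?C" "(\<pi> x, \<pi> y) \<in> table_rel" for x y
      proof -
        have "(f \<circ> \<rho>) (\<pi> x) < (f \<circ> \<rho>) (\<pi> y)"
          using L \<pi>S xy unfolding compatible_def by blast
        thus ?thesis using \<rho>\<pi> xy by simp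
      qed
      moreover have "(\<pi> x, \<pi> y) \<in> table_rel" if "x \<in> ?C" "y \<in> ?C" "(x, y) \<in> skew_rel k v" for x y
        using that by (auto simp: skew_rel_def tail_rel_def \<pi>_def table_rel_def split: if_splits)
      ultimately show "compatible ?C (skew_rel k v) f" by (auto simp: compatible_def)
    next
      assume R: "compatible ?C (skew_rel k v) f"
      have row0: "?g 0 c < ?g 0 (Suc c)" if "c < k" for c
        using R that assms by (auto simp: skew_rel_def compatible_simps \<rho>_def)
      have row1: "?g 1 c < ?g 1 (Suc c)" if "c < k" for c
        using R that assms by (auto simp: skew_rel_def compatible_simps \<rho>_def)
      have mid: "?g 0 c < ?g 1 c" if "c \<le> k" for c
        using R that assms by (auto simp: skew_rel_def compatible_simps \<rho>_def)
      have col0: "?g r 0 < ?g (r + 1) 0" if r: "0 \<le> r" "r < int m" for r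
      proof -
        consider "r = 0" | "r = 1" | "r \<ge> 2" using r by linarith
        thus ?thesis
        proof cases
          case 3
          have "f (Tl (nat (r - 2))) < f (Tl (Suc (nat (r - 2))))"
            using R r 3 by (auto simp: skew_rel_def compatible_simps)
          moreover have "Suc (nat (r - 2)) = nat (r - 1)" using 3 by auto
          ultimately show ?thesis using 3 by (simp add: \<rho>_def)
        qed (use R r mid[of 0] in \<open>auto simp: skew_rel_def compatible_simps \<rho>_def\<close>)
      qed
      have colk: "?g r k < ?g (r + 1) k" if "int k - int v \<le> r" "r < 1" for r
      proof (cases "r = 0")
        case True
        thus ?thesis using mid[of k] by simp
      next
        case False
        have "f (Up (Suc (k + nat (- r - 1)))) < f (Up (k + nat (- r - 1)))"
          using R that False by (auto simp: skew_rel_def compatible_simps)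
        moreover have "Suc (k + nat (- r - 1)) = k + nat (- r)" using that False by auto
        moreover have "\<rho> (r, k) = Up (k + nat (- r))" "\<rho> (r + 1, k) = Up (k + nat (- r - 1))"
          using that False by (auto simp: \<rho>_def)
        ultimately show ?thesis by simp
      qed
      show "compatible ?S table_rel (f \<circ> \<rho>)"
        unfolding compatible_def
      proof (intro ballI impI, clarsimp simp: table_rel_def)
        fix r c r' c' assume S: "(r, c) \<in> ?S" "(r', c') \<in> ?S"
          and "r = r' \<and> c < c' \<or> c = c' \<and> r < r'"
        then consider "r = r'" "c < c'" | "c = c'" "r < r'" by blast
        thus "?g r c < ?g r' c'"
        proof cases
          case 1
          have "r = 0 \<or> r = 1" "c' \<le> k" using S 1 assms by (auto simp: skew_shape_def)
          moreover have "?g 0 c < ?g 0 c'"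
            by (rule chain_less_nat[where a = 0 and b = k and g = "?g 0"])
              (use row0 1 \<open>c' \<le> k\<close> in simp_all)
          moreover have "?g 1 c < ?g 1 c'"
            by (rule chain_less_nat[where a = 0 and b = k and g = "?g 1"])
              (use row1 1 \<open>c' \<le> k\<close> in simp_all)
          ultimately show ?thesis using 1 by auto
        next
          case 2
          consider "c = 0" | "c = k" "c \<noteq> 0" | "0 < c" "c < k" using S assms
            by (auto simp: skew_shape_def)
          thus ?thesis
          proof cases
            case 1
            have "?g r 0 < ?g r' 0"
              by (rule chain_less_int[where a = 0 and b = "int m" and g = "\<lambda>r. ?g r 0"])
                (use col0 S 1 2 assms in \<open>auto simp: skew_shape_def\<close>)
            thus ?thesis using 1 2 by simp
          next
            case c: 2
            have "?g r k < ?g r' k"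
              by (rule chain_less_int[where a = "int k - int v" and b = 1 and g = "\<lambda>r. ?g r k"])
                (use colk S c 2 assms in \<open>auto simp: skew_shape_def\<close>)
            thus ?thesis using c 2 by simp
          next
            case 3
            hence "r = 0" "r' = 1" using S 2 by (auto simp: skew_shape_def)
            thus ?thesis using mid[of c] 2 3 by auto
          qed
        qed
      qed
    qed
  qed
  moreover have "Skyt (int m + 1) k (int v - int k + 2) = linexts ?S table_rel"
    by (rule Skyt_eq_linexts) (use assms in auto)
  ultimately show ?thesis by (simp only: lin_def sk_def)
qed


text \<open>In the applications \<open>H v\<close> counts labellings with one pair of elements left
  uncompared, and \<open>V v\<close> and \<open>V (Suc v)\<close> are the two outcomes of comparing
  them. At \<open>v = n\<close> nothing is left to compare.\<close>

lemma alternating_telescope: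
  fixes H V :: "nat \<Rightarrow> int"
  assumes "k \<le> n" "\<And>v. \<lbrakk>k \<le> v; v < n\<rbrakk> \<Longrightarrow> H v = V v + V (Suc v)" "H n = V n"
  shows "(\<Sum>v=k..n. (-1) ^ (n - v) * H v) = (-1) ^ (n - k) * V k"
  using assms
proof (induction k rule: inc_induct)
  case (step k)
  have "(\<Sum>v=k..n. (-1) ^ (n - v) * H v)
    = (-1) ^ (n - k) * H k + (\<Sum>v=Suc k..n. (-1) ^ (n - v) * H v)"
    using step.hyps by (simp add: sum.atLeast_Suc_atMost)
  also have "(\<Sum>v=Suc k..n. (-1) ^ (n - v) * H v) = (-1) ^ (n - Suc k) * V (Suc k)"
    using step by simp
  also have "(-1) ^ (n - Suc k) = - ((-1) ^ (n - k) :: int)"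
    using step.hyps by (simp flip: Suc_diff_Suc)
  finally show ?case using step by (simp add: algebra_simps)
qed simp

lemma skyt_eq:
  assumes "m \<ge> 1" "k \<ge> 1"
  shows "skyt (int m + 1) k (int l - 2 * int k + 1) = (if 2 * k < l then sk m k (l - k - 1) else 0)"
proof (cases "2 * k < l")
  case True
  hence "int (l - k - 1) - int k + 2 = int l - 2 * int k + 1" by simp
  thus ?thesis using skyt_eq_sk[of m k "l - k - 1"] assms True by (simp only: skyt_def) auto
qed (use assms in \<open>auto simp: skyt_def\<close>)

text \<open>If the left column has height 2, the entry 1 can only stand at \<open>(0, 0)\<close> or
  on top of the right column. In the second case, deleting it leaves a tableau whose right column is
  shorter by one.\<close>

lemma skyt_bar_eq:
  assumes "i \<ge> 1" "b \<ge> 2"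
  shows "int (skyt_bar i b) = int (skyt 2 i b) - int (skyt 2 i (b - 1))"
proof -
  let ?S = "skew_shape 2 i b" and ?t = "(2 - b, i)" and ?o = "(0, 0) :: int \<times> nat"
  have S: "?o \<in> ?S" "?t \<in> ?S" using assms by (auto simp: skew_shape_def)
  \<comment> \<open>Stated for all compatible labellings, not only for bijections, because it is
    applied to a reversed labelling below.\<close>
  have ge: "x = ?o \<or> x = ?t \<or> f ?o < f x \<or> f ?t < f x"
    if f: "compatible ?S table_rel f" and xS: "x \<in> ?S" for f x
  proof -
    obtain r c where x: "x = (r, c)" by (cases x)
    have lt: "f y < f z" if "y \<in> ?S" "z \<in> ?S" "(y, z) \<in> table_rel" for y z
      using that f by (auto simp: compatible_def)
    consider "c = 0" "r \<ge> 0" | "c = i" "r \<ge> 2 - b" | "0 < c" "r = 0" | "0 < c" "c < i" "r = 1"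
      using xS assms x by (fastforce simp: skew_shape_def)
    thus ?thesis
    proof cases
      case 4
      hence "f ?o < f (1, 0)" "f (1, 0) < f (r, c)"
        using xS x assms by (auto intro!: lt simp: table_rel_def skew_shape_def)
      thus ?thesis using x by simp
    qed (use lt[of ?o x] lt[of ?t x] S xS x in \<open>auto simp: table_rel_def\<close>)
  qed
  have lin_S: "skyt 2 i b = lin ?S table_rel"
    using assms by (simp add: skyt_def Skyt_eq_linexts lin_def)
  \<comment> \<open>Carrying the entry 1 at \<open>?o\<close> amounts to the single comparison of
    \<open>?o\<close> with \<open>?t\<close>, so that \<open>lin_split\<close> applies.\<close>
  have "{T \<in> linexts ?S table_rel. T ?o = 1} = linexts ?S (insert (?o, ?t) table_rel)"
  proof (intro equalityI subsetI)
    fix T assume T: "T \<in> {T \<in> linexts ?S table_rel. T ?o = 1}"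
    hence b: "bij_betw T ?S {1..card ?S}" by (simp add: linexts_def)
    hence "T ?t \<ge> 1" using S(2) bij_betwE by fastforce
    moreover have "?o \<noteq> ?t" using assms by simp
    hence "T ?o \<noteq> T ?t" using b S unfolding bij_betw_def by (meson inj_onD)
    ultimately have "T ?o < T ?t" using T by auto
    thus "T \<in> linexts ?S (insert (?o, ?t) table_rel)"
      using T by (auto simp: linexts_def compatible_insert')
  next
    fix T assume T: "T \<in> linexts ?S (insert (?o, ?t) table_rel)"
    hence b: "bij_betw T ?S {1..card ?S}" and c: "compatible ?S table_rel T" and "T ?o < T ?t"
      using S by (auto simp: linexts_def compatible_insert')
    have "card ?S > 0" using S by (auto simp: card_gt_0_iff)
    hence "1 \<in> T ` ?S" using b by (simp add: bij_betw_def)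
    then obtain x where x: "x \<in> ?S" "T x = 1" by auto
    have "T ?o \<ge> 1" using bij_betwE[OF b] S by auto
    hence "x = ?o" using ge[OF c x(1)] x(2) \<open>T ?o < T ?t\<close> by auto
    thus "T \<in> {T \<in> linexts ?S table_rel. T ?o = 1}"
      using T x by (auto simp: linexts_def compatible_insert')
  qed
  hence bar: "skyt_bar i b = lin ?S (insert (?o, ?t) table_rel)"
    using assms by (simp add: skyt_bar_def Skyt_bar_def Skyt_eq_linexts lin_def)
  have "lin ?S (insert (?t, ?o) table_rel) = skyt 2 i (b - 1)"
  proof (cases "b = 2")
    case True
    \<comment> \<open>For \<open>b = 2\<close> both cells lie in row 0, so the order with
      \<open>?t\<close> before \<open>?o\<close> is contradictory; the count 0 agrees with the
      convention for \<open>skyt 2 i 1\<close>.\<close>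
    hence ot: "(?o, ?t) \<in> table_rel" using assms by (simp add: table_rel_def)
    have "\<not> compatible ?S (insert (?t, ?o) table_rel) f" for f
    proof
      assume f: "compatible ?S (insert (?t, ?o) table_rel) f"
      hence "f ?t < f ?o" "f ?o < f ?t" using S ot unfolding compatible_def by blast+
      thus False by simp
    qed
    hence "linexts ?S (insert (?t, ?o) table_rel) = {}" by (auto simp: linexts_def)
    thus ?thesis using True assms by (simp add: lin_def skyt_def)
  next
    case False
    let ?R = "insert (?t, ?o) table_rel"
    \<comment> \<open>Here \<open>?t\<close> is the least cell. Reversal makes it the greatest one,
      which \<open>lin_greatest\<close> deletes, and a second reversal restores the order.\<close>
    have "lin ?S ?R = lin ?S (?R\<inverse>)" by (rule lin_rev) simp
    also have "\<dots> = lin (?S - {?t}) (?R\<inverse>)"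
    proof (rule lin_greatest)
      show "(?t, y) \<notin> ?R\<inverse>" if "y \<in> ?S" for y
        using that assms False by (auto simp: table_rel_def skew_shape_def)
      fix f :: "int \<times> nat \<Rightarrow> nat" and y
      assume f: "inj_on f ?S" "compatible ?S (?R\<inverse>) f" and y: "y \<in> ?S" "y \<noteq> ?t"
      \<comment> \<open>\<open>f\<close> obeys the converse relation, whereas \<open>ge\<close> is
        about \<open>table_rel\<close>; \<open>g\<close> turns \<open>f\<close> around without
        leaving the natural numbers.\<close>
      define g where "g x = Max (f ` ?S) - f x" for x
      have le: "f x \<le> Max (f ` ?S)" if "x \<in> ?S" for x using that by simp
      have gl: "g x < g z \<longleftrightarrow> f z < f x" if "x \<in> ?S" "z \<in> ?S" for x z
        using le[OF that(1)] le[OF that(2)] by (auto simp: g_def)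
      have f': "f w < f z" if "z \<in> ?S" "w \<in> ?S" "(z, w) \<in> ?R" for z w
        using f(2) that unfolding compatible_def by blast
      have "compatible ?S table_rel g" "g ?t < g ?o"
        using f' gl S unfolding compatible_def by blast+
      from ge[OF this(1) y(1)] this(2) y(2) have "g ?t < g y" by auto
      thus "f y < f ?t" using gl[OF S(2) y(1)] by blast
    qed (rule finite_skew_shape S)+
    also have "\<dots> = lin (?S - {?t}) ?R" by (rule lin_rev[symmetric]) simp
    also have "\<dots> = lin (skew_shape 2 i (b - 1)) table_rel"
    proof (rule lin_cong)
      show "?S - {?t} = skew_shape 2 i (b - 1)" using assms False by (auto simp: skew_shape_def)
      show "compatible (skew_shape 2 i (b - 1)) ?R f =
          compatible (skew_shape 2 i (b - 1)) table_rel f" for f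
        using assms by (simp add: compatible_insert') (simp add: skew_shape_def)
    qed
    finally show ?thesis using assms False by (simp add: skyt_def Skyt_eq_linexts lin_def)
  qed
  moreover have "?o \<noteq> ?t" using assms by simp
  ultimately show ?thesis using lin_split[OF finite_skew_shape S, of table_rel] lin_S bar by simp
qed

section \<open>The recursion for skew tableaux\<close>

lemma lin_single_chain:
  assumes "inj_on c {..<n}" "\<And>j k. \<lbrakk>j < n; k < n\<rbrakk> \<Longrightarrow> (c j, c k) \<in> R \<longleftrightarrow> k = Suc j"
  shows "lin (c ` {..<n}) R = 1"
  using lin_chain[of "{}" c n R] assms by simp

lemma sk_0: "m \<ge> 1 \<Longrightarrow> sk m 0 v = 1"
proof -
  assume m: "m \<ge> 1"
  define c where "c j = (if j \<le> v then Up (v - j) else if j = Suc v then Lo 0 else Tl (j - v - 2))"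
    for j
  have "cells (Suc v) (Suc 0) (m - 1) = c ` {..<v + m + 1}"
  proof (intro equalityI subsetI)
    fix x assume "x \<in> cells (Suc v) (Suc 0) (m - 1)"
    then consider j where "x = Up j" "j \<le> v" | "x = Lo 0" | j where "x = Tl j" "j < m - 1"
      by (auto simp: cells_def less_Suc_eq_le)
    thus "x \<in> c ` {..<v + m + 1}"
    proof cases
      case (1 j)
      thus ?thesis by (intro image_eqI[of _ _ "v - j"]) (auto simp: c_def)
    next
      case 2
      thus ?thesis using m by (intro image_eqI[of _ _ "Suc v"]) (auto simp: c_def)
    next
      case (3 j)
      thus ?thesis by (intro image_eqI[of _ _ "v + 2 + j"]) (auto simp: c_def)
    qed
  qed (use m in \<open>auto simp: c_def\<close>)
  moreover have "lin (c ` {..<v + m + 1}) (skew_rel 0 v) = 1"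
    by (rule lin_single_chain)
      (auto simp: c_def inj_on_def skew_rel_def tail_rel_def split: if_splits)
  ultimately show ?thesis by (simp add: sk_def)
qed

section \<open>The inner alternating sum\<close>

definition valley_rel :: "nat \<Rightarrow> nat \<Rightarrow> (cell \<times> cell) set" where
  "valley_rel k v = skew_rel k v \<union> {(Up j, Up (Suc j)) |j. v \<le> j}"

text \<open>The binomial coefficient shuffles a detached chain
  \<open>Up (v + 1) < ... < Up (i - 1)\<close> into a skew shape whose right column ends in
  \<open>Up v\<close>. Comparing \<open>Up v\<close> with \<open>Up (v + 1)\<close> either starts an
  ascent at \<open>Up v\<close> or prolongs the descending column by one cell. The telescope ends
  with the poset whose upper row ascends throughout.\<close>

lemma alternating_sk:
  assumes "m \<ge> 1" "k < i"
  shows "(\<Sum>v=k..i - 1. (-1) ^ (i - 1 - v) * int ((m + i + k choose (i - 1 - v)) * sk m k v))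
    = (-1) ^ (i - 1 - k) * int (lin (cells i (Suc k) (m - 1)) (valley_rel k k))"
proof -
  let ?S = "cells i (Suc k) (m - 1)"
  define hook_rel where
    "hook_rel v = skew_rel k v \<union> {(Up j, Up (Suc j)) |j. v < j}" for v
  have H: "lin ?S (hook_rel v) = (m + i + k choose (i - 1 - v)) * sk m k v" if v: "k \<le> v" "v < i"
    for v
  proof -
    let ?T = "cells (Suc v) (Suc k) (m - 1)" and ?c = "\<lambda>j. Up (Suc v + j)" and ?e = "i - 1 - v"
    have "lin (?T \<union> ?c ` {..<?e}) (hook_rel v) = (card ?T + ?e choose ?e) * lin ?T (hook_rel v)"
    proof (rule lin_chain)
      show "(x, ?c j) \<notin> hook_rel v \<and> (?c j, x) \<notin> hook_rel v" if "x \<in> ?T" "j < ?e" for x j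
        using that v by (auto simp: hook_rel_def skew_rel_def tail_rel_def)
      show "(?c j, ?c j') \<in> hook_rel v \<longleftrightarrow> j' = Suc j" if "j < ?e" "j' < ?e" for j j'
        using that v by (auto simp: hook_rel_def skew_rel_def tail_rel_def)
    qed (auto simp: inj_on_def)
    moreover have "?T \<union> ?c ` {..<?e} = ?S"
    proof (intro equalityI subsetI)
      fix x assume x: "x \<in> ?S"
      show "x \<in> ?T \<union> ?c ` {..<?e}"
      proof (cases x)
        case (Up j)
        thus ?thesis using x by (cases "j \<le> v") (auto intro!: image_eqI[of _ _ "j - Suc v"])
      qed (use x in auto)
    qed (use v in \<open>auto simp: cells_def\<close>)
    moreover have "card ?T + ?e = m + i + k" using v assms by simp
    moreover have "lin ?T (hook_rel v) = sk m k v"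
      unfolding sk_def by (rule lin_cong) (auto simp: hook_rel_def compatible_simps)
    ultimately show ?thesis by (simp only:)
  qed
  have step: "lin ?S (hook_rel v) = lin ?S (valley_rel k v) + lin ?S (valley_rel k (Suc v))"
    if v: "k \<le> v" "Suc v < i" for v
  proof -
    have "insert (Up v, Up (Suc v)) (hook_rel v) = valley_rel k v"
      by (auto simp: hook_rel_def valley_rel_def le_less)
    moreover have "insert (Up (Suc v), Up v) (hook_rel v) = valley_rel k (Suc v)"
      using v by (auto simp: hook_rel_def valley_rel_def skew_rel_def less_Suc_eq)
    ultimately show ?thesis using lin_split[of ?S "Up v" "Up (Suc v)" "hook_rel v"] v by simp
  qed
  have last: "lin ?S (hook_rel (i - 1)) = lin ?S (valley_rel k (i - 1))"
    by (rule lin_cong) (auto simp: hook_rel_def valley_rel_def compatible_simps)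
  have "(\<Sum>v=k..i - 1. (-1) ^ (i - 1 - v) * int (lin ?S (hook_rel v)))
    = (-1) ^ (i - 1 - k) * int (lin ?S (valley_rel k k))"
    using assms step last by (intro alternating_telescope) auto
  moreover have "(\<Sum>v=k..i - 1. (-1) ^ (i - 1 - v) * int (lin ?S (hook_rel v)))
    = (\<Sum>v=k..i - 1. (-1) ^ (i - 1 - v) * int ((m + i + k choose (i - 1 - v)) * sk m k v))"
    by (rule sum.cong) (use H assms in auto)
  ultimately show ?thesis by simp
qed

text \<open>Let \<open>N k\<close>, \<open>W k p\<close> and \<open>G k\<close> count the linear extensions of \<open>free_rel k\<close>, \<open>peak_rel k p\<close> and
  \<open>gap_rel k\<close>. Then \<open>N k = z k + z (Suc k)\<close> for \<open>z k = W k k - G k\<close>, so that the alternating sum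
  of the numbers \<open>N k\<close> telescopes. All these orders live on the same cells: a column placed on the
  last cell of the lower row is the descending part of the sequence \<open>Lo 0, Lo 1, \<dots>\<close>.\<close>

definition free_rel :: "nat \<Rightarrow> (cell \<times> cell) set" where
  "free_rel k = {(Up j, Up (Suc j)) |j. True} \<union> {(Lo j, Lo (Suc j)) |j. j < k}
     \<union> {(Lo (Suc j), Lo j) |j. k < j} \<union> {(Up j, Lo j) |j. j \<le> k} \<union> tail_rel"

definition peak_rel :: "nat \<Rightarrow> nat \<Rightarrow> (cell \<times> cell) set" where
  "peak_rel k p = {(Up j, Up (Suc j)) |j. True} \<union> {(Lo j, Lo (Suc j)) |j. j < k}
     \<union> {(Lo (Suc j), Lo j) |j. k \<le> j} \<union> {(Up j, Lo j) |j. j < p} \<union> tail_rel"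

definition cross_rel :: "nat \<Rightarrow> (cell \<times> cell) set" where
  "cross_rel k = insert (Lo k, Up k) (peak_rel k k)"

text \<open>The set comprehension accounts for \<open>k = 0\<close>, where there is no cell
  \<open>Up (k - 1)\<close> and nothing is added to \<open>cross_rel 0\<close>.\<close>

definition gap_rel :: "nat \<Rightarrow> (cell \<times> cell) set" where
  "gap_rel k = cross_rel k \<union> {(Lo (Suc (Suc j)), Up j) |j. Suc j = k}"

lemma compatible_peak_rel:
  "compatible (cells a b t) (peak_rel k p) f \<longleftrightarrow>
     (\<forall>j. Suc j < a \<longrightarrow> f (Up j) < f (Up (Suc j))) \<and>
     (\<forall>j<k. Suc j < b \<longrightarrow> f (Lo j) < f (Lo (Suc j))) \<and>
     (\<forall>j\<ge>k. Suc j < b \<longrightarrow> f (Lo (Suc j)) < f (Lo j)) \<and>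
     (\<forall>j<p. j < a \<longrightarrow> j < b \<longrightarrow> f (Up j) < f (Lo j)) \<and> compatible (cells a b t) tail_rel f"
  by (auto simp: peak_rel_def compatible_Un compatible_def)

lemma compatible_cross_rel:
  "compatible (cells a b t) (cross_rel k) f \<longleftrightarrow>
     (k < a \<longrightarrow> k < b \<longrightarrow> f (Lo k) < f (Up k)) \<and> compatible (cells a b t) (peak_rel k k) f"
  by (auto simp: cross_rel_def compatible_insert')

lemma compatible_gap_rel:
  "compatible (cells a b t) (gap_rel k) f \<longleftrightarrow>
     (k \<ge> 1 \<longrightarrow> k - 1 < a \<longrightarrow> Suc k < b \<longrightarrow> f (Lo (Suc k)) < f (Up (k - 1))) \<and>
     compatible (cells a b t) (cross_rel k) f"
  unfolding gap_rel_def compatible_Un compatible_Collect mem_cells by (cases k) auto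

text \<open>For peak 0 the lower row descends throughout and continues into the tail. It is a single
  chain of \<open>e + m\<close> cells, unrelated to the \<open>i\<close> cells of the upper
  row.\<close>

lemma lin_peak_0:
  assumes "m \<ge> 1"
  shows "lin (cells i (Suc e) (m - 1)) (peak_rel 0 0) = (i + e + m choose i)"
proof -
  define c where "c j = (if j \<le> e then Lo (e - j) else Tl (j - e - 1))" for j
  let ?T = "cells 0 (Suc e) (m - 1)"
  have T: "?T = c ` {..<e + m}"
  proof (intro equalityI subsetI)
    fix x assume "x \<in> ?T"
    then consider j where "x = Lo j" "j \<le> e" | j where "x = Tl j" "j < m - 1"
      by (auto simp: cells_def less_Suc_eq_le)
    thus "x \<in> c ` {..<e + m}"
    proof cases
      case (1 j)
      thus ?thesis using assms by (intro image_eqI[of _ _ "e - j"]) (auto simp: c_def)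
    next
      case (2 j)
      thus ?thesis by (intro image_eqI[of _ _ "e + 1 + j"]) (auto simp: c_def)
    qed
  qed (use assms in \<open>auto simp: c_def\<close>)
  have 1: "lin ?T (peak_rel 0 0) = 1" unfolding T
    by (rule lin_single_chain)
      (auto simp: c_def inj_on_def peak_rel_def tail_rel_def split: if_splits)
  have "lin (?T \<union> Up ` {..<i}) (peak_rel 0 0) = (card ?T + i choose i) * lin ?T (peak_rel 0 0)"
    by (rule lin_chain) (auto simp: inj_on_def peak_rel_def tail_rel_def)
  moreover have "?T \<union> Up ` {..<i} = cells i (Suc e) (m - 1)" by (auto simp: cells_def)
  moreover have "card ?T + i = i + e + m" using assms by simp
  ultimately show ?thesis using 1 by (simp only: mult_1_right)
qed

text \<open>The cells \<open>Lo e < ... < Lo (k + 1)\<close> are cut off from \<open>Lo k\<close>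
  and form a chain of \<open>e - k\<close> cells to be shuffled into the rest, which is the poset at
  the end of the telescope in \<open>alternating_sk\<close>.\<close>

lemma lin_free:
  assumes "m \<ge> 1" "k < i" "i \<le> e"
  shows "lin (cells i (Suc e) (m - 1)) (free_rel k)
    = (m + i + e choose (e - k)) * lin (cells i (Suc k) (m - 1)) (valley_rel k k)"
proof -
  let ?T = "cells i (Suc k) (m - 1)" and ?c = "\<lambda>j. Lo (e - j)" and ?e = "e - k"
  have "lin (?T \<union> ?c ` {..<?e}) (free_rel k) = (card ?T + ?e choose ?e) * lin ?T (free_rel k)"
  proof (rule lin_chain)
    show "(x, ?c j) \<notin> free_rel k \<and> (?c j, x) \<notin> free_rel k" if "x \<in> ?T" "j < ?e" for x j
      using that assms by (auto simp: free_rel_def tail_rel_def)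
    show "(?c j, ?c j') \<in> free_rel k \<longleftrightarrow> j' = Suc j" if "j < ?e" "j' < ?e" for j j'
      using that assms by (auto simp: free_rel_def tail_rel_def)
  qed (auto simp: inj_on_def)
  moreover have "?T \<union> ?c ` {..<?e} = cells i (Suc e) (m - 1)"
  proof (intro equalityI subsetI)
    fix x assume x: "x \<in> cells i (Suc e) (m - 1)"
    show "x \<in> ?T \<union> ?c ` {..<?e}"
    proof (cases x)
      case (Lo j)
      thus ?thesis using x by (cases "j \<le> k") (auto intro!: image_eqI[of _ _ "e - j"])
    qed (use x in auto)
  qed (use assms in \<open>auto simp: cells_def\<close>)
  moreover have "card ?T + ?e = m + i + e" using assms by simp
  moreover have "lin ?T (free_rel k) = lin ?T (valley_rel k k)"
  proof (rule lin_cong)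
    have *: "(\<forall>j. Suc j < i \<longrightarrow> f (Up j) < f (Up (Suc j))) \<longleftrightarrow>
      (\<forall>j<k. Suc j < i \<longrightarrow> f (Up j) < f (Up (Suc j))) \<and>
      (\<forall>j\<ge>k. Suc j < i \<longrightarrow> f (Up j) < f (Up (Suc j)))" for f :: "cell \<Rightarrow> nat"
      using not_less by blast
    show "compatible ?T (free_rel k) f = compatible ?T (valley_rel k k) f" for f
      unfolding free_rel_def valley_rel_def skew_rel_def compatible_Un compatible_Collect mem_cells
      using *[of f] by auto
  qed simp
  ultimately show ?thesis by (simp only:)
qed

text \<open>Comparing \<open>Lo k\<close> with \<open>Lo (k + 1)\<close> decides which of them is
  the peak of the lower row.\<close>

lemma lin_free_split:
  assumes "k < i" "i \<le> e"
  shows "lin (cells i (Suc e) t) (free_rel k)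
    = lin (cells i (Suc e) t) (peak_rel (Suc k) (Suc k)) + lin (cells i (Suc e) t) (peak_rel k
      (Suc k))"
proof -
  have "insert (Lo k, Lo (Suc k)) (free_rel k) = peak_rel (Suc k) (Suc k)"
    by (auto simp: free_rel_def peak_rel_def less_Suc_eq le_less)
  moreover have "insert (Lo (Suc k), Lo k) (free_rel k) = peak_rel k (Suc k)"
    by (auto simp: free_rel_def peak_rel_def less_Suc_eq le_less)
  ultimately show ?thesis
    using lin_split[of "cells i (Suc e) t" "Lo k" "Lo (Suc k)" "free_rel k"] assms by simp
qed

lemma lin_peak_split:
  assumes "k < i" "i \<le> e"
  shows "lin (cells i (Suc e) t) (peak_rel k k)
    = lin (cells i (Suc e) t) (peak_rel k (Suc k)) + lin (cells i (Suc e) t) (cross_rel k)"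
proof -
  have "insert (Up k, Lo k) (peak_rel k k) = peak_rel k (Suc k)"
    by (auto simp: peak_rel_def less_Suc_eq)
  thus ?thesis
    using lin_split[of "cells i (Suc e) t" "Up k" "Lo k" "peak_rel k k"] assms
    by (simp add: cross_rel_def)
qed

text \<open>The two orders differ by exchanging the labels \<open>Up k\<close> and \<open>Lo (Suc k)\<close>.\<close>

lemma lin_cross_shift:
  assumes "k < i" "i \<le> e"
  shows "lin (cells i (Suc e) t) (cross_rel k \<union> {(Up j, Lo (Suc k)) |j. Suc j = k})
    = lin (cells i (Suc e) t) (gap_rel (Suc k))"
proof -
  let ?S = "cells i (Suc e) t"
  define \<pi> where "\<pi> x = (if x = Up k then Lo (Suc k) else if x = Lo (Suc k) then Up k else x)" for x
  have \<pi>: "bij_betw \<pi> ?S ?S"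
    using assms by (intro bij_betwI[where g = \<pi>]) (auto simp: \<pi>_def)
  show ?thesis
  proof (rule lin_iso[OF \<pi>])
    fix f :: "cell \<Rightarrow> nat"
    have \<pi>s: "\<pi> (Up j) = (if j = k then Lo (Suc k) else Up j)"
      "\<pi> (Lo j) = (if j = Suc k then Up k else Lo j)" "\<pi> (Tl j) = Tl j" for j
      by (auto simp: \<pi>_def)
    show "compatible ?S (cross_rel k \<union> {(Up j, Lo (Suc k)) |j. Suc j = k}) (f \<circ> \<pi>)
        = compatible ?S (gap_rel (Suc k)) f" (is "?L = ?R")
    proof
      assume ?L
      hence up: "\<And>j. Suc j < i \<Longrightarrow> f (\<pi> (Up j)) < f (\<pi> (Up (Suc j)))"
        and asc: "\<And>j. j < k \<Longrightarrow> f (\<pi> (Lo j)) < f (\<pi> (Lo (Suc j)))"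
        and desc: "\<And>j. k \<le> j \<Longrightarrow> j < e \<Longrightarrow> f (\<pi> (Lo (Suc j))) < f (\<pi> (Lo j))"
        and cross: "\<And>j. j < k \<Longrightarrow> f (\<pi> (Up j)) < f (\<pi> (Lo j))"
        and tail: "compatible ?S tail_rel (f \<circ> \<pi>)"
        and LU: "f (\<pi> (Lo k)) < f (\<pi> (Up k))"
        and extra: "\<And>j. Suc j = k \<Longrightarrow> f (\<pi> (Up j)) < f (\<pi> (Lo (Suc k)))"
        using assms
        by (auto simp: compatible_Un compatible_Collect compatible_cross_rel compatible_peak_rel)
      \<comment> \<open>The chain \<open>Lo (k + 1) < Lo k < Up k\<close> turns into
        \<open>Up k < Lo k < Lo (k + 1)\<close>, so the peak moves to \<open>k + 1\<close>. The
        former neighbours of the exchanged cells supply the rest: \<open>Up k < Up (k + 1)\<close>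
        becomes the crossing condition and \<open>Lo (k + 2) < Lo (k + 1)\<close> becomes the gap
        condition at \<open>k + 1\<close>.\<close>
      have UL: "f (Up k) < f (Lo k)" using desc[of k] assms by (simp add: \<pi>s)
      have LL: "f (Lo k) < f (Lo (Suc k))" using LU by (simp add: \<pi>s)
      have "f (Up j) < f (Up (Suc j))" if "Suc j < i" for j
      proof -
        consider "j = k" | "Suc j = k" | "j \<noteq> k" "Suc j \<noteq> k" by blast
        thus ?thesis
        proof cases
          case 1
          thus ?thesis using up[of k] that UL LL by (simp add: \<pi>s)
        qed (use up[of j] extra[of j] that in \<open>auto simp: \<pi>s\<close>)
      qed
      moreover have "f (Lo j) < f (Lo (Suc j))" if "j < Suc k" for j
        using asc[of j] that LL by (cases "j = k") (auto simp: \<pi>s)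
      moreover have "f (Lo (Suc j)) < f (Lo j)" if "Suc k \<le> j" "j < e" for j
        using desc[of j] that UL LL by (cases "j = Suc k") (auto simp: \<pi>s)
      moreover have "f (Up j) < f (Lo j)" if "j < Suc k" for j
        using cross[of j] that UL by (cases "j = k") (auto simp: \<pi>s)
      moreover have "compatible ?S tail_rel f" using tail by (simp add: compatible_tail_rel \<pi>s)
      moreover have "f (Lo (Suc k)) < f (Up (Suc k))" if "Suc k < i"
        using up[of k] that by (simp add: \<pi>s)
      moreover have "f (Lo (Suc (Suc k))) < f (Up k)" if "Suc k < e"
        using desc[of "Suc k"] that by (simp add: \<pi>s)
      ultimately show ?R
        unfolding compatible_gap_rel compatible_cross_rel compatible_peak_rel by auto
    next
      assume ?R
      hence up: "\<And>j. Suc j < i \<Longrightarrow> f (Up j) < f (Up (Suc j))"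
        and asc: "\<And>j. j \<le> k \<Longrightarrow> f (Lo j) < f (Lo (Suc j))"
        and desc: "\<And>j. Suc k \<le> j \<Longrightarrow> j < e \<Longrightarrow> f (Lo (Suc j)) < f (Lo j)"
        and cross: "\<And>j. j \<le> k \<Longrightarrow> f (Up j) < f (Lo j)"
        and tail: "compatible ?S tail_rel f"
        and LU: "Suc k < i \<Longrightarrow> f (Lo (Suc k)) < f (Up (Suc k))"
        and gap: "Suc k < e \<Longrightarrow> f (Lo (Suc (Suc k))) < f (Up k)"
        using assms
        by (auto simp: compatible_gap_rel compatible_cross_rel compatible_peak_rel)
      have "f (\<pi> (Up j)) < f (\<pi> (Up (Suc j)))" if "Suc j < i" for j
      proof -
        consider "j = k" | "Suc j = k" | "j \<noteq> k" "Suc j \<noteq> k" by blast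
        thus ?thesis
        proof cases
          case 2
          thus ?thesis using up[of j] that cross[of k] asc[of k] by (simp add: \<pi>s)
        qed (use up[of j] that LU in \<open>auto simp: \<pi>s\<close>)
      qed
      moreover have "f (\<pi> (Lo j)) < f (\<pi> (Lo (Suc j)))" if "j < k" for j
        using asc[of j] that by (simp add: \<pi>s)
      moreover have "f (\<pi> (Lo (Suc j))) < f (\<pi> (Lo j))" if j: "k \<le> j" "j < e" for j
      proof -
        consider "j = k" | "j = Suc k" | "Suc k < j" using j by linarith
        thus ?thesis by cases (use desc[of j] j cross[of k] gap in \<open>auto simp: \<pi>s\<close>)
      qed
      moreover have "f (\<pi> (Up j)) < f (\<pi> (Lo j))" if "j < k" for j
        using cross[of j] that by (simp add: \<pi>s)
      moreover have "compatible ?S tail_rel (f \<circ> \<pi>)" using tail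
        by (simp add: compatible_tail_rel \<pi>s)
      moreover have "f (\<pi> (Lo k)) < f (\<pi> (Up k))" using asc[of k] by (simp add: \<pi>s)
      moreover have "f (\<pi> (Up j)) < f (\<pi> (Lo (Suc k)))" if "Suc j = k" for j
        using up[of j] that assms by (simp add: \<pi>s)
      ultimately show ?L
        unfolding compatible_Un compatible_Collect compatible_cross_rel compatible_peak_rel by auto
    qed
  qed
qed

text \<open>For \<open>k = 0\<close> there is no \<open>Up (k - 1)\<close> to be compared with, and
  all of \<open>cross_rel 0\<close> passes to \<open>gap_rel 1\<close>. The value 0 keeps
  \<open>lin_cross_split\<close> uniform.\<close>

definition gap_count :: "nat \<Rightarrow> nat \<Rightarrow> nat \<Rightarrow> nat \<Rightarrow> nat" where
  "gap_count i e t k = (if k = 0 then 0 else lin (cells i (Suc e) t) (gap_rel k))"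

text \<open>Compares \<open>Lo (k + 1)\<close> with \<open>Up (k - 1)\<close>. One outcome is the
  gap order at \<open>k\<close>, the other has as many extensions as the gap order at
  \<open>k + 1\<close> by \<open>lin_cross_shift\<close>.\<close>

lemma lin_cross_split:
  assumes "k < i" "i \<le> e"
  shows "lin (cells i (Suc e) t) (cross_rel k) = gap_count i e t k + gap_count i e t (Suc k)"
proof (cases k)
  case 0
  thus ?thesis using lin_cross_shift[OF assms, of t] by (simp add: gap_count_def)
next
  case (Suc j)
  have "insert (Lo (Suc k), Up j) (cross_rel k) = gap_rel k"
    using Suc by (auto simp: gap_rel_def)
  moreover have "insert (Up j, Lo (Suc k)) (cross_rel k)
    = cross_rel k \<union> {(Up j, Lo (Suc k)) |j. Suc j = k}"
    using Suc by auto
  ultimately show ?thesis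
    using lin_split[of "cells i (Suc e) t" "Lo (Suc k)" "Up j" "cross_rel k"] assms Suc
      lin_cross_shift[OF assms, of t] by (simp add: gap_count_def)
qed

text \<open>As there is no cell \<open>Up i\<close>, the crossing condition is void. If
  \<open>Up (i - 1) < Lo (i + 1)\<close>, then the descending cells
  \<open>Lo (i + 1), ..., Lo e\<close> continue the upper row as
  \<open>Up i, ..., Up (e - 1)\<close>, and the poset is a skew shape. For \<open>i = e\<close>
  there is no \<open>Lo (i + 1)\<close>, and the gap order is all there is.\<close>

lemma lin_peak_top:
  assumes "1 \<le> i" "i \<le> e"
  shows "lin (cells i (Suc e) (m - 1)) (peak_rel i i)
    = gap_count i e (m - 1) i + (if i < e then sk m i (e - 1) else 0)"
proof -
  let ?S = "cells i (Suc e) (m - 1)"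
  have peak: "lin ?S (peak_rel i i) = lin ?S (cross_rel i)"
    by (rule lin_cong) (auto simp: compatible_cross_rel)
  show ?thesis
  proof (cases "i < e")
    case False
    moreover have "lin ?S (cross_rel i) = lin ?S (gap_rel i)"
      by (rule lin_cong) (use False in \<open>auto simp: compatible_gap_rel\<close>)
    ultimately show ?thesis using assms peak by (simp add: gap_count_def)
  next
    case True
    let ?T = "cells e (Suc i) (m - 1)" and ?R = "insert (Up (i - 1), Lo (Suc i)) (cross_rel i)"
    have "insert (Lo (Suc i), Up (i - 1)) (cross_rel i) = gap_rel i"
      using assms by (cases i) (auto simp: gap_rel_def)
    hence "lin ?S (cross_rel i) = lin ?S (gap_rel i) + lin ?S ?R"
      using lin_split[of ?S "Lo (Suc i)" "Up (i - 1)" "cross_rel i"] assms True by simp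
    moreover have "lin ?S ?R = lin ?T (skew_rel i (e - 1))"
    proof -
      define \<pi> where "\<pi> x = (case x of Lo j \<Rightarrow> if j \<le> i then Lo j else Up (j - 1) | _ \<Rightarrow> x)" for x
      define \<rho> where "\<rho> x = (case x of Up j \<Rightarrow> if j < i then Up j else Lo (Suc j) | _ \<Rightarrow> x)" for x
      have \<pi>s: "\<pi> (Up j) = Up j" "\<pi> (Tl j) = Tl j" "\<pi> (Lo j) = (if j \<le> i then Lo j else Up (j - 1))"
        for j
        by (auto simp: \<pi>_def)
      have \<pi>: "bij_betw \<pi> ?S ?T"
      proof (rule bij_betwI[where g = \<rho>])
        show "\<pi> \<in> ?S \<rightarrow> ?T" using True by (auto simp: cells_def \<pi>_def)
        show "\<rho> \<in> ?T \<rightarrow> ?S" using True by (auto simp: cells_def \<rho>_def)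
        show "\<rho> (\<pi> x) = x" if "x \<in> ?S" for x using that by (cases x) (auto simp: \<pi>_def \<rho>_def)
        show "\<pi> (\<rho> x) = x" if "x \<in> ?T" for x using that by (cases x) (auto simp: \<pi>_def \<rho>_def)
      qed
      show ?thesis
      proof (rule lin_iso[OF \<pi>])
        fix f :: "cell \<Rightarrow> nat"
        show "compatible ?S ?R (f \<circ> \<pi>) = compatible ?T (skew_rel i (e - 1)) f" (is "?L = ?R")
        proof
          assume ?L
          hence up: "\<And>j. Suc j < i \<Longrightarrow> f (Up j) < f (Up (Suc j))"
            and asc: "\<And>j. j < i \<Longrightarrow> f (Lo j) < f (Lo (Suc j))"
            and desc: "\<And>j. i \<le> j \<Longrightarrow> j < e \<Longrightarrow> f (\<pi> (Lo (Suc j))) < f (\<pi> (Lo j))"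
            and cross: "\<And>j. j < i \<Longrightarrow> f (Up j) < f (Lo j)"
            and tail: "compatible ?S tail_rel (f \<circ> \<pi>)"
            and last: "f (Up (i - 1)) < f (Up i)"
            using assms True
            by (auto simp: compatible_insert' compatible_cross_rel compatible_peak_rel \<pi>s)
          have "f (Up j) < f (Up (Suc j))" if "j < i" for j
            using up[of j] last that by (cases "Suc j = i") auto
          moreover have "f (Up (Suc j)) < f (Up j)" if "i \<le> j" "j < e - 1" for j
            using desc[of "Suc j"] that by (simp add: \<pi>s)
          moreover have "f (Up j) < f (Lo j)" if "j \<le> i" for j
            using cross[of j] desc[of i] that True by (cases "j = i") (auto simp: \<pi>s)
          moreover have "compatible ?T tail_rel f" using tail by (simp add: compatible_tail_rel \<pi>s)
          ultimately show ?R
            unfolding skew_rel_def compatible_Un compatible_Collect using asc by auto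
        next
          assume ?R
          hence up: "\<And>j. j < i \<Longrightarrow> f (Up j) < f (Up (Suc j))"
            and asc: "\<And>j. j < i \<Longrightarrow> f (Lo j) < f (Lo (Suc j))"
            and desc: "\<And>j. i \<le> j \<Longrightarrow> j < e - 1 \<Longrightarrow> f (Up (Suc j)) < f (Up j)"
            and cross: "\<And>j. j \<le> i \<Longrightarrow> f (Up j) < f (Lo j)"
            and tail: "compatible ?T tail_rel f"
            using assms True
            by (auto simp: skew_rel_def compatible_Un compatible_Collect)
          have "f (\<pi> (Lo (Suc j))) < f (\<pi> (Lo j))" if "i \<le> j" "j < e" for j
          proof (cases "j = i")
            case False
            have "f (Up (Suc (j - 1))) < f (Up (j - 1))" by (rule desc) (use False that in auto)
            thus ?thesis using False that by (simp add: \<pi>s)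
          qed (use cross[of i] in \<open>auto simp: \<pi>s\<close>)
          moreover have "compatible ?S tail_rel (f \<circ> \<pi>)" using tail
            by (simp add: compatible_tail_rel \<pi>s)
          moreover have "f (Up (i - 1)) < f (Up i)" using up[of "i - 1"] assms by simp
          ultimately show ?L
            unfolding compatible_insert' compatible_cross_rel compatible_peak_rel
            using up asc cross by (auto simp: \<pi>s)
        qed
      qed
    qed
    moreover have "sk m i (e - 1) = lin ?T (skew_rel i (e - 1))" using True by (simp add: sk_def)
    ultimately show ?thesis using assms peak True by (simp add: gap_count_def)
  qed
qed

text \<open>The coefficients of the Kazhdan--Lusztig polynomial of the uniform matroid $U_{m,d}$.\<close>

definition u_coeff :: "nat \<Rightarrow> nat \<Rightarrow> nat \<Rightarrow> int" where
  "u_coeff m d i = int (skyt (int m + 1) i (int d - 2 * int i + 1))"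

lemma u_coeff_eq_sk:
  "\<lbrakk>m \<ge> 1; k \<le> v\<rbrakk> \<Longrightarrow> u_coeff m (v + k + 1) k = int (sk m k v)"
  using skyt_eq[of m k "v + k + 1"] by (cases "k = 0") (auto simp: u_coeff_def sk_0 skyt_def)

lemma u_coeff_0 [simp]: "u_coeff m d 0 = 1"
  by (simp add: u_coeff_def skyt_def)

lemma u_coeff_zero: "\<lbrakk>1 \<le> i; d \<le> 2 * i\<rbrakk> \<Longrightarrow> u_coeff m d i = 0"
  by (simp add: u_coeff_def skyt_def)

lemma u_coeff_m0: "1 \<le> i \<Longrightarrow> u_coeff 0 d i = 0"
  by (simp add: u_coeff_def skyt_def)

lemma u_coeff_nonneg: "u_coeff m d i \<ge> 0"
  by (simp add: u_coeff_def)

lemma alternating_pairs: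
  fixes N z :: "nat \<Rightarrow> int"
  assumes "\<And>k. k < i \<Longrightarrow> N k = z k + z (Suc k)"
  shows "(\<Sum>k<i. (-1) ^ (i - 1 - k) * N k) = z i - (-1) ^ i * z 0"
  using assms
proof (induction i)
  case (Suc i)
  have "(\<Sum>k<i. (-1) ^ (i - k) * N k) = - (\<Sum>k<i. (-1) ^ (i - 1 - k) * N k)"
    unfolding sum_negf[symmetric]
  proof (rule sum.cong[OF refl])
    fix k assume "k \<in> {..<i}"
    hence "i - k = Suc (i - 1 - k)" by auto
    thus "(-1) ^ (i - k) * N k = - ((-1) ^ (i - 1 - k) * N k)" by simp
  qed
  thus ?case using Suc by simp
qed simp

text \<open>In terms of the matroid, \<open>v + k + 1\<close> is the rank of a contraction and
  \<open>k\<close> the exponent of a term in its polynomial. The inner sum is evaluated by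
  \<open>alternating_sk\<close>, its factor is the one of \<open>lin_free\<close>, and the sum over
  \<open>k\<close> telescopes.\<close>

theorem u_coeff_recursion:
  assumes "1 \<le> i" "2 * i \<le> d"
  shows "u_coeff m d i = (-1) ^ i * int (m + d choose i) +
    (\<Sum>k<i. int (m + d choose (d - i - k)) *
       (\<Sum>v=k..i - 1. (-1) ^ (i - 1 - v) * int (m + i + k choose (i - 1 - v)) * u_coeff m
         (v + k + 1) k))"
proof (cases "m = 0")
  case True
  \<comment> \<open>For \<open>m = 0\<close> the left column is too short for the posets above. Only
    \<open>k = 0\<close> contributes, with an alternating row of Pascal's triangle that lacks its
    last entry.\<close>
  have "(\<Sum>v=0..i - 1. (-1) ^ (i - 1 - v) * int (i choose (i - 1 - v)))
    = (\<Sum>s\<le>i - 1. (-1) ^ s * int (i choose s))"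
    by (rule sum.reindex_bij_witness[of _ "\<lambda>s. i - 1 - s" "\<lambda>v. i - 1 - v"]) auto
  also have "\<dots> = (\<Sum>s\<le>i. (-1) ^ s * int (i choose s)) - (-1) ^ i"
    using assms by (cases i) auto
  also have "(\<Sum>s\<le>i. (-1) ^ s * int (i choose s)) = 0"
    using choose_alternating_sum[of i, where 'a = int] assms by simp
  finally have *: "(\<Sum>v=0..i - 1. (-1) ^ (i - 1 - v) * int (i choose (i - 1 - v))) = - ((-1) ^ i)"
    by simp
  have "(\<Sum>k<i. int (d choose (d - i - k)) *
       (\<Sum>v=k..i - 1. (-1) ^ (i - 1 - v) * int (i + k choose (i - 1 - v)) * u_coeff 0 (v + k + 1) k))
     = (\<Sum>k\<in>{0}. int (d choose (d - i - k)) *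
       (\<Sum>v=k..i - 1. (-1) ^ (i - 1 - v) * int (i + k choose (i - 1 - v)) * u_coeff 0
         (v + k + 1) k))"
    using assms by (intro sum.mono_neutral_right) (auto simp: u_coeff_m0)
  also have "\<dots> = - int (d choose i) * (-1) ^ i"
    using * assms binomial_symmetric[of i d] by simp
  finally show ?thesis using True assms by (simp add: u_coeff_m0)
next
  case False
  hence m: "m \<ge> 1" by simp
  define e where "e = d - i"
  have e: "i \<le> e" "d = i + e" using assms by (auto simp: e_def)
  let ?S = "cells i (Suc e) (m - 1)"
  define z :: "nat \<Rightarrow> int" where "z k = int (lin ?S (peak_rel k k)) - int (gap_count i e (m - 1) k)"
    for k
  \<comment> \<open>The three splittings read N k = W (k+1) (k+1) + W k (k+1), W k k = W k (k+1) + X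
    and X = G k + G (k+1), where X counts the extensions of \<open>cross_rel k\<close>; W k (k+1)
    and X are eliminated.\<close>
  have N: "int (lin ?S (free_rel k)) = z k + z (Suc k)" if "k < i" for k
    using lin_free_split[OF that e(1), of "m - 1"] lin_peak_split[OF that e(1), of "m - 1"]
      lin_cross_split[OF that e(1), of "m - 1"] by (simp add: z_def)
  have z0: "z 0 = int (m + d choose i)"
    using lin_peak_0[OF m, of i e] e by (simp add: z_def gap_count_def ac_simps)
  have zi: "z i = u_coeff m d i"
  proof (cases "i < e")
    case True
    have "u_coeff m (e - 1 + i + 1) i = int (sk m i (e - 1))"
      by (rule u_coeff_eq_sk) (use m True in auto)
    thus ?thesis using lin_peak_top[OF assms(1) e(1), of m] True e(2) by (simp add: z_def ac_simps)
  next
    case False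
    thus ?thesis using lin_peak_top[OF assms(1) e(1), of m] assms e u_coeff_zero[of i d m]
      by (simp add: z_def)
  qed
  have "z i - (-1) ^ i * z 0 = (\<Sum>k<i. (-1) ^ (i - 1 - k) * int (lin ?S (free_rel k)))"
    using alternating_pairs[of i "\<lambda>k. int (lin ?S (free_rel k))" z] N by simp
  also have "\<dots> = (\<Sum>k<i. int (m + d choose (d - i - k)) *
       (\<Sum>v=k..i - 1. (-1) ^ (i - 1 - v) * int (m + i + k choose (i - 1 - v)) * u_coeff m
         (v + k + 1) k))"
  proof (rule sum.cong[OF refl])
    fix k assume "k \<in> {..<i}"
    hence k: "k < i" by simp
    have "(\<Sum>v=k..i - 1. (-1) ^ (i - 1 - v) * int (m + i + k choose (i - 1 - v)) * u_coeff m (v + k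
      + 1) k)
        = (\<Sum>v=k..i - 1. (-1) ^ (i - 1 - v) * int ((m + i + k choose (i - 1 - v)) * sk m k v))"
      by (intro sum.cong refl) (subst u_coeff_eq_sk[OF m], auto)
    also have "\<dots> = (-1) ^ (i - 1 - k) * int (lin (cells i (Suc k) (m - 1)) (valley_rel k k))"
      by (rule alternating_sk[OF m k])
    finally have *: "(\<Sum>v=k..i - 1. (-1) ^ (i - 1 - v) * int (m + i + k choose (i - 1 - v))
      * u_coeff m (v + k + 1) k) = \<dots>" .
    show "(-1) ^ (i - 1 - k) * int (lin ?S (free_rel k)) = int (m + d choose (d - i - k)) *
       (\<Sum>v=k..i - 1. (-1) ^ (i - 1 - v) * int (m + i + k choose (i - 1 - v)) * u_coeff m
         (v + k + 1) k)"
      unfolding * lin_free[OF m k e(1)] using e by (simp add: ac_simps)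
  qed
  finally show ?thesis using z0 zi by simp
qed

section \<open>A hook formula\<close>

text \<open>The Young diagram of the partition (p, q, 1^r): \<open>Lo\<close> is the first row,
  \<open>Up\<close> the second one, and \<open>Tl\<close> the rest of the first column. In contrast
  to \<open>skew_rel\<close>, the cells \<open>Lo\<close> come first; the reason is the rotation in
  \<open>lin_cut_eq_straight\<close>.\<close>

definition straight_rel :: "(cell \<times> cell) set" where
  "straight_rel = {(Lo j, Lo (Suc j)) |j. True} \<union> {(Up j, Up (Suc j)) |j. True}
     \<union> {(Lo j, Up j) |j. True} \<union> insert (Up 0, Tl 0) {(Tl j, Tl (Suc j)) |j. True}"

definition straight :: "nat \<Rightarrow> nat \<Rightarrow> nat \<Rightarrow> nat" where
  "straight p q r = lin (cells q p r) straight_rel"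

lemma straight_0: "straight p 0 0 = 1"
proof -
  have "cells 0 p 0 = Lo ` {..<p}" by (auto simp: cells_def)
  thus ?thesis unfolding straight_def
    by (simp only:) (rule lin_single_chain, auto simp: inj_on_def straight_rel_def)
qed

text \<open>The three summands remove the three possible corners. The last cell of the second row is
  a corner unless it is \<open>Up 0\<close> with a tail below it.\<close>

lemma straight_step:
  assumes "1 \<le> q" "q \<le> p"
  shows "straight p q r = (if q < p then straight (p - 1) q r else 0)
    + (if 2 \<le> q \<or> r = 0 then straight p (q - 1) r else 0) + (if 0 < r then straight p q
      (r - 1) else 0)"
proof -
  let ?S = "cells q p r"
  let ?A = "if q < p then {Lo (p - 1)} else {}"
    and ?B = "if 2 \<le> q \<or> r = 0 then {Up (q - 1)} else {}"
    and ?C = "if 0 < r then {Tl (r - 1)} else {}"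
  have rel: "(Lo j, y) \<in> straight_rel \<longleftrightarrow> y = Lo (Suc j) \<or> y = Up j"
    "(Up j, y) \<in> straight_rel \<longleftrightarrow> y = Up (Suc j) \<or> j = 0 \<and> y = Tl 0"
    "(Tl j, y) \<in> straight_rel \<longleftrightarrow> y = Tl (Suc j)" for j y
    by (auto simp: straight_rel_def)
  have max: "{x \<in> ?S. \<forall>y\<in>?S. (x, y) \<notin> straight_rel} = ?A \<union> ?B \<union> ?C" (is "?M = _")
  proof (intro equalityI subsetI)
    fix x assume x: "x \<in> ?M"
    hence S: "x \<in> ?S" and n: "\<And>y. (x, y) \<in> straight_rel \<Longrightarrow> y \<notin> ?S" by auto
    show "x \<in> ?A \<union> ?B \<union> ?C"
    proof (cases x)
      case (Up j)
      thus ?thesis using S n[of "Up (Suc j)"] n[of "Tl 0"] by (cases j) (auto simp: rel)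
    next
      case (Lo j)
      thus ?thesis using S n[of "Lo (Suc j)"] n[of "Up j"] by (auto simp: rel)
    next
      case (Tl j)
      thus ?thesis using S n[of "Tl (Suc j)"] by (auto simp: rel)
    qed
  next
    fix x assume "x \<in> ?A \<union> ?B \<union> ?C"
    thus "x \<in> ?M" using assms by (auto simp: rel split: if_splits)
  qed
  have "straight p q r = (\<Sum>x\<in>?A \<union> ?B \<union> ?C. lin (?S - {x}) straight_rel)"
    unfolding straight_def max[symmetric]
    by (rule lin_remove) (use assms in \<open>auto simp: cells_def lessThan_empty_iff\<close>)
  also have "\<dots> = (\<Sum>x\<in>?A. lin (?S - {x}) straight_rel) + (\<Sum>x\<in>?B. lin (?S - {x}) straight_rel)
      + (\<Sum>x\<in>?C. lin (?S - {x}) straight_rel)"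
    by (subst sum.union_disjoint; (subst sum.union_disjoint)?) auto
  also have "(\<Sum>x\<in>?A. lin (?S - {x}) straight_rel) = (if q < p then straight (p - 1) q r else 0)"
  proof (cases "q < p")
    case True
    have "?S - {Lo (p - 1)} = cells q (p - 1) r" by (auto simp: cells_def)
    thus ?thesis using True by (simp add: straight_def)
  qed simp
  also have "(\<Sum>x\<in>?B. lin (?S - {x}) straight_rel) = (if 2 \<le> q \<or> r
    = 0 then straight p (q - 1) r else 0)"
  proof -
    have "?S - {Up (q - 1)} = cells (q - 1) p r" by (auto simp: cells_def)
    thus ?thesis by (simp add: straight_def)
  qed
  also have "(\<Sum>x\<in>?C. lin (?S - {x}) straight_rel) = (if 0 < r then straight p q (r - 1) else 0)"
  proof -
    have "?S - {Tl (r - 1)} = cells q p (r - 1)" by (auto simp: cells_def)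
    thus ?thesis by (simp add: straight_def)
  qed
  finally show ?thesis .
qed

text \<open>The hook length formula for (p, q, 1^r): the first two cells of the first column have
  hooks p + r + 1 and q + r, the tail contributes r!, and the remaining cells of the two rows
  contribute p! / (p - q + 1) and (q - 1)!. The induction removes corners, and \<open>F\<close> is
  the factor common to the three contributions.\<close>

lemma straight_hook:
  assumes "1 \<le> q" "q \<le> p"
  shows "real (straight p q r) = fact (p + q + r) * (real p - real q + 1)
    / ((real p + real r + 1) * (real q + real r) * fact p * fact (q - 1) * fact r)"
  using assms
proof (induction "p + q + r" arbitrary: p q r rule: less_induct)
  case less
  obtain p' q' where pq: "p = Suc p'" "q = Suc q'" using less.prems by (cases p; cases q) auto
  have q'p': "q' \<le> p'" using less.prems pq by simp
  define F where "F = (fact (p' + q' + r + 1) / (fact p * fact q' * fact r) :: real)"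
  have A: "real (if q < p then straight (p - 1) q r else 0)
      = F * (p * (real p - real q) / ((real p + real r) * (real q + real r)))"
  proof (cases "q < p")
    case True
    have "real (straight (p - 1) q r) = fact (p' + q + r) * (real p' - real q + 1)
      / ((real p' + real r + 1) * (real q + real r) * fact p' * fact q' * fact r)"
      using less.hyps[of p' q r] True pq by simp
    also have "\<dots> = F * (p * (real p - real q) / ((real p + real r) * (real q + real r)))"
    proof -
      have e: "real p' - real q + 1 = real p - real q" "real p' + real r + 1 = real p + real r"
        "p' + q + r = p' + q' + r + 1" "fact p = real p * fact p'" "real p \<noteq> 0" using pq by auto
      have cancel: "N * X / (Y * f * g * h) = N / ((c * f) * g * h) * (c * X / Y)" if "c \<noteq> 0"
        for N X Y f g h c :: real using that by simp
      show ?thesis unfolding F_def e(1-4) by (rule cancel[OF e(5)])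
    qed
    finally show ?thesis using True by simp
  qed (use q'p' pq in simp)
  \<comment> \<open>For \<open>q = 1\<close> and \<open>r = 0\<close> the denominator is 0; that
    case is settled separately at the end.\<close>
  have B: "real (if 2 \<le> q \<or> r = 0 then straight p (q - 1) r else 0)
      = F * (q' * (real p - real q + 2) / ((real p + real r + 1) * (real q' + real r)))"
    if "q' + r > 0"
  proof (cases q')
    case 0
    thus ?thesis using that pq by simp
  next
    case (Suc q'')
    have "real (straight p q' r) = fact (p + q' + r) * (real p - real q' + 1)
      / ((real p + real r + 1) * (real q' + real r) * fact p * fact q'' * fact r)"
      using less.hyps[of p q' r] Suc pq q'p' by simp
    also have "\<dots> = F * (q' * (real p - real q + 2) / ((real p + real r + 1) * (real q' + real r)))"
    proof -
      have e: "real p - real q' + 1 = real p - real q + 2" "p + q' + r = p' + q' + r + 1"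
        "fact q' = real q' * fact q''" "real q' \<noteq> 0" using pq Suc by auto
      have cancel: "N * X / (Y * f * g * h) = N / (f * (c * g) * h) * (c * X / Y)" if "c \<noteq> 0"
        for N X Y f g h c :: real using that by simp
      show ?thesis unfolding F_def e(1-3) by (rule cancel[OF e(4)])
    qed
    finally show ?thesis using Suc pq by simp
  qed
  have C: "real (if 0 < r then straight p q (r - 1) else 0)
      = F * (r * (real p - real q + 1) / ((real p + real r) * (real q' + real r)))"
  proof (cases r)
    case (Suc r')
    have "real (straight p q r') = fact (p + q + r') * (real p - real q + 1)
      / ((real p + real r' + 1) * (real q + real r') * fact p * fact q' * fact r')"
      using less.hyps[of p q r'] Suc less.prems pq by simp
    also have "\<dots> = F * (r * (real p - real q + 1) / ((real p + real r) * (real q' + real r)))"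
    proof -
      have e: "real p + real r' + 1 = real p + real r" "real q + real r' = real q' + real r"
        "p + q + r' = p' + q' + r + 1" "fact r = real r * fact r'" "real r \<noteq> 0" using pq Suc by auto
      have cancel: "N * X / (Y * f * g * h) = N / (f * g * (c * h)) * (c * X / Y)" if "c \<noteq> 0"
        for N X Y f g h c :: real using that by simp
      show ?thesis unfolding F_def e(1-4) by (rule cancel[OF e(5)])
    qed
    finally show ?thesis using Suc by simp
  qed simp
  have goal: "fact (p + q + r) * (real p - real q + 1)
    / ((real p + real r + 1) * (real q + real r) * fact p * fact (q - 1) * fact r)
    = F * ((real p + real q + real r) * (real p - real q + 1) / ((real p + real r + 1) *
      (real q + real r)))"
  proof -
    have e: "fact (p + q + r) = (real p + real q + real r) * fact (p' + q' + r + 1)" "q - 1 = q'"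
      using pq by auto
    have "c * N * X / (Y * Z * f * g * h) = N / (f * g * h) * (c * X / (Y * Z))"
      for c N X Y Z f g h :: real by (simp add: mult_ac)
    thus ?thesis unfolding F_def e .
  qed
  show ?case
  proof (cases "q' + r > 0")
    case True
    have pos: "real q' + real r > 0" "real p + real r > 0" "real p + real r + 1 > 0" "real q
      + real r > 0"
      using True pq by auto
    have q: "real q = real q' + 1" using pq by simp
    have "real (straight p q r) = F * (p * (real p - real q) / ((real p + real r) * (real q
      + real r)))
      + F * (q' * (real p - real q + 2) / ((real p + real r + 1) * (real q' + real r)))
      + F * (r * (real p - real q + 1) / ((real p + real r) * (real q' + real r)))"
      unfolding A[symmetric] B[OF True, symmetric] C[symmetric]
        using straight_step[OF less.prems, of r] by simp
    also have "\<dots> = F * ((real p + real q + real r) * (real p - real q + 1)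
        / ((real p + real r + 1) * (real q + real r)))"
    proof -
      define P Q R where "P = real p" and "Q = real q'" and "R = real r"
      have "P * (P - (Q + 1)) / ((P + R) * (Q + 1 + R)) + Q * (P - (Q + 1) + 2) / ((P + R + 1) * (Q
        + R))
          + R * (P - (Q + 1) + 1) / ((P + R) * (Q + R))
          = (P + (Q + 1) + R) * (P - (Q + 1) + 1) / ((P + R + 1) * (Q + 1 + R))"
      proof -
        have "P + R > 0" "Q + R > 0" "P + R + 1 > 0" "Q + 1 + R > 0"
          using pos q by (auto simp: P_def Q_def R_def)
        thus ?thesis by (simp add: divide_simps) algebra
      qed
      thus ?thesis unfolding q P_def Q_def R_def by (simp only: distrib_left[symmetric])
    qed
    finally show ?thesis unfolding goal .
  next
    case False
    hence 0: "q' = 0" "r = 0" "q = 1" using pq by auto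
    have F: "F = 1" using 0 pq by (simp add: F_def del: fact_Suc)
    have "real (straight p q r) = real (if q < p then straight (p - 1) q r else 0) + 1"
      using straight_step[OF less.prems, of r] straight_0[of p] 0 by simp
    also have "\<dots> = real p" unfolding A F using 0 pq by simp
    finally show ?thesis unfolding goal F using 0 pq by simp
  qed
qed


section \<open>Closed recursion in the corank\<close>

lemma lin_iso_rel:
  assumes \<pi>: "bij_betw \<pi> S S'" and R: "\<And>x y. \<lbrakk>x \<in> S; y \<in> S\<rbrakk> \<Longrightarrow> (x, y) \<in> R \<longleftrightarrow> (\<pi> x, \<pi> y) \<in> R'"
  shows "lin S R = lin S' R'"
proof (rule lin_iso[OF \<pi>])
  fix f :: "'b \<Rightarrow> nat"
  have "S' = \<pi> ` S" using \<pi> by (simp add: bij_betw_def)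
  thus "compatible S R (f \<circ> \<pi>) = compatible S' R' f"
    using R by (auto simp: compatible_def)
qed

section \<open>Bending the left column into the lower row\<close>

definition tail_cell :: "nat \<Rightarrow> cell" where
  "tail_cell l = (case l of 0 \<Rightarrow> Lo 0 | Suc l \<Rightarrow> Tl l)"

lemma tail_cell_simps [simp]: "tail_cell 0 = Lo 0" "tail_cell (Suc l) = Tl l"
  by (simp_all add: tail_cell_def)

definition core_rel :: "nat \<Rightarrow> nat \<Rightarrow> (cell \<times> cell) set" where
  "core_rel k v = {(Up j, Up (Suc j)) |j. j < k} \<union> {(Up (Suc j), Up j) |j. k \<le> j \<and> j < v}
     \<union> {(Lo j, Lo (Suc j)) |j. j < k} \<union> {(Up j, Lo j) |j. j \<le> k}"

text \<open>In \<open>bent_rel k v j\<close> the first \<open>j\<close> cells of the tail extend the lower row to the left and the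
  remaining ones hang below its new left end, from which they are detached in \<open>cut_rel k v j\<close>.\<close>

definition bent_rel :: "nat \<Rightarrow> nat \<Rightarrow> nat \<Rightarrow> (cell \<times> cell) set" where
  "bent_rel k v j = core_rel k v \<union> {(tail_cell (Suc l), tail_cell l) |l. l < j}
     \<union> {(tail_cell l, tail_cell (Suc l)) |l. j \<le> l}"

definition cut_rel :: "nat \<Rightarrow> nat \<Rightarrow> nat \<Rightarrow> (cell \<times> cell) set" where
  "cut_rel k v j = core_rel k v \<union> {(tail_cell (Suc l), tail_cell l) |l. l < j}
     \<union> {(tail_cell l, tail_cell (Suc l)) |l. j < l}"

lemma bent_rel_0: "bent_rel k v 0 = skew_rel k v"
proof -
  have "{(tail_cell l, tail_cell (Suc l)) |l. 0 \<le> l} = tail_rel"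
  proof (intro equalityI subsetI)
    fix x assume "x \<in> {(tail_cell l, tail_cell (Suc l)) |l. 0 \<le> l}"
    then obtain l where "x = (tail_cell l, tail_cell (Suc l))" by auto
    thus "x \<in> tail_rel" by (cases l) (auto simp: tail_rel_def)
  next
    fix x assume "x \<in> tail_rel"
    hence "x = (tail_cell 0, tail_cell (Suc 0)) \<or> (\<exists>j. x
      = (tail_cell (Suc j), tail_cell (Suc (Suc j))))"
      by (auto simp: tail_rel_def)
    thus "x \<in> {(tail_cell l, tail_cell (Suc l)) |l. 0 \<le> l}" by blast
  qed
  thus ?thesis by (simp add: bent_rel_def skew_rel_def core_rel_def)
qed

text \<open>With exactly \<open>j\<close> tail cells nothing is detached, and a rotation by 180
  degrees yields a straight shape: the prolonged lower row becomes the first row, and the right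
  column becomes the rest of the first column. The rotation reverses the order, whence the converse
  relation.\<close>

lemma lin_cut_eq_straight:
  assumes "k \<le> v"
  shows "lin (cells (Suc v) (Suc k) j) (cut_rel k v j) = straight (k + 1 + j) (k + 1) (v - k)"
proof -
  let ?S = "cells (Suc v) (Suc k) j" and ?T = "cells (k + 1) (k + 1 + j) (v - k)"
  define \<pi> where "\<pi> x = (case x of Up a \<Rightarrow> if a \<le> k then Up (k - a) else Tl (a - k - 1)
      | Lo a \<Rightarrow> Lo (k - a) | Tl l \<Rightarrow> Lo (k + 1 + l))" for x
  define \<rho> where "\<rho> x = (case x of Up a \<Rightarrow> Up (k - a) | Tl a \<Rightarrow> Up (a + k + 1)
      | Lo a \<Rightarrow> if a \<le> k then Lo (k - a) else Tl (a - k - 1))" for x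
  have \<pi>: "bij_betw \<pi> ?S ?T"
  proof (rule bij_betwI[where g = \<rho>])
    show "\<pi> \<in> ?S \<rightarrow> ?T" by (auto simp: cells_def \<pi>_def)
    show "\<rho> \<in> ?T \<rightarrow> ?S" using assms by (auto simp: cells_def \<rho>_def)
    show "\<rho> (\<pi> x) = x" if "x \<in> ?S" for x using that by (cases x) (auto simp: \<pi>_def \<rho>_def)
    show "\<pi> (\<rho> x) = x" if "x \<in> ?T" for x using that by (cases x) (auto simp: \<pi>_def \<rho>_def)
  qed
  have cut: "cut_rel k v j = core_rel k v \<union> {(tail_cell (Suc l), tail_cell l) |l. l < j}
     \<union> {(Tl l, Tl (Suc l)) |l. j \<le> l}"
  proof -
    have "{(tail_cell l, tail_cell (Suc l)) |l. j < l} = {(Tl l, Tl (Suc l)) |l. j \<le> l}"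
    proof (intro equalityI subsetI)
      fix x assume "x \<in> {(tail_cell l, tail_cell (Suc l)) |l. j < l}"
      then obtain l where "x = (tail_cell l, tail_cell (Suc l))" "j < l" by auto
      thus "x \<in> {(Tl l, Tl (Suc l)) |l. j \<le> l}" by (cases l) auto
    next
      fix x assume "x \<in> {(Tl l, Tl (Suc l)) |l. j \<le> l}"
      then obtain l where "x = (tail_cell (Suc l), tail_cell (Suc (Suc l)))" "j < Suc l" by auto
      thus "x \<in> {(tail_cell l, tail_cell (Suc l)) |l. j < l}" by blast
    qed
    thus ?thesis by (simp add: cut_rel_def)
  qed
  have "lin ?S (cut_rel k v j) = lin ?T (straight_rel\<inverse>)"
  proof (rule lin_iso_rel[OF \<pi>])
    fix x y assume S: "x \<in> ?S" "y \<in> ?S"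
    show "(x, y) \<in> cut_rel k v j \<longleftrightarrow> (\<pi> x, \<pi> y) \<in> straight_rel\<inverse>"
      unfolding cut using S assms
      by (cases x; cases y)
        (auto simp: core_rel_def straight_rel_def \<pi>_def tail_cell_def split: nat.splits)
  qed
  thus ?thesis by (simp add: straight_def lin_rev[of _ "straight_rel"])
qed

text \<open>Comparing \<open>tail_cell j\<close> with \<open>tail_cell (j + 1)\<close> in the cut
  order either leaves the rest of the tail hanging or bends one more cell into the row, so the cut
  orders telescope to \<open>bent_rel k v 0\<close>, the skew shape. The detached rest is a chain of
  \<open>m - 1 - j\<close> cells, which accounts for the binomial coefficient.\<close>

lemma sk_expansion:
  assumes "m \<ge> 1" "k \<le> v"
  shows "int (sk m k v) = (\<Sum>j<m. (-1) ^ j *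
    int ((m + v + k + 1 choose (m - 1 - j)) * straight (k + 1 + j) (k + 1) (v - k)))"
proof -
  let ?S = "cells (Suc v) (Suc k) (m - 1)"
  have cut: "lin ?S (cut_rel k v j)
    = (m + v + k + 1 choose (m - 1 - j)) * straight (k + 1 + j) (k + 1) (v - k)"
    if j: "j < m" for j
  proof -
    let ?T = "cells (Suc v) (Suc k) j" and ?c = "\<lambda>l. Tl (j + l)" and ?e = "m - 1 - j"
    have "lin (?T \<union> ?c ` {..<?e}) (cut_rel k v j)
      = (card ?T + ?e choose ?e) * lin ?T (cut_rel k v j)"
    proof (rule lin_chain)
      show "(x, ?c l) \<notin> cut_rel k v j \<and> (?c l, x) \<notin> cut_rel k v j" if "x \<in> ?T" "l < ?e" for x l
        using that by (auto simp: cut_rel_def core_rel_def tail_cell_def split: nat.splits)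
      show "(?c l, ?c l') \<in> cut_rel k v j \<longleftrightarrow> l' = Suc l" if "l < ?e" "l' < ?e" for l l'
      proof
        assume "l' = Suc l"
        hence "(?c l, ?c l') \<in> {(tail_cell l, tail_cell (Suc l)) |l. j < l}"
          by (intro CollectI exI[of _ "Suc (j + l)"]) simp
        thus "(?c l, ?c l') \<in> cut_rel k v j" by (simp add: cut_rel_def)
      qed (auto simp: cut_rel_def core_rel_def tail_cell_def split: nat.splits)
    qed (auto simp: inj_on_def)
    moreover have "?T \<union> ?c ` {..<?e} = ?S"
    proof (intro equalityI subsetI)
      fix x assume x: "x \<in> ?S"
      show "x \<in> ?T \<union> ?c ` {..<?e}"
      proof (cases x)
        case (Tl l)
        thus ?thesis using x by (cases "l < j") (auto intro!: image_eqI[of _ _ "l - j"])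
      qed (use x in auto)
    qed (use j in \<open>auto simp: cells_def\<close>)
    moreover have "card ?T + ?e = m + v + k + 1" using j by simp
    ultimately show ?thesis using lin_cut_eq_straight[OF assms(2), of j] by (simp only:)
  qed
  have step: "lin ?S (cut_rel k v j) = lin ?S (bent_rel k v j) + lin ?S (bent_rel k v (Suc j))"
    if j: "j < m - 1" for j
  proof -
    have "insert (tail_cell j, tail_cell (Suc j)) (cut_rel k v j) = bent_rel k v j"
      unfolding cut_rel_def bent_rel_def by (auto simp: le_less)
    moreover have "insert (tail_cell (Suc j), tail_cell j) (cut_rel k v j) = bent_rel k v (Suc j)"
      unfolding cut_rel_def bent_rel_def
        by (auto simp: less_Suc_eq Suc_le_eq simp del: tail_cell_simps)
    moreover have "tail_cell j \<in> ?S" "tail_cell (Suc j) \<in> ?S" "tail_cell j \<noteq> tail_cell (Suc j)"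
      using j by (auto simp: tail_cell_def split: nat.splits)
    ultimately show ?thesis using lin_split[of ?S "tail_cell j" "tail_cell (Suc j)" "cut_rel k v j"]
      by simp
  qed
  have last: "lin ?S (cut_rel k v (m - 1)) = lin ?S (bent_rel k v (m - 1))"
  proof (rule lin_cong)
    show "compatible ?S (cut_rel k v (m - 1)) f = compatible ?S (bent_rel k v (m - 1)) f" for f
    proof -
      have "compatible ?S {(tail_cell l, tail_cell (Suc l)) |l. Q l} f" if "\<And>l. Q l \<Longrightarrow> m - 1 \<le> l"
        for Q
        unfolding compatible_Collect using that by fastforce
      hence "compatible ?S {(tail_cell l, tail_cell (Suc l)) |l. m - 1 < l} f"
        "compatible ?S {(tail_cell l, tail_cell (Suc l)) |l. m - 1 \<le> l} f"
          by (simp_all add: less_imp_le)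
      thus ?thesis unfolding cut_rel_def bent_rel_def compatible_Un by blast
    qed
  qed simp
  have "(\<Sum>j=0..m - 1. (-1) ^ (m - 1 - j) * int (lin ?S (cut_rel k v j)))
      = (-1) ^ (m - 1 - 0) * int (lin ?S (bent_rel k v 0))"
    using step last by (intro alternating_telescope) auto
  moreover have "{0..m - 1} = {..<m}" using assms by auto
  ultimately have *: "(-1) ^ (m - 1) * int (sk m k v)
    = (\<Sum>j<m. (-1) ^ (m - 1 - j) * int (lin ?S (cut_rel k v j)))"
    by (simp add: bent_rel_0 sk_def)
  have "int (sk m k v) = (-1) ^ (m - 1) * ((-1) ^ (m - 1) * int (sk m k v))"
    by (simp flip: power_add mult.assoc)
  also have "\<dots> = (\<Sum>j<m. (-1) ^ (m - 1) * (-1) ^ (m - 1 - j) * int (lin ?S (cut_rel k v j)))"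
    unfolding * by (simp add: sum_distrib_left mult.assoc)
  also have "\<dots> = (\<Sum>j<m. (-1) ^ j * int (lin ?S (cut_rel k v j)))"
  proof (rule sum.cong[OF refl])
    fix j assume "j \<in> {..<m}"
    hence "m - 1 + (m - 1 - j) = 2 * (m - 1 - j) + j" by auto
    hence "(-1 :: int) ^ (m - 1 + (m - 1 - j)) = (-1) ^ (2 * (m - 1 - j) + j)" by (simp only:)
    hence "(-1 :: int) ^ (m - 1) * (-1) ^ (m - 1 - j) = (-1) ^ (2 * (m - 1 - j) + j)"
      by (simp only: power_add)
    thus "(-1) ^ (m - 1) * (-1) ^ (m - 1 - j) * int (lin ?S (cut_rel k v j))
      = (-1) ^ j * int (lin ?S (cut_rel k v j))"
      by (simp add: power_add power_mult)
  qed
  finally show ?thesis using cut by simp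
qed

text \<open>The coefficient of x^n in (1 + x)^(N+1) / (1 + x).\<close>

lemma alternating_choose:
  "(\<Sum>j<Suc n. (-1) ^ j * int (Suc N choose (n - j))) = int (N choose n)"
proof (induction n)
  case (Suc n)
  have "(\<Sum>j<Suc (Suc n). (-1) ^ j * int (Suc N choose (Suc n - j)))
      = int (Suc N choose Suc n) - (\<Sum>j<Suc n. (-1) ^ j * int (Suc N choose (n - j)))"
    by (subst sum.lessThan_Suc_shift) (simp add: sum_negf)
  thus ?case using Suc by simp
qed simp

text \<open>The coefficient of x^n in (1 + x)^(N+2) / (1 + x)^2.\<close>

lemma alternating_weighted_choose:
  "(\<Sum>j<Suc n. (-1) ^ j * (int j + 1) * int (Suc (Suc N) choose (n - j))) = int (N choose n)"
proof (induction n)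
  case (Suc n)
  have "(\<Sum>j<Suc (Suc n). (-1) ^ j * (int j + 1) * int (Suc (Suc N) choose (Suc n - j)))
      = int (Suc (Suc N) choose Suc n) + (\<Sum>j<Suc n. (-1) ^ Suc j * (int (Suc j) + 1) * int (Suc
        (Suc N) choose (n - j)))"
    by (subst sum.lessThan_Suc_shift) simp
  also have "(\<Sum>j<Suc n. (-1) ^ Suc j * (int (Suc j) + 1) * int (Suc (Suc N) choose (n - j)))
      = - (\<Sum>j<Suc n. (-1) ^ j * (int j + 1) * int (Suc (Suc N) choose (n - j)))
        - (\<Sum>j<Suc n. (-1) ^ j * int (Suc (Suc N) choose (n - j)))"
    unfolding sum_negf[symmetric] sum_subtractf[symmetric]
    by (rule sum.cong) (auto simp: algebra_simps)
  finally show ?case unfolding Suc alternating_choose by simp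
qed simp


text \<open>The terms \<open>T m j\<close> of \<open>sk_expansion\<close> satisfy (m + d) T (m-1) j
  = (m - 1 - j) T m j. Subtracting this from (m + d - i) T m j leaves the factor d - i + 1 + j,
  which cancels the only factor of the hook formula that couples \<open>j\<close> to
  \<open>d\<close>. What remains is summed by \<open>alternating_weighted_choose\<close>.\<close>

lemma u_coeff_corank_step:
  assumes "1 \<le> m" "1 \<le> i" "2 * i < d"
  shows "(real m + real d - real i) * of_int (u_coeff m d i)
    = (real m + real d) * of_int (u_coeff (m - 1) d i)
    + fact (m + d) * real (m + i - 2 choose (m - 1)) / (fact (m + i) *
      (real d - real i) * fact i * fact (d - 2 * i - 1))"
proof -
  define r where "r = d - 2 * i - 1"
  have d: "d = 2 * i + r + 1" using assms by (simp add: r_def)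
  define K where "K = 1 / ((real d - real i) * fact i * fact r)"
  have Di: "real d - real i > 0" using assms by simp
  define T where "T m j = real (m + d choose (m - 1 - j)) * real (straight (i + 1 + j) (i + 1) r)"
    for m j
  have u: "of_int (u_coeff m d i) = (\<Sum>j<m. (-1) ^ j * T m j)" for m
  proof (cases "m = 0")
    case False
    have "u_coeff m d i = int (sk m i (d - i - 1))"
      using u_coeff_eq_sk[of m i "d - i - 1"] False assms by simp
    also have "real_of_int \<dots> = (\<Sum>j<m. (-1) ^ j * T m j)"
      using sk_expansion[of m i "d - i - 1"] False assms by (simp add: T_def r_def mult_2)
    finally show ?thesis .
  qed (use assms in \<open>simp add: u_coeff_m0\<close>)
  have T: "T m j = K * fact (m + d) * (real j + 1) / (fact (m - 1 - j) * fact (i + 1 + j) * (real d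
    - real i + 1 + real j))"
    if "j < m" for m j
  proof -
    have "real (straight (i + 1 + j) (i + 1) r) = fact (d + 1 + j) * (real j + 1)
        / ((real d - real i + 1 + real j) * (real d - real i) * fact (i + 1 + j) * fact i * fact r)"
    proof -
      have "i + 1 + j + (i + 1) + r = d + 1 + j" "real (i + 1 + j) - real (i + 1) + 1 = real j + 1"
        "real (i + 1 + j) + real r + 1 = real d - real i + 1 + real j" "real (i + 1) + real r
          = real d - real i"
        "i + 1 - 1 = i" using d by auto
      thus ?thesis using straight_hook[of "i + 1" "i + 1 + j" r] by (simp only:)
    qed
    moreover have "real (m + d choose (m - 1 - j))
      = fact (m + d) / (fact (m - 1 - j) * fact (d + 1 + j))"
    proof -
      have "m + d - (m - 1 - j) = d + 1 + j" "m - 1 - j \<le> m + d" using that by auto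
      thus ?thesis using binomial_fact[of "m - 1 - j" "m + d", where 'a = real] by simp
    qed
    moreover have "real d - real i + 1 + real j > 0" using Di by simp
    ultimately show ?thesis unfolding T_def K_def by (simp del: fact_Suc)
  qed
  have step: "(real m + real d - real i) * T m j - (if j < m - 1 then (real m + real d) * T (m
    - 1) j else 0)
      = K * fact (m + d) / fact (m + i) * ((real j + 1) * real (m + i choose
        (m - 1 - j)))" if "j < m" for j
  proof -
    have pos: "real d - real i + 1 + real j > 0" using Di by simp
    have S: "(if j < m - 1 then (real m + real d) * T (m - 1) j else 0)
      = (real m - 1 - real j) * T m j"
    proof (cases "j < m - 1")
      case True
      have f: "fact (m + d) = (real m + real d) * fact (m - 1 + d)"
        "fact (m - 1 - j) = (real m - 1 - real j) * fact (m - 1 - 1 - j)"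
        using True by (cases m; simp add: fact_reduce of_nat_diff algebra_simps)+
      have "real m - 1 - real j > 0" using True by auto
      have t: "T m j = K * ((real m + real d) * fact (m - 1 + d)) * (real j + 1) /
          ((real m - 1 - real j) * fact (m - 1 - 1 - j) * fact (i + 1 + j) *
            (real d - real i + 1 + real j))"
        "T (m - 1) j = K * fact (m - 1 + d) * (real j + 1) /
          (fact (m - 1 - 1 - j) * fact (i + 1 + j) * (real d - real i + 1 + real j))"
        using T[OF that] T[OF True] unfolding f by blast+
      have "N * (K * A * J / (B * C * E)) = c * (K * (N * A) * J / (c * B * C * E))" if "c > 0"
        for N A B C E J c :: real using that by (simp add: mult_ac)
      from this[OF \<open>real m - 1 - real j > 0\<close>] show ?thesis unfolding t if_P[OF True] .
    next
      case False
      hence "real m - 1 - real j = 0" using that by auto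
      thus ?thesis using False by simp
    qed
    have "real (m + i choose (m - 1 - j)) = fact (m + i) / (fact (m - 1 - j) * fact (i + 1 + j))"
    proof -
      have "m + i - (m - 1 - j) = i + 1 + j" "m - 1 - j \<le> m + i" using that by auto
      thus ?thesis using binomial_fact[of "m - 1 - j" "m + i", where 'a = real] by simp
    qed
    moreover have "(real m + real d - real i) * T m j - (real m - 1 - real j) * T m j
        = (real d - real i + 1 + real j) * T m j" by (simp add: algebra_simps)
    ultimately show ?thesis unfolding S using T[OF that] pos by (simp del: fact_Suc)
  qed
  have "(real m + real d - real i) * of_int (u_coeff m d i) - (real m + real d) * of_int (u_coeff (m
    - 1) d i)
      = (\<Sum>j<m. (-1) ^ j * ((real m + real d - real i) * T m j))
        - (\<Sum>j<m. if j < m - 1 then (-1) ^ j * ((real m + real d) * T (m - 1) j) else 0)"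
  proof -
    have "(\<Sum>j<m - 1. (-1) ^ j * ((real m + real d) * T (m - 1) j))
        = (\<Sum>j<m. if j < m - 1 then (-1) ^ j * ((real m + real d) * T (m - 1) j) else 0)"
      by (rule sum.mono_neutral_cong_left) auto
    thus ?thesis unfolding u by (simp add: sum_distrib_left mult.left_commute)
  qed
  also have "\<dots> = (\<Sum>j<m. (-1) ^ j * (K * fact (m + d) / fact (m + i) * ((real j + 1) * real (m
    + i choose (m - 1 - j)))))"
    unfolding sum_subtractf[symmetric]
  proof (rule sum.cong[OF refl])
    fix j assume "j \<in> {..<m}"
    with step[of j, symmetric] show "(-1) ^ j * ((real m + real d - real i) * T m j) -
        (if j < m - 1 then (-1) ^ j * ((real m + real d) * T (m - 1) j) else 0)
        = (-1) ^ j * (K * fact (m + d) / fact (m + i) * ((real j + 1) * real (m + i choose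
          (m - 1 - j))))"
      by (simp add: right_diff_distrib)
  qed
  also have "\<dots> = K * fact (m + d) / fact (m + i) *
      of_int (\<Sum>j<m. (-1) ^ j * (int j + 1) * int (m + i choose (m - 1 - j)))"
    by (simp add: sum_distrib_left mult_ac)
  also have "(\<Sum>j<m. (-1) ^ j * (int j + 1) * int (m + i choose (m - 1 - j)))
    = int (m + i - 2 choose (m - 1))"
    using alternating_weighted_choose[of "m + i - 2" "m - 1"] assms
      by (simp add: numeral_2_eq_2 Suc_diff_Suc)
  finally show ?thesis using Di by (simp add: K_def r_def mult_ac del: fact_Suc)
qed

text \<open>This will be applied to $y_m = U_{m,d} / (\binom{m+d}{d} Q_d)$, coefficientwise, and
  \<open>D = d - i\<close>. In the excluded case the value is 9/40.\<close>

lemma y_lower_bound: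
  fixes y :: "nat \<Rightarrow> real" and D i :: nat
  assumes iD: "1 \<le> i" "i < D" and y0: "y 0 = 0"
    and rec: "\<And>m. m \<ge> 1 \<Longrightarrow> (real m + real D) * y m = real m * y (m - 1)
      + real m * ((real D)\<^sup>2 - 1) * (real i + 1) / (2 * (real m + real i) *
        (real m + real i - 1) * real D)"
    and m: "m \<ge> 1" and exc: "\<not> (m = 3 \<and> D = 2 \<and> i = 1)"
  shows "y m \<ge> 1 / (real (max m (D + i)) + 1)"
proof -
  define a b where "a = real D" and "b = real i"
  have ab: "b \<ge> 1" "a \<ge> b + 1" using iD by (auto simp: a_def b_def)
  define \<rho> where "\<rho> x = x * (a\<^sup>2 - 1) * (b + 1) / (2 * (x + b) * (x + b - 1) * a)" for x :: real
  have rec: "(real m + a) * y m = real m * y (m - 1) + \<rho> (real m)" if "m \<ge> 1" for m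
    using rec[OF that] by (simp add: \<rho>_def a_def b_def)
  \<comment> \<open>\<open>P x \<ge> 0\<close> means \<open>\<rho> x \<ge> a / (a + b + 1)\<close>.
    This is what preserves the constant bound 1 / (a + b + 1): the right-hand side of the recursion
    is then at least (m + a) / (a + b + 1).\<close>
  define P where "P x = x * (a\<^sup>2 - 1) * (b + 1) * (a + b + 1) - 2 * (x + b) * (x + b - 1) * a\<^sup>2"
    for x
  have frac: "C / X \<le> N / M" if "C * M \<le> N * X" "M > 0" "X > 0" for C X N M :: real
    using that by (simp add: pos_le_divide_eq pos_divide_le_eq)
  have \<rho>P: "\<rho> x \<ge> a / (a + b + 1)" if "P x \<ge> 0" "x \<ge> 1" for x
  proof -
    have "x + b > 0" "x + b - 1 > 0" "a > 0" "a + b + 1 > 0" using that ab by auto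
    hence pos: "2 * (x + b) * (x + b - 1) * a > 0" by simp
    have "a * (2 * (x + b) * (x + b - 1) * a) \<le> (x * (a\<^sup>2 - 1) * (b + 1)) * (a + b + 1)"
      using that(1) by (simp add: P_def power2_eq_square mult_ac)
    thus ?thesis unfolding \<rho>_def using pos \<open>a + b + 1 > 0\<close> by (rule frac)
  qed
  have next_ge: "y m \<ge> 1 / (a + b + 1)" if "m \<ge> 1" "y (m - 1) \<ge> 1 / (a + b + 1)" "P (real m) \<ge> 0"
    for m
  proof -
    have "(real m + a) * y m \<ge> real m * (1 / (a + b + 1)) + a / (a + b + 1)"
      unfolding rec[OF that(1)] using that \<rho>P[of "real m"] by (intro add_mono mult_left_mono) auto
    also have "real m * (1 / (a + b + 1)) + a / (a + b + 1) = (real m + a) * (1 / (a + b + 1))"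
      by (simp add: add_divide_distrib)
    finally show ?thesis using that(1) ab by (subst (asm) mult_le_cancel_left_pos) auto
  qed
  have y1: "y 1 \<ge> 1 / (a + b + 1)"
  proof -
    have "\<rho> 1 = (a + 1) * (a - 1) * (b + 1) / (2 * b * a * (b + 1))"
      by (simp add: \<rho>_def power2_eq_square algebra_simps)
    hence "\<rho> 1 = (1 + a) * ((a - 1) / (2 * b * a))" using ab by simp
    hence "(1 + a) * y 1 = (1 + a) * ((a - 1) / (2 * b * a))" using rec[of 1] y0 by simp
    hence "y 1 = (a - 1) / (2 * b * a)" using ab by (subst (asm) mult_left_cancel) auto
    moreover have "(a - 1) * (a + b + 1) \<ge> 2 * b * a"
    proof -
      have "(a - 1) * (a + b + 1) \<ge> (a - 1) * (2 * b + 2)" using ab by (intro mult_left_mono) auto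
      thus ?thesis using ab by (simp add: algebra_simps)
    qed
    ultimately show ?thesis using ab by (simp add: frac)
  qed
  have P1: "P 1 \<ge> 0"
  proof -
    have "(a\<^sup>2 - 1) * (a + b + 1) \<ge> (a\<^sup>2 - 1) * (2 * b + 2)"
      using ab by (intro mult_left_mono) auto
    moreover have "a\<^sup>2 \<ge> (b + 1) * (b + 1)" using ab unfolding power2_eq_square
      by (intro mult_mono) auto
    moreover have "(b + 1) * (b + 1) \<ge> (b + 1) * 1" using ab by (intro mult_left_mono) auto
    ultimately have "a\<^sup>2 \<ge> b + 1" "(a\<^sup>2 - 1) * (a + b + 1) \<ge> (a\<^sup>2 - 1) * (2 * b + 2)" by auto
    hence "(a\<^sup>2 - 1) * (a + b + 1) \<ge> 2 * b * a\<^sup>2" by (simp add: algebra_simps)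
    hence "(b + 1) * ((a\<^sup>2 - 1) * (a + b + 1)) \<ge> (b + 1) * (2 * b * a\<^sup>2)" using ab
      by (intro mult_left_mono) auto
    thus ?thesis by (simp add: P_def algebra_simps)
  qed
  \<comment> \<open>\<open>P\<close> is quadratic with leading coefficient -2 a^2, so it suffices to
    know its sign at the ends of an interval. The identity below is linear interpolation plus the
    nonnegative concavity term.\<close>
  have concave: "P x \<ge> 0" if "1 \<le> x" "x \<le> X" "P X \<ge> 0" for x X
  proof (cases "X = 1")
    case False
    hence X: "X > 1" using that by simp
    have "(X - 1) * P x = (X - x) * P 1 + (x - 1) * P X + 2 * a\<^sup>2 * ((X - 1) * ((x - 1) * (X - x)))"
      unfolding P_def by algebra
    also have "\<dots> \<ge> 0" using that P1 X by (intro add_nonneg_nonneg mult_nonneg_nonneg) auto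
    finally show ?thesis using X by (simp add: zero_le_mult_iff)
  qed (use that P1 in auto)
  have small: "y m \<ge> 1 / (a + b + 1)" if "\<And>k. 1 \<le> k \<Longrightarrow> k \<le> N \<Longrightarrow> P (real k) \<ge> 0" "1 \<le> m" "m \<le> N"
    for m N
    using that(2,3)
  proof (induction m rule: dec_induct)
    case (step n)
    thus ?case using next_ge[of "Suc n"] that(1)[of "Suc n"] by simp
  qed (use y1 in simp)
  let ?d = "D + i"
  have upto: "y m \<ge> 1 / (a + b + 1)" if m: "1 \<le> m" "m \<le> ?d" "\<not> (m = 3 \<and> D = 2 \<and> i = 1)" for m
  proof -
    consider "i = 1" | "i = 2" "D = 3" | "i = 2" "D \<ge> 4" | "i \<ge> 3" using iD by linarith
    thus ?thesis
    proof cases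
      case 1
      hence b: "b = 1" by (simp add: b_def)
      \<comment> \<open>For \<open>i = 1\<close>, \<open>P\<close> is nonnegative up to
        \<open>D\<close> but negative at \<open>D + 1 = ?d\<close>, so \<open>m = D + 1\<close>
        needs an argument of its own.\<close>
      have "P (real k) \<ge> 0" if "1 \<le> k" "k \<le> D" for k
      proof -
        have "P (real k) = 2 * real k * ((a\<^sup>2 - 1) * (a + 2) - (real k + 1) * a\<^sup>2)"
          unfolding P_def b by algebra
        moreover have "(real k + 1) * a\<^sup>2 \<le> (a + 1) * a\<^sup>2"
          using that by (intro mult_right_mono) (auto simp: a_def)
        moreover have "(a\<^sup>2 - 1) * (a + 2) - (a + 1) * a\<^sup>2 = (a - 2) * (a + 1)" by algebra
        moreover have "(a - 2) * (a + 1) \<ge> 0" using ab b by (intro mult_nonneg_nonneg) auto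
        ultimately show ?thesis by simp
      qed
      hence le_D: "y k \<ge> 1 / (a + 2)" if "1 \<le> k" "k \<le> D" for k using small[of D k] that b
        by (simp add: add.commute)
      have \<rho>1: "\<rho> x = (a\<^sup>2 - 1) / ((x + 1) * a)" if "x > 0" for x
      proof -
        have "\<rho> x = ((2 * x) * (a\<^sup>2 - 1)) / ((2 * x) * ((x + 1) * a))"
          unfolding \<rho>_def b by (simp add: algebra_simps)
        thus ?thesis using that by (simp only: mult_divide_mult_cancel_left_if) simp
      qed
      show ?thesis
      proof (cases "m \<le> D")
        case False
        hence mD: "m = D + 1" using m 1 by simp
        consider "D = 2" | "D = 3" | "D \<ge> 4" using iD 1 by linarith
        thus ?thesis
        proof cases
          case D: 1
          thus ?thesis using m mD 1 by simp
        next
          case D: 2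
          have a: "a = 3" using D by (simp add: a_def)
          have "y 1 = 1 / 3" using rec[of 1] y0 by (simp add: \<rho>1 a)
          hence "y 2 = 14 / 45" using rec[of 2] by (simp add: \<rho>1 a)
          hence "y 3 = 4 / 15" using rec[of 3] by (simp add: \<rho>1 a)
          hence "y 4 = 8 / 35" using rec[of 4] by (simp add: \<rho>1 a)
          thus ?thesis using mD D by (simp add: a b)
        next
          case D: 3
          hence a: "a \<ge> 4" by (simp add: a_def)
          \<comment> \<open>Two steps of the recursion with the exact values of
            \<open>\<rho>\<close>, starting from the bound at \<open>D - 1\<close>. They suffice
            because a (a - 3) - 2 is positive, which fails for a = 3; therefore \<open>D = 3\<close>
            was computed outright.\<close>
          have 1: "(a + a) * y D = a * y (D - 1) + \<rho> a" using rec[of D] D by (simp add: a_def)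
          have "\<rho> a = (a - 1) / a" using a by (simp add: \<rho>1 divide_simps power2_eq_square) algebra
          moreover have "a * y (D - 1) \<ge> a * (1 / (a + 2))"
            using le_D[of "D - 1"] D a by (intro mult_left_mono) auto
          ultimately have 2: "(2 * a) * y D \<ge> a / (a + 2) + (a - 1) / a" using 1 by simp
          have 3: "(2 * a + 1) * y m = (a + 1) * y D + \<rho> (a + 1)"
            using rec[of m] mD by (simp add: a_def algebra_simps)
          have 4: "\<rho> (a + 1) = (a\<^sup>2 - 1) / ((a + 2) * a)" using a by (simp add: \<rho>1)
          have "(a + 1) * y D \<ge> (a + 1) * ((a / (a + 2) + (a - 1) / a) / (2 * a))"
            using 2 a by (intro mult_left_mono) (auto simp: divide_simps mult_ac)
          hence "(2 * a + 1) * y m \<ge> (a + 1) * ((a / (a + 2) + (a - 1) / a) / (2 * a)) + (a\<^sup>2 - 1)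
            / ((a + 2) * a)"
            unfolding 3 4 by simp
          also have "(a + 1) * ((a / (a + 2) + (a - 1) / a) / (2 * a)) + (a\<^sup>2 - 1) / ((a + 2) * a)
              = ((a + 1) * (2 * a\<^sup>2 + a - 2) + 2 * a * (a\<^sup>2 - 1)) / (2 * a\<^sup>2 * (a + 2))"
            using a by (simp add: divide_simps power2_eq_square) algebra
          finally have 5: "(2 * a + 1) * y m
            \<ge> ((a + 1) * (2 * a\<^sup>2 + a - 2) + 2 * a * (a\<^sup>2 - 1)) / (2 * a\<^sup>2 * (a + 2))" .
          have "(a + 1) * (2 * a\<^sup>2 + a - 2) + 2 * a * (a\<^sup>2 - 1) - (2 * a + 1) * (2 * a\<^sup>2)
            = a * (a - 3) - 2"
            by algebra
          moreover have "a * (a - 3) \<ge> 4 * 1" using a by (intro mult_mono) auto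
          ultimately have "(2 * a + 1) * (2 * a\<^sup>2)
            \<le> (a + 1) * (2 * a\<^sup>2 + a - 2) + 2 * a * (a\<^sup>2 - 1)" by linarith
          hence "(2 * a + 1) * (2 * a\<^sup>2) / (2 * a\<^sup>2 * (a + 2)) \<le> (2 * a + 1) * y m"
            using a by (intro order_trans[OF divide_right_mono 5]) auto
          moreover have "(2 * a + 1) * (2 * a\<^sup>2) / (2 * a\<^sup>2 * (a + 2))
            = (2 * a + 1) * (1 / (a + 2))"
            using a by simp
          ultimately have "(2 * a + 1) * (1 / (a + 2)) \<le> (2 * a + 1) * y m" by linarith
          thus ?thesis using a b by (subst (asm) mult_le_cancel_left_pos) (auto simp: add.commute)
        qed
      qed (use le_D m b in \<open>auto simp: add.commute\<close>)
    next
      case 2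
      have a: "a = 3" "b = 2" using 2 by (simp_all add: a_def b_def)
      \<comment> \<open>Here \<open>P\<close> is nonnegative at 4 but negative at 5, so the value at
        \<open>?d = 5\<close> is computed.\<close>
      have "P (real k) \<ge> 0" if "1 \<le> k" "k \<le> 4" for k
      proof -
        have "P 4 \<ge> 0" by (simp add: P_def a)
        thus ?thesis using concave[of "real k" 4] that by simp
      qed
      hence le4: "y k \<ge> 1 / (a + b + 1)" if "1 \<le> k" "k \<le> 4" for k using small[of 4 k] that by simp
      show ?thesis
      proof (cases "m \<le> 4")
        case False
        hence "m = 5" using m 2 by simp
        have "y 1 = 1 / 6" using rec[of 1] y0 by (simp add: \<rho>_def a)
        hence "y 2 = 1 / 5" using rec[of 2] by (simp add: \<rho>_def a)
        hence "y 3 = 1 / 5" using rec[of 3] by (simp add: \<rho>_def a)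
        hence "y 4 = 4 / 21" using rec[of 4] by (simp add: \<rho>_def a)
        hence "y 5 = 5 / 28" using rec[of 5] by (simp add: \<rho>_def a)
        thus ?thesis using \<open>m = 5\<close> by (simp add: a)
      qed (use le4 m in auto)
    next
      case 3
      \<comment> \<open>Shifting the variables to the corner of the admissible region makes all
        coefficients of \<open>P (a + b)\<close> nonnegative, and concavity then covers all smaller
        arguments. The next case does the same with two variables.\<close>
      define t where "t = a - 4"
      have t: "t \<ge> 0" "a = 4 + t" "b = 2" using 3 by (auto simp: t_def a_def b_def)
      have "P (a + b) = 98 + 217 * t + 99 * t ^ 2 + 17 * t ^ 3 + t ^ 4"
        unfolding P_def t(2,3) by algebra
      also have "\<dots> \<ge> 0" using t(1) by simp
      finally have "P (real k) \<ge> 0" if "1 \<le> k" "k \<le> ?d" for k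
        using concave[of "real k" "a + b"] that by (simp add: a_def b_def)
      thus ?thesis using small[of ?d m] m by simp
    next
      case 4
      define s t where "s = b - 3" and "t = a - b - 1"
      have st: "s \<ge> 0" "t \<ge> 0" "b = 3 + s" "a = 4 + s + t" using 4 ab
        by (auto simp: s_def t_def b_def)
      have "P (a + b) = 480 + 644*t + 248*t^2 + 38*t^3 + 2*t^4 + 1168*s + 1033*s*t + 289*s*t^2
        + 31*s*t^3 + s*t^4 + 942*s^2 + 582*s^2*t + 108*s^2*t^2 + 6*s^2*t^3 + 346*s^3 + 139*s^3*t
        + 13*s^3*t^2 + 60*s^4 + 12*s^4*t + 4*s^5"
        unfolding P_def st(3,4) by algebra
      also have "\<dots> \<ge> 0" using st(1,2) by simp
      finally have "P (real k) \<ge> 0" if "1 \<le> k" "k \<le> ?d" for k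
        using concave[of "real k" "a + b"] that by (simp add: a_def b_def)
      thus ?thesis using small[of ?d m] m by simp
    qed
  qed
  \<comment> \<open>Beyond \<open>?d\<close> the bound to be propagated is 1 / (m + 1): the term m y
    (m-1) is at least 1, and \<open>\<rho>\<close> is at least (a - 1) / (m + 1), which together
    make (m + a) / (m + 1).\<close>
  have large_step: "y m \<ge> 1 / (real m + 1)" if "m > ?d" "y (m - 1) \<ge> 1 / real m" for m
  proof -
    define x where "x = real m"
    have x: "x \<ge> 2 * b + 1" using that ab by (simp add: x_def a_def b_def)
    have pos: "x > 0" "x + b > 0" "x + b - 1 > 0" "a > 0" "x + 1 > 0" "x + a > 0" using x ab by auto
    have "(b - 1) * (x\<^sup>2 - 3 * x - 2 * b) \<ge> 0"
    proof (cases "i = 1")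
      case False
      hence b: "b \<ge> 2" using iD by (simp add: b_def)
      have "x * (x - 3) \<ge> (2 * b + 1) * (2 * b - 2)" using x b by (intro mult_mono) auto
      moreover have "(2 * b + 1) * (2 * b - 2) \<ge> (2 * b + 1) * 2" using b
        by (intro mult_left_mono) auto
      ultimately have "x\<^sup>2 - 3 * x - 2 * b \<ge> 0" using b
        by (simp add: power2_eq_square algebra_simps)
      thus ?thesis using b by simp
    qed (simp add: b_def)
    moreover have "x * (x + 1) * (b + 1) - 2 * (x + b) * (x + b - 1)
      = (b - 1) * (x\<^sup>2 - 3 * x - 2 * b)"
      by algebra
    ultimately have A: "2 * (x + b) * (x + b - 1) \<le> x * (x + 1) * (b + 1)" by linarith
    have B: "a * (a - 1) \<le> a\<^sup>2 - 1" using ab by (simp add: power2_eq_square algebra_simps)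
    have "(2 * (x + b) * (x + b - 1)) * (a * (a - 1)) \<le> (x * (x + 1) * (b + 1)) * (a\<^sup>2 - 1)"
      by (rule mult_mono[OF A B]) (use pos ab in simp_all)
    hence "(a - 1) * (2 * (x + b) * (x + b - 1) * a) \<le> (x * (a\<^sup>2 - 1) * (b + 1)) * (x + 1)"
      by (simp add: mult_ac)
    hence "(a - 1) / (x + 1) \<le> \<rho> x"
      unfolding \<rho>_def using pos by (intro frac) auto
    moreover have "x * y (m - 1) \<ge> 1" using that(2) pos by (simp add: x_def field_simps)
    ultimately have "(x + a) * y m \<ge> 1 + (a - 1) / (x + 1)" using rec[of m] that
      by (simp add: x_def)
    also have "1 + (a - 1) / (x + 1) = (x + a) * (1 / (x + 1))" using pos by (simp add: field_simps)
    finally show ?thesis using pos by (subst (asm) mult_le_cancel_left_pos) (auto simp: x_def)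
  qed
  show ?thesis
  proof (cases "m \<le> ?d")
    case True
    thus ?thesis using upto[of m] m exc by (simp add: a_def b_def add_ac)
  next
    case False
    have base: "y ?d \<ge> 1 / (real ?d + 1)" if "\<not> (D = 2 \<and> i = 1)"
      using upto[of ?d] that iD by (simp add: a_def b_def)
    \<comment> \<open>For \<open>D = 2\<close> and \<open>i = 1\<close> the bound fails at m = 3, as
      9/40 < 1/4. It holds again at m = 4, with equality, and the induction starts there.\<close>
    have base3: "y 4 \<ge> 1 / 5" if "D = 2" "i = 1"
    proof -
      have a: "a = 2" "b = 1" using that by (simp_all add: a_def b_def)
      have "y 1 = 1 / 4" using rec[of 1] y0 by (simp add: \<rho>_def a)
      hence "y 2 = 1 / 4" using rec[of 2] by (simp add: \<rho>_def a)
      hence "y 3 = 9 / 40" using rec[of 3] by (simp add: \<rho>_def a)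
      thus ?thesis using rec[of 4] by (simp add: \<rho>_def a)
    qed
    have ind: "y m \<ge> 1 / (real m + 1)" if "M \<le> m" "?d \<le> M" "y M \<ge> 1 / (real M + 1)" for m M
      using that(1)
    proof (induction m rule: dec_induct)
      case (step n)
      thus ?case using large_step[of "Suc n"] that(2) by (simp add: add_ac)
    qed (use that in simp)
    have "y m \<ge> 1 / (real m + 1)"
    proof (cases "D = 2 \<and> i = 1")
      case True
      thus ?thesis using ind[of 4 m] base3 False by simp
    next
      case 2: False
      thus ?thesis using ind[of ?d m] base False by simp
    qed
    thus ?thesis using False by (simp add: max_def)
  qed
qed

text \<open>What one circuit-hyperplane subtracts from \<open>u_coeff m d i\<close>.\<close>

definition q_coeff :: "nat \<Rightarrow> nat \<Rightarrow> int" where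
  "q_coeff d i = u_coeff 1 d i - u_coeff 1 (d - 1) i"

text \<open>As \<open>u_coeff 0 d i = 0\<close>, one step of the corank recursion gives both terms
  in closed form. For \<open>d = 2 * i + 1\<close> the second one is 0, and so is its formula
  because of the factor \<open>real r\<close>.\<close>

lemma q_coeff_closed:
  assumes "1 \<le> i" "2 * i < d"
  shows "of_int (q_coeff d i) = 2 * fact d /
    (fact (i + 1) * fact (i - 1) * (real d - real i + 1) * (real d - real i - 1) * fact
      (d - 2 * i - 1))"
proof -
  define r where "r = d - 2 * i - 1"
  define D where "D = real d - real i"
  define K where "K = (fact d / (fact (i + 1) * fact i * D * fact r) :: real)"
  have d: "real d = 2 * real i + real r + 1" using assms by (simp add: r_def)
  have D: "D > 1" using assms by (simp add: D_def)
  have "(1 + D) * of_int (u_coeff 1 d i) = (real d + 1) * K"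
    using u_coeff_corank_step[of 1 i d] assms
    by (simp add: u_coeff_m0 K_def D_def r_def add.commute) (simp add: algebra_simps)?
  hence u1: "of_int (u_coeff 1 d i) = (real d + 1) * K / (D + 1)" using D by (simp add: field_simps)
  have u2: "of_int (u_coeff 1 (d - 1) i) = real r * K / (D - 1)"
  proof (cases r)
    case 0
    thus ?thesis using assms u_coeff_zero[of i "d - 1" 1] by (simp add: r_def)
  next
    case (Suc r')
    have r': "d - 1 - 2 * i - 1 = r'" "2 * i < d - 1" "real (d - 1) = real d - 1" using Suc
      by (auto simp: r_def)
    have f: "fact r = real r * fact r'" "real r > 0" using Suc by simp_all
    have "D * of_int (u_coeff 1 (d - 1) i) = fact d / (fact (i + 1) * (D - 1) * fact i * fact r')"
      using u_coeff_corank_step[of 1 i "d - 1"] assms r' by (simp add: u_coeff_m0 D_def)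
    also have "\<dots> = D * (real r * K / (D - 1))" using D f by (simp add: K_def)
    finally show ?thesis using D by (subst (asm) mult_left_cancel) auto
  qed
  have fi: "fact i = real i * fact (i - 1)" using assms by (simp add: fact_reduce)
  have "(real d + 1) / (D + 1) - real r / (D - 1) = 2 * real i * D / ((D + 1) * (D - 1))"
    using D by (simp add: divide_simps) (simp add: D_def d algebra_simps)
  hence "of_int (q_coeff d i) = 2 * real i * D / ((D + 1) * (D - 1)) * K"
    unfolding q_coeff_def of_int_diff u1 u2 by (metis left_diff_distrib times_divide_eq_left)
  also have "\<dots> = 2 * fact d / (fact (i + 1) * fact (i - 1) * (D + 1) * (D - 1) * fact r)"
    unfolding K_def fi using D assms by (simp add: mult_ac del: fact_Suc)
  finally show ?thesis by (simp add: D_def r_def)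
qed

lemma q_coeff_pos: "\<lbrakk>1 \<le> i; 2 * i < d\<rbrakk> \<Longrightarrow> q_coeff d i > 0"
proof -
  assume "1 \<le> i" "2 * i < d"
  hence "real_of_int (q_coeff d i) > 0" unfolding q_coeff_closed[OF \<open>1 \<le> i\<close> \<open>2 * i < d\<close>] by simp
  thus ?thesis by simp
qed

text \<open>Since m times binomial(m+d, d) equals m + d times binomial(m-1+d, d), the normalization
  by this binomial coefficient turns (m + d) U_{m-1,d} into m y (m-1), so the corank recursion takes
  the form required by \<open>y_lower_bound\<close>.\<close>

lemma u_coeff_ge:
  assumes "1 \<le> i" "2 * i < d" "1 \<le> m" "\<not> (m = 3 \<and> d = 3 \<and> i = 1)"
  shows "real (m + d choose d) * of_int (q_coeff d i)
    \<le> (real (max m d) + 1) * of_int (u_coeff m d i)"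
proof -
  define D where "D = d - i"
  have D: "d = D + i" "i < D" "real d - real i = real D" using assms by (auto simp: D_def)
  define q where "q = real_of_int (q_coeff d i)"
  have q: "q > 0" using q_coeff_pos[OF assms(1,2)] by (simp add: q_def)
  define y where "y m = of_int (u_coeff m d i) / (real (m + d choose d) * q)" for m
  have rec: "(real m + real D) * y m = real m * y (m - 1)
      + real m * ((real D)\<^sup>2 - 1) * (real i + 1) / (2 * (real m + real i) *
        (real m + real i - 1) * real D)"
    if "m \<ge> 1" for m
  proof -
    define C where "C = real (m + d choose d) * q"
    have C: "C > 0" using q by (simp add: C_def)
    have b: "real (m + d choose d) = fact (m + d) / (fact m * fact d)"
      using binomial_fact[of d "m + d", where 'a = real] by (simp add: mult.commute)
    have "real m * real (m + d choose d) = (real m + real d) * real (m - 1 + d choose d)"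
    proof -
      have "real (m - 1 + d choose d) = fact (m - 1 + d) / (fact (m - 1) * fact d)"
        using binomial_fact[of d "m - 1 + d", where 'a = real] by (simp add: mult.commute)
      moreover have "fact (m + d) = (real m + real d) * fact (m - 1 + d)" "fact m
        = real m * fact (m - 1)"
        using that by (auto simp: fact_reduce)
      ultimately show ?thesis using b that by simp
    qed
    hence C': "real m * C = (real m + real d) * (real (m - 1 + d choose d) * q)"
      unfolding C_def by (metis mult.assoc)
    define E where "E = fact (m + d) * real (m + i - 2 choose (m - 1)) /
      (fact (m + i) * (real d - real i) * fact i * fact (d - 2 * i - 1))"
    have "E = C * (real m * ((real D)\<^sup>2 - 1) * (real i + 1) /
        (2 * (real m + real i) * (real m + real i - 1) * real D))"
    proof -
      have c: "real (m + i - 2 choose (m - 1)) = fact (m + i - 2) / (fact (m - 1) * fact (i - 1))"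
      proof -
        have "m + i - 2 - (m - 1) = i - 1" "m - 1 \<le> m + i - 2" using that assms by auto
        thus ?thesis using binomial_fact[of "m - 1" "m + i - 2", where 'a = real] by simp
      qed
      have f: "fact (m + i) = (real m + real i) * ((real m + real i - 1) * fact (m + i - 2))"
        "fact m = real m * fact (m - 1)" "fact (i + 1) = (real i + 1) * fact i"
      proof -
        define n where "n = m + i - 2"
        have n: "m + i = Suc (Suc n)" using \<open>m \<ge> 1\<close> assms(1) by (simp add: n_def)
        have mi: "real m + real i = real n + 2" "m + i - 2 = n" using n by linarith+
        thus "fact (m + i) = (real m + real i) * ((real m + real i - 1) * fact (m + i - 2))"
          unfolding mi n by (simp add: algebra_simps)
      qed (use that in \<open>auto simp: fact_reduce\<close>)
      have pos: "real D - 1 > 0" "real m + real i - 1 > 0" "real m > 0" "real D > 0" "real D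
        + 1 > 0"
        "real m + real i > 0" "real i + 1 > 0" using D assms that by auto
      have sq: "(real D)\<^sup>2 - 1 = (real D + 1) * (real D - 1)" by algebra
      have gen: "F * (a / (b * c)) / (x * (z * a) * E * f * r)
          = F / (n * b * h) * (2 * h / (k * f * c * u * w * r)) * (n * (u * w) * k /
            (2 * x * z * E))"
        if "a > 0" "b > 0" "c > 0" "f > 0" "r > 0" "h > 0" "n > 0" "k > 0" "u > 0" "w > 0" "x > 0"
          "z > 0" "E > 0"
        for F a b c x z E f r n h k u w :: real using that by (simp add: divide_simps)
      show ?thesis
        unfolding E_def C_def b c q_def q_coeff_closed[OF assms(1,2)] D(3) f sq
        by (rule gen) (use pos in simp_all)
    qed
    moreover have "(real m + real D) * of_int (u_coeff m d i)
      = (real m + real d) * of_int (u_coeff (m - 1) d i) + E"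
    proof -
      have "real m + real d - real i = real m + real D" using D(3) by simp
      thus ?thesis using u_coeff_corank_step[OF that assms(1,2)] unfolding E_def by (simp only:)
    qed
    ultimately have "(real m + real D) * y m = (real m + real d) * of_int (u_coeff (m - 1) d i) / C
      + real m * ((real D)\<^sup>2 - 1) * (real i + 1) / (2 * (real m + real i) *
        (real m + real i - 1) * real D)"
      using C unfolding y_def C_def[symmetric] by (simp add: add_divide_distrib)
    moreover have "(real m + real d) * of_int (u_coeff (m - 1) d i) / C = real m * y (m - 1)"
    proof -
      define B where "B = real (m - 1 + d choose d) * q"
      have B: "B > 0" using q by (simp add: B_def)
      have "(real m + real d) * U / C = real m * (U / B)" for U
        using B C C' unfolding B_def[symmetric] by (simp add: frac_eq_eq mult_ac)
      thus ?thesis unfolding y_def B_def[symmetric] .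
    qed
    ultimately show ?thesis by simp
  qed
  have "y m \<ge> 1 / (real (max m (D + i)) + 1)"
    by (rule y_lower_bound[OF assms(1) D(2) _ rec]) (use assms D in \<open>auto simp: y_def u_coeff_m0\<close>)
  moreover have "real (m + d choose d) * q > 0" using q by simp
  ultimately show ?thesis unfolding y_def D(1)[symmetric] q_def by (simp add: divide_simps mult_ac)
qed

text \<open>Here the estimate of \<open>u_coeff_ge\<close> fails, as 4 * 9 < 20 * 2; the exact
  values replace it.\<close>

lemma u_coeff_3_3_1: "u_coeff 3 3 1 = 9" "q_coeff 3 1 = 2"
proof -
  have 1: "real_of_int (u_coeff 1 3 1) = 2"
    using u_coeff_corank_step[of 1 1 3] by (simp add: u_coeff_m0 fact_numeral)
  have "real_of_int (u_coeff 2 3 1) = 5"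
    using u_coeff_corank_step[of 2 1 3] 1 by (simp add: fact_numeral)
  hence "real_of_int (u_coeff 3 3 1) = 9"
    using u_coeff_corank_step[of 3 1 3] by (simp add: fact_numeral)
  thus "u_coeff 3 3 1 = 9" by simp
  have "real_of_int (q_coeff 3 1) = 2" using 1 u_coeff_zero[of 1 2 1] by (simp add: q_coeff_def)
  thus "q_coeff 3 1 = 2" by simp
qed

section \<open>Rank, flats, localization and contraction\<close>

lemma matroid_finite: "matroid M \<Longrightarrow> finite (ground M)"
  by (simp add: matroid_def)

lemma indep_subset: "\<lbrakk>matroid M; X \<in> indep M\<rbrakk> \<Longrightarrow> X \<subseteq> ground M"
  by (simp add: matroid_def)

lemma indep_finite: "\<lbrakk>matroid M; X \<in> indep M\<rbrakk> \<Longrightarrow> finite X"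
  by (rule finite_subset[OF indep_subset matroid_finite])

lemma indep_empty: "matroid M \<Longrightarrow> {} \<in> indep M"
  by (simp add: matroid_def)

lemma indep_mono: "\<lbrakk>matroid M; X \<in> indep M; Y \<subseteq> X\<rbrakk> \<Longrightarrow> Y \<in> indep M"
  unfolding matroid_def by blast

lemma indep_augment:
  "\<lbrakk>matroid M; X \<in> indep M; Y \<in> indep M; card X < card Y\<rbrakk> \<Longrightarrow> \<exists>y\<in>Y - X. insert y X \<in> indep M"
  unfolding matroid_def by blast

lemma finite_indep: "matroid M \<Longrightarrow> finite (indep M)"
  by (rule finite_subset[of _ "Pow (ground M)"]) (auto dest: indep_subset matroid_finite)

lemma card_le_rk: "\<lbrakk>matroid M; X \<in> indep M; X \<subseteq> A\<rbrakk> \<Longrightarrow> card X \<le> rk M A"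
  unfolding rk_def using finite_indep[of M] by (intro Max_ge) auto

lemma rk_attained: "matroid M \<Longrightarrow> \<exists>X\<in>indep M. X \<subseteq> A \<and> card X = rk M A"
proof -
  assume M: "matroid M"
  have "rk M A \<in> card ` {X \<in> indep M. X \<subseteq> A}"
    unfolding rk_def using M finite_indep[OF M] indep_empty[OF M] by (intro Max_in) auto
  thus ?thesis by auto
qed

lemma rk_mono: "\<lbrakk>matroid M; A \<subseteq> B\<rbrakk> \<Longrightarrow> rk M A \<le> rk M B"
proof -
  assume M: "matroid M" and AB: "A \<subseteq> B"
  obtain X where "X \<in> indep M" "X \<subseteq> A" "card X = rk M A" using rk_attained[OF M] by blast
  thus ?thesis using card_le_rk[OF M, of X B] AB by auto
qed

lemma rk_indep: "\<lbrakk>matroid M; X \<in> indep M\<rbrakk> \<Longrightarrow> rk M X = card X"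
proof -
  assume M: "matroid M" and X: "X \<in> indep M"
  obtain Y where Y: "Y \<subseteq> X" "card Y = rk M X" using rk_attained[OF M] by blast
  have "card Y \<le> card X" by (rule card_mono[OF indep_finite[OF M X] Y(1)])
  thus ?thesis using card_le_rk[OF M X order_refl] Y by simp
qed

lemma indep_if_rk:
  assumes "matroid M" "finite X" "rk M X = card X" shows "X \<in> indep M"
proof -
  obtain Y where Y: "Y \<in> indep M" "Y \<subseteq> X" "card Y = rk M X" using rk_attained[OF assms(1)] by blast
  hence "Y = X" using card_subset_eq[OF assms(2)] assms(3) by simp
  thus ?thesis using Y by simp
qed

lemma rk_le_card: "\<lbrakk>matroid M; finite A\<rbrakk> \<Longrightarrow> rk M A \<le> card A"
proof -
  assume M: "matroid M" and A: "finite A"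
  obtain Y where "Y \<subseteq> A" "card Y = rk M A" using rk_attained[OF M] by blast
  thus ?thesis using card_mono[OF A] by metis
qed

lemma rk_empty: "matroid M \<Longrightarrow> rk M {} = 0"
  using rk_indep[OF _ indep_empty, of M] by simp

lemma basis_extend:
  assumes M: "matroid M" and "X \<in> indep M" "X \<subseteq> A"
  shows "\<exists>B\<in>indep M. X \<subseteq> B \<and> B \<subseteq> A \<and> card B = rk M A"
  using assms(2,3)
proof (induction "rk M A - card X" arbitrary: X rule: less_induct)
  case less
  show ?case
  proof (cases "card X = rk M A")
    case False
    hence lt: "card X < rk M A" using card_le_rk[OF M less.prems] by simp
    obtain Y where Y: "Y \<in> indep M" "Y \<subseteq> A" "card Y = rk M A" using rk_attained[OF M] by blast
    obtain y where y: "y \<in> Y - X" "insert y X \<in> indep M"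
      using indep_augment[OF M less.prems(1) Y(1)] lt Y(3) by auto
    have "card (insert y X) = Suc (card X)" using y indep_finite[OF M less.prems(1)] by simp
    moreover have "insert y X \<subseteq> A" using y Y(2) less.prems by auto
    moreover from this have "rk M A - card (insert y X) < rk M A - card X" using lt calculation
      by simp
    ultimately obtain B where "B \<in> indep M" "insert y X \<subseteq> B" "B \<subseteq> A" "card B = rk M A"
      using less.hyps[of "insert y X"] y(2) by blast
    thus ?thesis by blast
  qed (use less.prems in auto)
qed

lemma basis_of_iff:
  assumes M: "matroid M"
  shows "basis_of M A B \<longleftrightarrow> B \<in> indep M \<and> B \<subseteq> A \<and> card B = rk M A"
proof
  assume b: "basis_of M A B"
  then obtain C where C: "C \<in> indep M" "B \<subseteq> C" "C \<subseteq> A" "card C = rk M A"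
    using basis_extend[OF M, of B A] by (auto simp: basis_of_def)
  have "x \<in> B" if "x \<in> C" for x
    using b that C indep_mono[OF M C(1), of "insert x B"] by (auto simp: basis_of_def)
  hence "C = B" using C by auto
  thus "B \<in> indep M \<and> B \<subseteq> A \<and> card B = rk M A" using C by simp
next
  assume b: "B \<in> indep M \<and> B \<subseteq> A \<and> card B = rk M A"
  have "insert x B \<notin> indep M" if "x \<in> A - B" for x
    using card_le_rk[OF M, of "insert x B" A] b that indep_finite[OF M, of B] by auto
  thus "basis_of M A B" using b by (auto simp: basis_of_def)
qed

lemma basis_exists: "matroid M \<Longrightarrow> \<exists>B. basis_of M A B"
  using rk_attained[of M A] by (auto simp: basis_of_iff)

lemma rk_insert_le: "matroid M \<Longrightarrow> rk M (insert x A) \<le> Suc (rk M A)"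
proof -
  assume M: "matroid M"
  obtain X where X: "X \<in> indep M" "X \<subseteq> insert x A" "card X = rk M (insert x A)"
    using rk_attained[OF M] by blast
  have "X - {x} \<in> indep M" using indep_mono[OF M X(1)] by blast
  moreover have "X - {x} \<subseteq> A" using X by auto
  ultimately have "card (X - {x}) \<le> rk M A" by (rule card_le_rk[OF M])
  moreover have "card X \<le> Suc (card (X - {x}))" by (simp add: card_Diff_singleton_if) arith
  ultimately show ?thesis using X by simp
qed

lemma rk_Un_le:
  assumes M: "matroid M" and "finite X" shows "rk M (X \<union> A) \<le> card X + rk M A"
  using assms(2)
proof (induction X rule: finite_induct)
  case (insert x X)
  thus ?case using rk_insert_le[OF M, of x "X \<union> A"] by simp
qed simp

text \<open>If \<open>x\<close> raised the rank of \<open>F\<close>, then a basis of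
  \<open>G\<close>, extended within \<open>F\<close> and after that within
  \<open>insert x F\<close>, would acquire \<open>x\<close>; so \<open>x\<close> would raise the
  rank of \<open>G\<close> as well.\<close>

lemma rk_insert_eq_mono:
  assumes M: "matroid M" and "G \<subseteq> F" "rk M (insert x G) = rk M G"
  shows "rk M (insert x F) = rk M F"
proof (rule ccontr)
  assume "rk M (insert x F) \<noteq> rk M F"
  hence lt: "rk M F < rk M (insert x F)" using rk_mono[OF M subset_insertI[of F x]] by simp
  hence x: "x \<notin> F" by (metis insert_absorb less_irrefl)
  obtain B where B: "B \<in> indep M" "B \<subseteq> G" "card B = rk M G" using rk_attained[OF M] by blast
  obtain B' where B': "B' \<in> indep M" "B \<subseteq> B'" "B' \<subseteq> F" "card B' = rk M F"
    using basis_extend[OF M B(1), of F] B assms(2) by auto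
  obtain C where C: "C \<in> indep M" "B' \<subseteq> C" "C \<subseteq> insert x F" "card C = rk M (insert x F)"
    using basis_extend[OF M B'(1), of "insert x F"] B' by auto
  have "x \<in> C"
  proof (rule ccontr)
    assume "x \<notin> C"
    hence "C \<subseteq> F" using C by auto
    from card_le_rk[OF M C(1) this] show False using C lt by simp
  qed
  hence "insert x B \<in> indep M" using indep_mono[OF M C(1)] B' C by auto
  hence "card (insert x B) \<le> rk M (insert x G)" using card_le_rk[OF M] B by blast
  moreover have "card (insert x B) = Suc (card B)" using x B assms(2) indep_finite[OF M B(1)]
    by (subst card_insert_disjoint) auto
  ultimately show False using assms(3) B by simp
qed

lemma rk_Un_eq:
  assumes M: "matroid M" and "finite A" "\<And>x. x \<in> A \<Longrightarrow> rk M (insert x G) = rk M G"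
  shows "rk M (A \<union> G) = rk M G"
  using assms(2,3)
proof (induction A rule: finite_induct)
  case (insert x A)
  have "rk M (insert x (A \<union> G)) = rk M (A \<union> G)"
    by (rule rk_insert_eq_mono[OF M, of G]) (use insert.prems in auto)
  moreover have "rk M (A \<union> G) = rk M G" using insert by blast
  ultimately show ?case by simp
qed simp

lemma flat_subset: "F \<in> flats M \<Longrightarrow> F \<subseteq> ground M"
  by (simp add: flats_def)

lemma finite_flats: "matroid M \<Longrightarrow> finite (flats M)"
  by (rule finite_subset[of _ "Pow (ground M)"]) (auto simp: flats_def dest: matroid_finite)

lemma ground_flat: "ground M \<in> flats M"
  by (simp add: flats_def)

lemma flat_iff: "F \<in> flats M \<longleftrightarrow> F \<subseteq> ground M \<and> (\<forall>x\<in>ground M - F. rk M F < rk M (insert x F))"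
  by (simp add: flats_def)

lemma rk_less_flat:
  assumes "matroid M" "F \<in> flats M" "F \<subset> G" "G \<subseteq> ground M" shows "rk M F < rk M G"
proof -
  obtain x where x: "x \<in> G - F" using assms by auto
  hence "rk M F < rk M (insert x F)" using assms by (auto simp: flat_iff)
  also have "\<dots> \<le> rk M G" using x assms by (intro rk_mono) auto
  finally show ?thesis .
qed

section \<open>Loops, localization and contraction\<close>

definition loops :: "'a set_system \<Rightarrow> 'a set" where
  "loops M = {x \<in> ground M. rk M {x} = 0}"

lemma rk_loops: "matroid M \<Longrightarrow> rk M (loops M) = 0"
proof -
  assume M: "matroid M"
  have "rk M (loops M \<union> {}) = rk M {}"
  proof (rule rk_Un_eq[OF M])
    show "finite (loops M)" using matroid_finite[OF M] by (simp add: loops_def)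
  qed (simp add: loops_def rk_empty[OF M])
  thus ?thesis by (simp add: rk_empty[OF M])
qed

lemma loops_subset_flat:
  assumes "matroid M" "F \<in> flats M" shows "loops M \<subseteq> F"
proof
  fix x assume x: "x \<in> loops M"
  hence "rk M (insert x F) = rk M F"
    using rk_insert_eq_mono[of M "{}" F x] assms by (simp add: loops_def rk_empty)
  hence "\<not> rk M F < rk M (insert x F)" by simp
  thus "x \<in> F" using assms x unfolding flat_iff loops_def by blast
qed

lemma loops_flat: "matroid M \<Longrightarrow> loops M \<in> flats M"
  unfolding flat_iff
proof (intro conjI ballI)
  fix x assume M: "matroid M" and x: "x \<in> ground M - loops M"
  have "rk M {x} \<le> rk M (insert x (loops M))" by (rule rk_mono[OF M]) auto
  moreover have "rk M {x} > 0" using x by (auto simp: loops_def)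
  ultimately show "rk M (loops M) < rk M (insert x (loops M))" by (simp add: rk_loops[OF M])
qed (auto simp: loops_def)

lemma Inter_flats: "matroid M \<Longrightarrow> \<Inter>(flats M) = loops M"
  using loops_flat loops_subset_flat by blast

lemma rk_flat_0_iff: "\<lbrakk>matroid M; F \<in> flats M\<rbrakk> \<Longrightarrow> rk M F = 0 \<longleftrightarrow> F = loops M"
proof
  assume M: "matroid M" and F: "F \<in> flats M"
  show "F = loops M" if "rk M F = 0"
    using rk_less_flat[OF M loops_flat[OF M] _ flat_subset[OF F]] loops_subset_flat[OF M F] that
      by auto
qed (simp add: rk_loops)

lemma ground_localization [simp]: "ground (localization M F) = F"
  by (simp add: localization_def)

lemma matroid_localization:
  assumes "matroid M" "F \<subseteq> ground M" shows "matroid (localization M F)"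
proof -
  have 1: "finite F" using assms matroid_finite finite_subset by blast
  have 2: "\<exists>y\<in>Y - X. insert y X \<in> indep M \<and> insert y X \<subseteq> F"
    if XY: "X \<in> indep M" "X \<subseteq> F" "Y \<in> indep M" "Y \<subseteq> F" "card X < card Y" for X Y
    using indep_augment[OF assms(1) XY(1,3,5)] XY by blast
  show ?thesis
    unfolding matroid_def localization_def set_system.sel
    using 1 2 indep_empty[OF assms(1)] indep_mono[OF assms(1)] by (auto; blast)
qed

lemma rk_localization: "A \<subseteq> F \<Longrightarrow> rk (localization M F) A = rk M A"
proof -
  assume "A \<subseteq> F"
  hence "{X \<in> indep (localization M F). X \<subseteq> A} = {X \<in> indep M. X \<subseteq> A}"
    by (auto simp: localization_def)
  thus ?thesis by (simp add: rk_def)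
qed

lemma flats_localization:
  assumes M: "matroid M" and F: "F \<in> flats M"
  shows "flats (localization M F) = {G \<in> flats M. G \<subseteq> F}"
proof (intro equalityI subsetI)
  fix G assume G: "G \<in> flats (localization M F)"
  hence GF: "G \<subseteq> F" by (auto simp: flats_def)
  have "rk M G < rk M (insert x G)" if x: "x \<in> ground M - G" for x
  proof (cases "x \<in> F")
    case True
    thus ?thesis using G GF x by (auto simp: flats_def rk_localization)
  next
    case False
    have "rk M (insert x G) \<noteq> rk M G"
    proof
      assume "rk M (insert x G) = rk M G"
      hence "\<not> rk M F < rk M (insert x F)" using rk_insert_eq_mono[OF M GF, of x] by simp
      thus False using F False x unfolding flat_iff by blast
    qed
    thus ?thesis using rk_mono[OF M subset_insertI[of G x]] by simp
  qed
  thus "G \<in> {G \<in> flats M. G \<subseteq> F}" using GF flat_subset[OF F] by (auto simp: flat_iff)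
next
  fix G assume "G \<in> {G \<in> flats M. G \<subseteq> F}"
  thus "G \<in> flats (localization M F)"
    using flat_subset[OF F] by (auto simp: flats_def rk_localization)
qed

lemma ground_contraction [simp]: "ground (contraction M F) = ground M - F"
  by (simp add: contraction_def)

lemma basis_Int:
  assumes M: "matroid M" "B \<in> indep M" "B \<subseteq> F" "card B = rk M F" "C \<in> indep M" "B \<subseteq> C"
  shows "C \<inter> F = B"
proof -
  have "C \<inter> F \<in> indep M" using indep_mono[OF M(1,5)] by blast
  hence "card (C \<inter> F) \<le> card B" using card_le_rk[OF M(1), of "C \<inter> F" F] M(4) by simp
  moreover have "finite (C \<inter> F)" using indep_finite[OF M(1,5)] by simp
  ultimately show ?thesis using card_seteq[of "C \<inter> F" B] M by auto
qed

text \<open>The right-hand side does not mention \<open>B\<close>, so any basis may be chosen in the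
  definition of \<open>contraction\<close>.\<close>

lemma Un_basis_indep_iff:
  assumes M: "matroid M" and F: "F \<subseteq> ground M" and B: "basis_of M F B" and X: "X \<subseteq> ground M - F"
  shows "X \<union> B \<in> indep M \<longleftrightarrow> rk M (X \<union> F) = card X + rk M F"
proof -
  have B: "B \<in> indep M" "B \<subseteq> F" "card B = rk M F" using B by (auto simp: basis_of_iff[OF M])
  have fX: "finite X" using X matroid_finite[OF M] finite_subset by blast
  show ?thesis
  proof
    assume i: "X \<union> B \<in> indep M"
    have "card (X \<union> B) = card X + card B"
      using X B fX indep_finite[OF M B(1)] by (intro card_Un_disjoint) auto
    moreover have "card (X \<union> B) \<le> rk M (X \<union> F)" using card_le_rk[OF M i] B by auto
    ultimately show "rk M (X \<union> F) = card X + rk M F" using rk_Un_le[OF M fX, of F] B by simp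
  next
    assume r: "rk M (X \<union> F) = card X + rk M F"
    obtain C where C: "C \<in> indep M" "B \<subseteq> C" "C \<subseteq> X \<union> F" "card C = rk M (X \<union> F)"
      using basis_extend[OF M B(1), of "X \<union> F"] B by auto
    have CF: "C \<inter> F = B" by (rule basis_Int[OF M B C(1,2)])
    have "card (C - B) = card X"
      using C B r indep_finite[OF M B(1)] by (subst card_Diff_subset) auto
    moreover have "C - B \<subseteq> X" using C CF by auto
    ultimately have "C - B = X" using card_subset_eq[OF fX] by blast
    hence "X \<union> B = C" using C by auto
    thus "X \<union> B \<in> indep M" using C by simp
  qed
qed

lemma indep_contraction_iff:
  assumes "matroid M" "F \<subseteq> ground M"
  shows "X \<in> indep (contraction M F) \<longleftrightarrow> X \<subseteq> ground M - F \<and> rk M (X \<union> F) = card X + rk M F"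
proof -
  have "X \<in> indep (contraction M F) \<longleftrightarrow>
      X \<subseteq> ground M - F \<and> (\<exists>B. basis_of M F B \<and> X \<union> B \<in> indep M)"
    by (simp add: contraction_def)
  also have "\<dots> \<longleftrightarrow> X \<subseteq> ground M - F \<and> rk M (X \<union> F) = card X + rk M F"
    using Un_basis_indep_iff[OF assms] basis_exists[OF assms(1), of F] by blast
  finally show ?thesis .
qed

lemma indep_contraction_basis:
  assumes "matroid M" "F \<subseteq> ground M" "basis_of M F B"
  shows "X \<in> indep (contraction M F) \<longleftrightarrow> X \<subseteq> ground M - F \<and> X \<union> B \<in> indep M"
  using Un_basis_indep_iff[OF assms] indep_contraction_iff[OF assms(1,2)] by blast

lemma matroid_contraction:
  assumes M: "matroid M" and F: "F \<subseteq> ground M" shows "matroid (contraction M F)"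
proof -
  obtain B where b: "basis_of M F B" using basis_exists[OF M] by blast
  hence B: "B \<in> indep M" "B \<subseteq> F" by (auto simp: basis_of_def)
  note iff = indep_contraction_basis[OF M F b]
  show ?thesis
    unfolding matroid_def ground_contraction
  proof (intro conjI ballI allI impI)
    show "finite (ground M - F)" using matroid_finite[OF M] by simp
    show "{} \<in> indep (contraction M F)" using B by (simp add: iff)
    fix X assume X: "X \<in> indep (contraction M F)"
    thus "X \<subseteq> ground M - F" by (simp add: iff)
    fix Y
    show "Y \<in> indep (contraction M F)" if "Y \<subseteq> X"
      using X that indep_mono[OF M, of "X \<union> B" "Y \<union> B"] by (auto simp: iff)
    assume Y: "Y \<in> indep (contraction M F)" and lt: "card X < card Y"
    have "card (Z \<union> B) = card Z + card B" if "Z \<in> indep (contraction M F)" for Z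
    proof (rule card_Un_disjoint)
      show "finite Z" "finite B" using that indep_finite[OF M, of "Z \<union> B"] by (auto simp: iff)
      show "Z \<inter> B = {}" using that B by (auto simp: iff)
    qed
    hence "card (X \<union> B) < card (Y \<union> B)" using X Y lt by simp
    then obtain y where "y \<in> (Y \<union> B) - (X \<union> B)" "insert y (X \<union> B) \<in> indep M"
      using indep_augment[OF M, of "X \<union> B" "Y \<union> B"] X Y by (auto simp: iff)
    thus "\<exists>y\<in>Y - X. insert y X \<in> indep (contraction M F)"
      using X Y by (intro bexI[of _ y]) (auto simp: iff)
  qed
qed

lemma rk_contraction:
  assumes M: "matroid M" and F: "F \<subseteq> ground M" and A: "A \<subseteq> ground M - F"
  shows "rk (contraction M F) A = rk M (A \<union> F) - rk M F"
proof (rule antisym)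
  obtain X where X: "X \<in> indep (contraction M F)" "X \<subseteq> A" "card X = rk (contraction M F) A"
    using rk_attained[OF matroid_contraction[OF M F]] by blast
  have "rk M (X \<union> F) \<le> rk M (A \<union> F)" using X by (intro rk_mono[OF M]) auto
  thus "rk (contraction M F) A \<le> rk M (A \<union> F) - rk M F"
    using X by (auto simp: indep_contraction_iff[OF M F])
  obtain B where b: "basis_of M F B" using basis_exists[OF M] by blast
  hence B: "B \<in> indep M" "B \<subseteq> F" "card B = rk M F" by (auto simp: basis_of_iff[OF M])
  obtain C where C: "C \<in> indep M" "B \<subseteq> C" "C \<subseteq> A \<union> F" "card C = rk M (A \<union> F)"
    using basis_extend[OF M B(1), of "A \<union> F"] B by auto
  have CF: "C \<inter> F = B" by (rule basis_Int[OF M B C(1,2)])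
  have "(C - B) \<union> B = C" using C by auto
  hence "C - B \<in> indep (contraction M F)"
    using C CF A by (auto simp: indep_contraction_basis[OF M F b])
  moreover have "C - B \<subseteq> A" using C CF by auto
  ultimately have "card (C - B) \<le> rk (contraction M F) A"
    by (rule card_le_rk[OF matroid_contraction[OF M F]])
  thus "rk M (A \<union> F) - rk M F \<le> rk (contraction M F) A"
    using C B indep_finite[OF M B(1)] by (simp add: card_Diff_subset)
qed

lemma rank_contraction:
  assumes "matroid M" "F \<subseteq> ground M" shows "rank (contraction M F) = rank M - rk M F"
proof -
  have "ground M - F \<union> F = ground M" using assms by auto
  thus ?thesis using rk_contraction[OF assms, of "ground M - F"] by simp
qed

lemma flats_contraction:
  assumes M: "matroid M" and F: "F \<in> flats M"
  shows "flats (contraction M F) = (\<lambda>G. G - F) ` {G \<in> flats M. F \<subseteq> G}"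
proof -
  note Fs = flat_subset[OF F]
  have iff: "H \<in> flats (contraction M F) \<longleftrightarrow> H \<union> F \<in> flats M" if H: "H \<subseteq> ground M - F" for H
  proof -
    have "rk (contraction M F) H < rk (contraction M F) (insert x H)
      \<longleftrightarrow> rk M (H \<union> F) < rk M (insert x (H \<union> F))"
      if "x \<in> ground M - F - H" for x
      using rk_contraction[OF M Fs H] rk_contraction[OF M Fs, of "insert x H"] that H
        rk_mono[OF M, of F "H \<union> F"] by auto
    thus ?thesis using H Fs by (auto simp: flat_iff)
  qed
  show ?thesis
  proof (intro equalityI subsetI)
    fix H assume H: "H \<in> flats (contraction M F)"
    hence "H \<subseteq> ground M - F" by (auto simp: flat_iff)
    thus "H \<in> (\<lambda>G. G - F) ` {G \<in> flats M. F \<subseteq> G}"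
      using H iff by (intro image_eqI[of _ _ "H \<union> F"]) auto
  next
    fix H assume "H \<in> (\<lambda>G. G - F) ` {G \<in> flats M. F \<subseteq> G}"
    then obtain G where G: "G \<in> flats M" "F \<subseteq> G" "H = G - F" by auto
    hence "H \<union> F = G" "H \<subseteq> ground M - F" using flat_subset[of G] by auto
    thus "H \<in> flats (contraction M F)" using iff G by simp
  qed
qed

lemma contraction_contraction:
  assumes M: "matroid M" and FG: "F \<subseteq> G" "G \<subseteq> ground M"
  shows "contraction (contraction M F) (G - F) = contraction M G"
proof -
  let ?N = "contraction M F"
  have F: "F \<subseteq> ground M" using FG by auto
  note N = matroid_contraction[OF M F]
  have gr: "ground (contraction ?N (G - F)) = ground (contraction M G)" using FG by auto
  have GF: "G - F \<subseteq> ground ?N" using FG by auto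
  have "X \<in> indep (contraction ?N (G - F)) \<longleftrightarrow> X \<in> indep (contraction M G)" for X
  proof (cases "X \<subseteq> ground M - G")
    case True
    have 1: "(X \<union> (G - F)) \<union> F = X \<union> G" "G - F \<union> F = G" using FG by auto
    have "rk ?N (X \<union> (G - F)) = rk M (X \<union> G) - rk M F"
      using rk_contraction[OF M F, of "X \<union> (G - F)"] True FG unfolding 1 by blast
    moreover have "rk ?N (G - F) = rk M G - rk M F"
      using rk_contraction[OF M F, of "G - F"] FG unfolding 1 by blast
    moreover have "rk M F \<le> rk M G" "rk M G \<le> rk M (X \<union> G)" using FG by (auto intro: rk_mono[OF M])
    ultimately show ?thesis
      using True FG by (auto simp: indep_contraction_iff[OF N GF] indep_contraction_iff[OF M FG(2)])
  next
    case False
    thus ?thesis using FG by (auto simp: indep_contraction_iff[OF N GF] indep_contraction_iff[OF M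
      FG(2)])
  qed
  thus ?thesis using gr by (intro set_system.expand) auto
qed

section \<open>Moebius function and characteristic polynomials of intervals\<close>

lemma moebius_refl [simp]: "moebius L X X = 1"
  by (simp add: moebius.simps)

lemma moebius_less:
  "\<lbrakk>finite L; X \<subset> Y\<rbrakk> \<Longrightarrow> moebius L X Y = - (\<Sum>Z | Z \<in> L \<and> X \<subseteq> Z \<and> Z \<subset> Y. moebius L X Z)"
  by (subst moebius.simps) auto

lemma sum_moebius_upper:
  assumes "finite L" "Y \<in> L" "X \<subseteq> Y" "X \<in> L"
  shows "(\<Sum>Z | Z \<in> L \<and> X \<subseteq> Z \<and> Z \<subseteq> Y. moebius L X Z) = (if X = Y then 1 else 0)"
proof (cases "X = Y")
  case True
  hence "{Z \<in> L. X \<subseteq> Z \<and> Z \<subseteq> Y} = {Y}" using assms by auto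
  thus ?thesis using True by simp
next
  case False
  have "{Z \<in> L. X \<subseteq> Z \<and> Z \<subseteq> Y} = insert Y {Z \<in> L. X \<subseteq> Z \<and> Z \<subset> Y}" using assms by auto
  moreover have "finite {Z \<in> L. X \<subseteq> Z \<and> Z \<subset> Y}" using assms by simp
  ultimately show ?thesis using moebius_less[OF assms(1), of X Y] False assms
    by (simp add: psubset_eq)
qed

text \<open>A left inverse of the zeta function is a right inverse. Summing mu(X,W) mu(Z,Y) over all
  W and Z with X <= W <= Z <= Y gives mu(X,Y) if W is summed first. If Z is summed first, the
  induction hypothesis leaves the wanted sum plus mu(X,Y).\<close>

lemma sum_moebius_lower:
  assumes "finite L" "X \<in> L" "Y \<in> L" "X \<subseteq> Y"
  shows "(\<Sum>Z | Z \<in> L \<and> X \<subseteq> Z \<and> Z \<subseteq> Y. moebius L Z Y) = (if X = Y then 1 else 0)"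
  using assms(2,4)
proof (induction "card {Z \<in> L. X \<subseteq> Z \<and> Z \<subseteq> Y}" arbitrary: X rule: less_induct)
  case less
  define I where "I A B = {Z \<in> L. A \<subseteq> Z \<and> Z \<subseteq> B}" for A B
  have fin: "finite (I A B)" for A B using assms(1) by (simp add: I_def)
  define s where "s W = (\<Sum>Z\<in>I W Y. moebius L Z Y)" for W
  show ?case
  proof (cases "X = Y")
    case True
    hence "{Z \<in> L. X \<subseteq> Z \<and> Z \<subseteq> Y} = {Y}" using less.prems by auto
    thus ?thesis using True by simp
  next
    case False
    have IH: "s W = (if W = Y then 1 else 0)" if W: "W \<in> I X Y" "W \<noteq> X" for W
    proof -
      have "I W Y \<subset> I X Y" using W less.prems by (auto simp: I_def)
      hence "card (I W Y) < card (I X Y)" by (rule psubset_card_mono[OF fin])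
      thus ?thesis using less.hyps[of W] W by (auto simp: I_def s_def)
    qed
    have X: "X \<in> I X Y" and Y: "Y \<in> I X Y" using less.prems assms(3) by (auto simp: I_def)
    have "(\<Sum>W\<in>I X Y. moebius L X W * s W) = (\<Sum>W\<in>I X Y. \<Sum>Z\<in>I W Y. moebius L X W * moebius L Z Y)"
      by (simp add: s_def sum_distrib_left)
    also have "\<dots> = (\<Sum>Z\<in>I X Y. \<Sum>W\<in>I X Z. moebius L X W * moebius L Z Y)"
      unfolding sum.Sigma[OF fin ballI[OF fin]]
      by (rule sum.reindex_bij_witness[of _ "\<lambda>(Z, W). (W, Z)" "\<lambda>(W, Z). (Z, W)"])
        (auto simp: I_def)
    also have "\<dots> = (\<Sum>Z\<in>I X Y. (if X = Z then 1 else 0) * moebius L Z Y)"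
    proof (rule sum.cong[OF refl])
      fix Z assume "Z \<in> I X Y"
      thus "(\<Sum>W\<in>I X Z. moebius L X W * moebius L Z Y) = (if X = Z then 1 else 0) * moebius L Z Y"
        using sum_moebius_upper[OF assms(1), of Z X] less.prems
        by (simp add: I_def sum_distrib_right[symmetric])
    qed
    also have "\<dots> = moebius L X Y" using X fin
      by (simp add: if_distrib[of "\<lambda>x. x * _"] cong: if_cong)
    finally have "moebius L X Y = (\<Sum>W\<in>I X Y. moebius L X W * s W)" by simp
    also have "\<dots> = s X + (\<Sum>W\<in>I X Y - {X}. moebius L X W * s W)"
      using X fin by (simp add: sum.remove)
    also have "(\<Sum>W\<in>I X Y - {X}. moebius L X W * s W) = (\<Sum>W\<in>I X Y - {X}. if W
      = Y then moebius L X W else 0)"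
      using IH by (intro sum.cong) auto
    also have "\<dots> = moebius L X Y" using Y False fin by simp
    finally show ?thesis using False by (simp add: s_def I_def)
  qed
qed

lemma moebius_restrict:
  assumes "finite L" "X \<subseteq> Y" "Y \<subseteq> B"
  shows "moebius {G \<in> L. G \<subseteq> B} X Y = moebius L X Y"
  using assms(2,3)
proof (induction "card {Z \<in> L. Z \<subset> Y}" arbitrary: Y rule: less_induct)
  case less
  show ?case
  proof (cases "X = Y")
    case False
    have "(\<Sum>Z | Z \<in> {G \<in> L. G \<subseteq> B} \<and> X \<subseteq> Z \<and> Z \<subset> Y. moebius {G \<in> L. G \<subseteq> B} X Z)
        = (\<Sum>Z | Z \<in> L \<and> X \<subseteq> Z \<and> Z \<subset> Y. moebius L X Z)"
    proof (rule sum.cong)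
      show "{Z. Z \<in> {G \<in> L. G \<subseteq> B} \<and> X \<subseteq> Z \<and> Z \<subset> Y} = {Z. Z \<in> L \<and> X \<subseteq> Z \<and> Z \<subset> Y}"
        using less.prems by blast
      fix Z assume Z: "Z \<in> {Z. Z \<in> L \<and> X \<subseteq> Z \<and> Z \<subset> Y}"
      hence "{W \<in> L. W \<subset> Z} \<subset> {W \<in> L. W \<subset> Y}" by blast
      hence "card {W \<in> L. W \<subset> Z} < card {W \<in> L. W \<subset> Y}"
        using assms(1) by (intro psubset_card_mono) auto
      thus "moebius {G \<in> L. G \<subseteq> B} X Z = moebius L X Z"
        using less.hyps[of Z] Z less.prems by blast
    qed
    thus ?thesis using moebius_less[of _ X Y] assms(1) less.prems False by (simp add: psubset_eq)
  qed simp
qed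

lemma moebius_Diff:
  assumes "finite L" "F \<subseteq> X" "X \<subseteq> Y"
  shows "moebius ((\<lambda>G. G - F) ` {G \<in> L. F \<subseteq> G}) (X - F) (Y - F) = moebius L X Y"
  using assms(3)
proof (induction "card {Z \<in> L. Z \<subset> Y}" arbitrary: Y rule: less_induct)
  case less
  let ?L = "(\<lambda>G. G - F) ` {G \<in> L. F \<subseteq> G}"
  show ?case
  proof (cases "X = Y")
    case False
    hence lt: "X - F \<subset> Y - F" using less.prems assms(2) by blast
    have set: "{Z \<in> ?L. X - F \<subseteq> Z \<and> Z \<subset> Y - F} = (\<lambda>G. G - F) ` {Z \<in> L. X \<subseteq> Z \<and> Z \<subset> Y}"
    proof (intro equalityI subsetI)
      fix Z assume "Z \<in> {Z \<in> ?L. X - F \<subseteq> Z \<and> Z \<subset> Y - F}"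
      then obtain G where G: "G \<in> L" "F \<subseteq> G" "Z = G - F" "X - F \<subseteq> G - F" "G - F \<subset> Y - F" by blast
      hence "X \<subseteq> G" "G \<subset> Y" using assms(2) less.prems by blast+
      thus "Z \<in> (\<lambda>G. G - F) ` {Z \<in> L. X \<subseteq> Z \<and> Z \<subset> Y}" using G by blast
    next
      fix Z assume "Z \<in> (\<lambda>G. G - F) ` {Z \<in> L. X \<subseteq> Z \<and> Z \<subset> Y}"
      then obtain G where G: "G \<in> L" "X \<subseteq> G" "G \<subset> Y" "Z = G - F" by blast
      hence "F \<subseteq> G" "G - F \<subset> Y - F" "X - F \<subseteq> G - F" using assms(2) by blast+
      thus "Z \<in> {Z \<in> ?L. X - F \<subseteq> Z \<and> Z \<subset> Y - F}" using G by blast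
    qed
    have inj: "inj_on (\<lambda>G. G - F) {Z \<in> L. X \<subseteq> Z \<and> Z \<subset> Y}"
      using assms(2) by (intro inj_onI) blast
    have "(\<Sum>Z | Z \<in> ?L \<and> X - F \<subseteq> Z \<and> Z \<subset> Y - F. moebius ?L (X - F) Z)
        = (\<Sum>Z | Z \<in> L \<and> X \<subseteq> Z \<and> Z \<subset> Y. moebius ?L (X - F) (Z - F))"
      unfolding set sum.reindex[OF inj] comp_def ..
    also have "\<dots> = (\<Sum>Z | Z \<in> L \<and> X \<subseteq> Z \<and> Z \<subset> Y. moebius L X Z)"
    proof (rule sum.cong[OF refl])
      fix Z assume Z: "Z \<in> {Z \<in> L. X \<subseteq> Z \<and> Z \<subset> Y}"
      hence "{W \<in> L. W \<subset> Z} \<subset> {W \<in> L. W \<subset> Y}" by blast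
      hence "card {W \<in> L. W \<subset> Z} < card {W \<in> L. W \<subset> Y}"
        using assms(1) by (intro psubset_card_mono) auto
      thus "moebius ?L (X - F) (Z - F) = moebius L X Z" using less.hyps[of Z] Z by blast
    qed
    finally show ?thesis
      using moebius_less[OF _ lt, of ?L] moebius_less[of L X Y] assms(1) less.prems False
      by (simp add: psubset_eq)
  qed simp
qed

text \<open>The characteristic polynomial of the minor with lattice of flats [A, B], taken inside
  \<open>M\<close> so that minors of minors need no Moebius functions of their own.
  \<open>rchi\<close> is its reversal.\<close>

definition chi :: "'a set_system \<Rightarrow> 'a set \<Rightarrow> 'a set \<Rightarrow> int poly" where
  "chi M A B = (\<Sum>H | H \<in> flats M \<and> A \<subseteq> H \<and> H \<subseteq> B. monom (moebius (flats M) A H) (rk M B - rk M H))"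

definition rchi :: "'a set_system \<Rightarrow> 'a set \<Rightarrow> 'a set \<Rightarrow> int poly" where
  "rchi M A B = (\<Sum>H | H \<in> flats M \<and> A \<subseteq> H \<and> H \<subseteq> B. monom (moebius (flats M) A H) (rk M H - rk M A))"

lemma sum_monom: "(\<Sum>x\<in>A. monom (f x) n) = monom (\<Sum>x\<in>A. f x) n"
  by (induction A rule: infinite_finite_induct) (auto simp: add_monom)

text \<open>In the incidence algebra \<open>chi\<close> is the product of the Moebius function and
  the zeta function weighted with t^(rank difference), and \<open>rchi\<close> that of the weighted
  Moebius function and the zeta function. In the product the inner zeta and Moebius functions
  cancel, and after that the weighted ones.\<close>

lemma rchi_chi:
  assumes M: "matroid M" and A: "A \<in> flats M" and G: "G \<in> flats M" and AG: "A \<subseteq> G"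
  shows "(\<Sum>F | F \<in> flats M \<and> A \<subseteq> F \<and> F \<subseteq> G. rchi M A F * chi M F G) = (if A = G then 1 else 0)"
proof -
  let ?L = "flats M" and ?\<mu> = "moebius (flats M)" and ?r = "rk M"
  define I where "I A B = {Z \<in> ?L. A \<subseteq> Z \<and> Z \<subseteq> B}" for A B
  have fin: "finite (I A B)" for A B using finite_flats[OF M] by (simp add: I_def)
  have "(\<Sum>F\<in>I A G. rchi M A F * chi M F G) = (\<Sum>F\<in>I A G. \<Sum>H\<in>I A F. \<Sum>K\<in>I F G.
      monom (?\<mu> A H * ?\<mu> F K) (?r H - ?r A + (?r G - ?r K)))"
    by (simp add: rchi_def chi_def I_def sum_product mult_monom)
  also have "\<dots> = (\<Sum>(F, H, K)\<in>(SIGMA F:I A G. I A F \<times> I F G).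
      monom (?\<mu> A H * ?\<mu> F K) (?r H - ?r A + (?r G - ?r K)))"
    by (simp add: sum.cartesian_product sum.Sigma fin)
  also have "\<dots> = (\<Sum>(H, K, F)\<in>(SIGMA H:I A G. SIGMA K:I H G. I H K).
      monom (?\<mu> A H * ?\<mu> F K) (?r H - ?r A + (?r G - ?r K)))"
    by (rule sum.reindex_bij_witness[of _ "\<lambda>(H, K, F). (F, H, K)" "\<lambda>(F, H, K). (H, K, F)"])
      (auto simp: I_def)
  also have "\<dots> = (\<Sum>H\<in>I A G. \<Sum>K\<in>I H G. \<Sum>F\<in>I H K.
      monom (?\<mu> A H * ?\<mu> F K) (?r H - ?r A + (?r G - ?r K)))"
    by (simp add: sum.Sigma fin)
  also have "\<dots> = (\<Sum>H\<in>I A G. \<Sum>K\<in>I H G. if H = K then monom (?\<mu> A H) (?r G - ?r A) else 0)"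
  proof (intro sum.cong refl)
    fix H K assume H: "H \<in> I A G" and K: "K \<in> I H G"
    have "(\<Sum>F\<in>I H K. monom (?\<mu> A H * ?\<mu> F K) (?r H - ?r A + (?r G - ?r K)))
        = monom (?\<mu> A H * (\<Sum>F\<in>I H K. ?\<mu> F K)) (?r H - ?r A + (?r G - ?r K))"
      by (simp add: sum_monom sum_distrib_left)
    also have "(\<Sum>F\<in>I H K. ?\<mu> F K) = (if H = K then 1 else 0)"
      unfolding I_def using H K by (intro sum_moebius_lower finite_flats[OF M]) (auto simp: I_def)
    also have "monom (?\<mu> A H * (if H = K then 1 else 0)) (?r H - ?r A + (?r G - ?r K))
        = (if H = K then monom (?\<mu> A H) (?r G - ?r A) else 0)"
    proof (cases "H = K")
      case True
      have "?r A \<le> ?r H" "?r H \<le> ?r G" using H by (auto simp: I_def intro: rk_mono[OF M])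
      thus ?thesis using True by simp
    qed simp
    finally show "(\<Sum>F\<in>I H K. monom (?\<mu> A H * ?\<mu> F K) (?r H - ?r A + (?r G - ?r K)))
      = (if H = K then monom (?\<mu> A H) (?r G - ?r A) else 0)" .
  qed
  also have "\<dots> = (\<Sum>H\<in>I A G. monom (?\<mu> A H) (?r G - ?r A))"
  proof (intro sum.cong refl)
    fix H assume "H \<in> I A G"
    hence "H \<in> I H G" by (auto simp: I_def)
    thus "(\<Sum>K\<in>I H G. if H = K then monom (?\<mu> A H) (?r G - ?r A) else 0)
      = monom (?\<mu> A H) (?r G - ?r A)"
      using fin by simp
  qed
  also have "\<dots> = monom (if A = G then 1 else 0) (?r G - ?r A)"
    unfolding sum_monom I_def using sum_moebius_upper[OF finite_flats[OF M] G AG A] by simp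
  also have "\<dots> = (if A = G then 1 else 0)" by (simp add: monom_0 one_pCons)
  finally show ?thesis by (simp add: I_def)
qed

lemma coeff_rev_poly:
  assumes "degree p \<le> n"
  shows "coeff (rev_poly n p) k = (if k \<le> n then coeff p (n - k) else 0)"
proof -
  have "coeff (rev_poly n p) k = (if k < n - degree p then 0 else coeff (reflect_poly p) (k
    - (n - degree p)))"
    by (simp add: rev_poly_def coeff_monom_mult)
  thus ?thesis using assms by (auto simp: coeff_reflect_poly coeff_eq_0)
qed

lemma rev_poly_mult:
  assumes "degree p \<le> a" "degree q \<le> b"
  shows "rev_poly (a + b) (p * q) = rev_poly a p * rev_poly b q"
proof (cases "p = 0 \<or> q = 0")
  case False
  hence "degree (p * q) = degree p + degree q" by (simp add: degree_mult_eq)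
  hence "a + b - degree (p * q) = (a - degree p) + (b - degree q)" using assms by simp
  moreover have "monom 1 (x + y) = monom 1 x * monom (1 :: int) y" for x y by (simp add: mult_monom)
  ultimately show ?thesis by (simp add: rev_poly_def reflect_poly_mult mult_ac)
qed (auto simp: rev_poly_def)

lemma rev_poly_sum:
  assumes "\<And>x. x \<in> A \<Longrightarrow> degree (f x) \<le> n"
  shows "rev_poly n (\<Sum>x\<in>A. f x) = (\<Sum>x\<in>A. rev_poly n (f x))"
proof (rule poly_eqI)
  fix k
  have "degree (\<Sum>x\<in>A. f x) \<le> n"
    using assms by (induction A rule: infinite_finite_induct) (auto intro: degree_add_le)
  thus "coeff (rev_poly n (\<Sum>x\<in>A. f x)) k = coeff (\<Sum>x\<in>A. rev_poly n (f x)) k"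
    using assms by (simp add: coeff_rev_poly coeff_sum)
qed

lemma rev_poly_monom: "k \<le> n \<Longrightarrow> rev_poly n (monom c k) = monom c (n - k)"
proof (rule poly_eqI)
  fix j assume k: "k \<le> n"
  have "degree (monom c k) \<le> n" using degree_monom_le[of c k] k by simp
  thus "coeff (rev_poly n (monom c k)) j = coeff (monom c (n - k)) j"
    using k by (auto simp: coeff_rev_poly)
qed

lemma degree_chi: "matroid M \<Longrightarrow> degree (chi M A B) \<le> rk M B - rk M A"
  unfolding chi_def
proof (rule degree_sum_le)
  fix H assume M: "matroid M" and "H \<in> {H \<in> flats M. A \<subseteq> H \<and> H \<subseteq> B}"
  hence "rk M A \<le> rk M H" by (auto intro: rk_mono)
  thus "degree (monom (moebius (flats M) A H) (rk M B - rk M H)) \<le> rk M B - rk M A"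
    using degree_monom_le[of "moebius (flats M) A H" "rk M B - rk M H"] by linarith
qed (simp add: finite_flats)

lemma rev_chi:
  assumes M: "matroid M"
  shows "rev_poly (rk M B - rk M A) (chi M A B) = rchi M A B"
proof -
  let ?I = "{H \<in> flats M. A \<subseteq> H \<and> H \<subseteq> B}"
  have r: "rk M A \<le> rk M H \<and> rk M H \<le> rk M B" if "H \<in> ?I" for H
    using that by (auto intro: rk_mono[OF M])
  have "rev_poly (rk M B - rk M A) (chi M A B)
    = (\<Sum>H\<in>?I. rev_poly (rk M B - rk M A) (monom (moebius (flats M) A H) (rk M B - rk M H)))"
    unfolding chi_def
  proof (rule rev_poly_sum)
    fix H assume "H \<in> ?I"
    with r[of H] show "degree (monom (moebius (flats M) A H) (rk M B - rk M H)) \<le> rk M B - rk M A"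
      using degree_monom_le[of "moebius (flats M) A H" "rk M B - rk M H"] by linarith
  qed
  also have "\<dots> = rchi M A B"
    unfolding rchi_def
  proof (rule sum.cong[OF refl])
    fix H assume "H \<in> ?I"
    with r[of H] show "rev_poly (rk M B - rk M A) (monom (moebius (flats M) A H) (rk M B - rk M H))
        = monom (moebius (flats M) A H) (rk M H - rk M A)"
      by (subst rev_poly_monom) auto
  qed
  finally show ?thesis .
qed


lemma chi_refl: "A \<in> flats M \<Longrightarrow> chi M A A = 1"
proof -
  assume "A \<in> flats M"
  hence "{H \<in> flats M. A \<subseteq> H \<and> H \<subseteq> A} = {A}" by auto
  thus ?thesis by (simp add: chi_def monom_0 one_pCons)
qed

lemma rchi_refl: "A \<in> flats M \<Longrightarrow> rchi M A A = 1"
proof -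
  assume "A \<in> flats M"
  hence "{H \<in> flats M. A \<subseteq> H \<and> H \<subseteq> A} = {A}" by auto
  thus ?thesis by (simp add: rchi_def monom_0 one_pCons)
qed

lemma charpoly_localization:
  assumes M: "matroid M" and B: "B \<in> flats M"
  shows "charpoly (localization M B) = chi M (loops M) B"
proof -
  let ?N = "localization M B"
  have N: "matroid ?N" by (rule matroid_localization[OF M flat_subset[OF B]])
  have L: "loops M \<subseteq> B" by (rule loops_subset_flat[OF M B])
  have "loops ?N = loops M" using L flat_subset[OF B] by (auto simp: loops_def rk_localization)
  hence inter: "\<Inter>(flats ?N) = loops M" using Inter_flats[OF N] by simp
  have fl: "flats ?N = {G \<in> flats M. G \<subseteq> B}" by (rule flats_localization[OF M B])
  show ?thesis
    unfolding charpoly_def chi_def inter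
  proof (rule sum.cong)
    show "flats ?N = {H \<in> flats M. loops M \<subseteq> H \<and> H \<subseteq> B}"
      unfolding fl using loops_subset_flat[OF M] by blast
    fix H assume "H \<in> {H \<in> flats M. loops M \<subseteq> H \<and> H \<subseteq> B}"
    thus "monom (moebius (flats ?N) (loops M) H) (rank ?N - rk ?N H)
        = monom (moebius (flats M) (loops M) H) (rk M B - rk M H)"
      unfolding fl using moebius_restrict[OF finite_flats[OF M], of "loops M" H B]
      by (simp add: rk_localization)
  qed
qed

lemma chi_contraction:
  assumes M: "matroid M" and F: "F \<in> flats M" "F \<subseteq> A" "A \<subseteq> B" "B \<subseteq> ground M"
  shows "chi (contraction M F) (A - F) (B - F) = chi M A B"
proof -
  let ?N = "contraction M F"
  have Fs: "F \<subseteq> ground M" using flat_subset[OF F(1)] .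
  have rk: "rk ?N (H - F) = rk M H - rk M F" if "F \<subseteq> H" "H \<subseteq> ground M" for H
  proof -
    have "H - F \<union> F = H" "H - F \<subseteq> ground M - F" using that by auto
    thus ?thesis using rk_contraction[OF M Fs, of "H - F"] by simp
  qed
  have set: "{H \<in> flats ?N. A - F \<subseteq> H \<and> H \<subseteq> B - F} = (\<lambda>G. G - F) ` {H \<in> flats M. A \<subseteq> H \<and> H \<subseteq> B}"
  proof (intro equalityI subsetI)
    fix Z assume "Z \<in> {H \<in> flats ?N. A - F \<subseteq> H \<and> H \<subseteq> B - F}"
    then obtain G where G: "G \<in> flats M" "F \<subseteq> G" "Z = G - F" "A - F \<subseteq> G - F" "G - F \<subseteq> B - F"
      unfolding flats_contraction[OF M F(1)] by blast
    hence "A \<subseteq> G" "G \<subseteq> B" using F by blast+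
    thus "Z \<in> (\<lambda>G. G - F) ` {H \<in> flats M. A \<subseteq> H \<and> H \<subseteq> B}" using G by blast
  next
    fix Z assume "Z \<in> (\<lambda>G. G - F) ` {H \<in> flats M. A \<subseteq> H \<and> H \<subseteq> B}"
    then obtain G where "G \<in> flats M" "A \<subseteq> G" "G \<subseteq> B" "Z = G - F" by blast
    thus "Z \<in> {H \<in> flats ?N. A - F \<subseteq> H \<and> H \<subseteq> B - F}"
      unfolding flats_contraction[OF M F(1)] using F by blast
  qed
  have inj: "inj_on (\<lambda>G. G - F) {H \<in> flats M. A \<subseteq> H \<and> H \<subseteq> B}" using F by (intro inj_onI) blast
  show ?thesis
    unfolding chi_def set sum.reindex[OF inj] comp_def
  proof (rule sum.cong[OF refl])
    fix H assume H: "H \<in> {H \<in> flats M. A \<subseteq> H \<and> H \<subseteq> B}"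
    have FH: "F \<subseteq> H" "H \<subseteq> ground M" using H F by blast+
    have "moebius (flats ?N) (A - F) (H - F) = moebius (flats M) A H"
      unfolding flats_contraction[OF M F(1)]
      by (rule moebius_Diff) (use H F finite_flats[OF M] in auto)
    moreover have "rk ?N (B - F) - rk ?N (H - F) = rk M B - rk M H"
      using rk[OF FH] rk[of B] F FH H rk_mono[OF M, of F H] rk_mono[OF M, of H B] by auto
    ultimately show "monom (moebius (flats ?N) (A - F) (H - F)) (rk ?N (B - F) - rk ?N (H - F))
        = monom (moebius (flats M) A H) (rk M B - rk M H)" by simp
  qed
qed

lemma loops_contraction: "\<lbrakk>matroid M; F \<in> flats M\<rbrakk> \<Longrightarrow> loops (contraction M F) = {}"
proof -
  assume M: "matroid M" and F: "F \<in> flats M"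
  have "{} \<in> flats (contraction M F)" unfolding flats_contraction[OF M F] using F by blast
  thus ?thesis using loops_subset_flat[OF matroid_contraction[OF M flat_subset[OF F]]] by blast
qed

lemma charpoly_localization_contraction:
  assumes M: "matroid M" and FG: "F \<in> flats M" "G \<in> flats M" "F \<subseteq> G"
  shows "charpoly (localization (contraction M F) (G - F)) = chi M F G"
proof -
  have "G - F \<in> flats (contraction M F)" unfolding flats_contraction[OF M FG(1)] using FG by blast
  from charpoly_localization[OF matroid_contraction[OF M flat_subset[OF FG(1)]] this]
  have "charpoly (localization (contraction M F) (G - F)) = chi (contraction M F) (F - F) (G - F)"
    by (simp add: loops_contraction[OF M FG(1)])
  also have "\<dots> = chi M F G" by (rule chi_contraction[OF M FG(1)])
    (use FG flat_subset[OF FG(2)] in auto)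
  finally show ?thesis .
qed

text \<open>The recursion of a contraction, read in the flats of \<open>M\<close> above
  \<open>F\<close>. All contractions met in the induction can then be compared within one
  lattice.\<close>

lemma sum_flats_contraction:
  assumes M: "matroid M" and F: "F \<in> flats M"
  shows "(\<Sum>H\<in>flats (contraction M F). charpoly (localization (contraction M F) H)
    * P (contraction (contraction M F) H))
    = (\<Sum>G | G \<in> flats M \<and> F \<subseteq> G. chi M F G * P (contraction M G))"
proof -
  have inj: "inj_on (\<lambda>G. G - F) {G \<in> flats M. F \<subseteq> G}" by (intro inj_onI) blast
  show ?thesis
    unfolding flats_contraction[OF M F] sum.reindex[OF inj] comp_def
  proof (rule sum.cong[OF refl])
    fix G assume "G \<in> {G \<in> flats M. F \<subseteq> G}"
    thus "charpoly (localization (contraction M F) (G - F)) * P (contraction (contraction M F) (G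
      - F))
        = chi M F G * P (contraction M G)"
      using charpoly_localization_contraction[OF M F, of G] contraction_contraction[OF M, of F G]
        flat_subset[of G M] by simp
  qed
qed

section \<open>Existence and uniqueness of Kazhdan--Lusztig polynomials\<close>

text \<open>The restriction to contractions of smaller rank excludes exactly the flat of loops.\<close>

function kl_rec :: "'a set_system \<Rightarrow> int poly" where
  "kl_rec M = (if rank M = 0 then 1 else
     - (\<Sum>k | 2 * k < rank M. monom (coeff (\<Sum>F | F \<in> flats M \<and> rank (contraction M F) < rank M.
        charpoly (localization M F) * kl_rec (contraction M F)) k) k))"
  by auto
termination by (relation "measure (\<lambda>M. rank M)") auto

declare kl_rec.simps [simp del]

text \<open>The omitted term is \<open>P (contraction M (loops M))\<close>. It is the only one whose
  matroid has the same rank as \<open>M\<close>, so it is what the recursion is solved for.\<close>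

definition kl_rest :: "('a set_system \<Rightarrow> int poly) \<Rightarrow> 'a set_system \<Rightarrow> int poly" where
  "kl_rest P M = (\<Sum>F | F \<in> flats M \<and> F \<noteq> loops M. chi M (loops M) F * P (contraction M F))"

lemma kl_sum_eq:
  assumes M: "matroid M"
  shows "(\<Sum>F\<in>flats M. charpoly (localization M F) * P (contraction M F))
    = P (contraction M (loops M)) + kl_rest P M"
proof -
  have "(\<Sum>F\<in>flats M. charpoly (localization M F) * P (contraction M F))
      = (\<Sum>F\<in>flats M. chi M (loops M) F * P (contraction M F))"
    by (rule sum.cong) (auto simp: charpoly_localization[OF M])
  also have "\<dots> = chi M (loops M) (loops M) * P (contraction M (loops M))
      + (\<Sum>F\<in>flats M - {loops M}. chi M (loops M) F * P (contraction M F))"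
    using finite_flats[OF M] loops_flat[OF M] by (rule sum.remove)
  also have "flats M - {loops M} = {F. F \<in> flats M \<and> F \<noteq> loops M}" by auto
  finally show ?thesis by (simp add: chi_refl[OF loops_flat[OF M]] kl_rest_def)
qed

text \<open>Used to identify the polynomial of a matroid with that of its loopless contraction,
  which is a different set system if there are loops.\<close>

lemma kl_rest_contraction_loops:
  assumes M: "matroid M"
  shows "kl_rest P (contraction M (loops M)) = kl_rest P M"
proof -
  let ?N = "contraction M (loops M)"
  note L = loops_flat[OF M]
  have N: "matroid ?N" by (rule matroid_contraction[OF M flat_subset[OF L]])
  have "P (contraction ?N (loops ?N)) + kl_rest P ?N
      = (\<Sum>G | G \<in> flats M \<and> loops M \<subseteq> G. chi M (loops M) G * P (contraction M G))"
    using sum_flats_contraction[OF M L, of P] kl_sum_eq[OF N, of P] by simp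
  also have "\<dots> = (\<Sum>F\<in>flats M. charpoly (localization M F) * P (contraction M F))"
    using loops_subset_flat[OF M] by (intro sum.cong) (auto simp: charpoly_localization[OF M])
  also have "\<dots> = P ?N + kl_rest P M" by (rule kl_sum_eq[OF M])
  also have "contraction ?N (loops ?N) = ?N"
    using contraction_contraction[OF M order_refl flat_subset[OF L]] loops_contraction[OF M L]
      by simp
  finally show ?thesis by simp
qed

text \<open>Below degree r/2 the reversal of \<open>p\<close> has no coefficients, so the difference
  shows -p there.\<close>

lemma low_half_unique:
  fixes p q :: "int poly"
  assumes "2 * degree p < r" "2 * degree q < r" "rev_poly r p - p = rev_poly r q - q"
  shows "p = q"
proof (rule poly_eqI)
  fix k
  show "coeff p k = coeff q k"
  proof (cases "2 * k < r")
    case True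
    have "coeff (rev_poly r p) k = 0" "coeff (rev_poly r q) k = 0"
      using True assms(1,2) by (auto simp: coeff_rev_poly coeff_eq_0)
    moreover have "coeff (rev_poly r p - p) k = coeff (rev_poly r q - q) k" using assms(3) by simp
    ultimately show ?thesis by simp
  next
    case False
    thus ?thesis using assms(1,2) by (simp add: coeff_eq_0)
  qed
qed

text \<open>The condition of \<open>kl_family\<close> at a single matroid, so that it can be assumed
  for contractions in an induction on the rank.\<close>

definition kl_spec :: "('a set_system \<Rightarrow> int poly) \<Rightarrow> 'a set_system \<Rightarrow> bool" where
  "kl_spec P M \<longleftrightarrow> (rank M = 0 \<longrightarrow> P M = 1) \<and> (rank M > 0 \<longrightarrow> 2 * degree (P M) < rank M) \<and>
        rev_poly (rank M) (P M) = (\<Sum>F\<in>flats M. charpoly (localization M F) * P (contraction M F))"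

lemma kl_family_iff: "kl_family P \<longleftrightarrow> (\<forall>M. matroid M \<longrightarrow> kl_spec P M)"
  by (auto simp: kl_family_def kl_spec_def)

text \<open>By assumption the reversal of the term of \<open>F\<close> is \<open>rchi\<close> times
  the whole recursion of the contraction. Collected by the upper flat \<open>G\<close>, the sum of
  \<open>rchi\<close> times \<open>chi\<close> over all \<open>F\<close> would be 0 by
  \<open>rchi_chi\<close>; only \<open>F = loops M\<close> is missing, which leaves minus
  \<open>chi\<close>.\<close>

lemma kl_rest_antisym:
  assumes M: "matroid M" and IH: "\<And>F. \<lbrakk>F \<in> flats M; F \<noteq> loops M\<rbrakk> \<Longrightarrow> kl_spec P (contraction M F)"
  shows "degree (kl_rest P M) \<le> rank M" "rev_poly (rank M) (kl_rest P M) = - kl_rest P M"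
proof -
  let ?L = "{F. F \<in> flats M \<and> F \<noteq> loops M}"
  have fin: "finite ?L" using finite_flats[OF M] by simp
  have deg: "degree (P (contraction M F)) \<le> rank M - rk M F" if "F \<in> ?L" for F
    using IH[of F] that rank_contraction[OF M flat_subset[of F M]]
      by (cases "rank (contraction M F) = 0") (auto simp: kl_spec_def)
  have dchi: "degree (chi M (loops M) F) \<le> rk M F" for F
    using degree_chi[OF M, of "loops M" F] by (simp add: rk_loops[OF M])
  have rle: "rk M F \<le> rank M" if "F \<in> ?L" for F using that flat_subset[of F M]
    by (auto intro: rk_mono[OF M])
  have dterm: "degree (chi M (loops M) F * P (contraction M F)) \<le> rank M" if "F \<in> ?L" for F
    using degree_mult_le[of "chi M (loops M) F"
      "P (contraction M F)"] dchi[of F] deg[OF that] rle[OF that] by linarith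
  show "degree (kl_rest P M) \<le> rank M"
    unfolding kl_rest_def by (rule degree_sum_le[OF fin dterm])
  have "rev_poly (rank M) (kl_rest P M)
    = (\<Sum>F\<in>?L. rev_poly (rank M) (chi M (loops M) F * P (contraction M F)))"
    unfolding kl_rest_def by (rule rev_poly_sum[OF dterm])
  also have "\<dots> = (\<Sum>F\<in>?L. rchi M (loops M) F * (\<Sum>G | G \<in> flats M \<and> F
    \<subseteq> G. chi M F G * P (contraction M G)))"
  proof (rule sum.cong[OF refl])
    fix F assume F: "F \<in> ?L"
    have "rev_poly (rank M) (chi M (loops M) F * P (contraction M F))
        = rev_poly (rk M F + (rank M - rk M F)) (chi M (loops M) F * P (contraction M F))"
      using rle[OF F] by simp
    also have "\<dots> = rev_poly (rk M F) (chi M (loops M) F) * rev_poly (rank M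
      - rk M F) (P (contraction M F))"
      by (rule rev_poly_mult[OF dchi deg[OF F]])
    also have "rev_poly (rk M F) (chi M (loops M) F) = rchi M (loops M) F"
      using rev_chi[OF M, where A = "loops M" and B = F] by (simp add: rk_loops[OF M])
    also have "rev_poly (rank M - rk M F) (P (contraction M F))
        = (\<Sum>G | G \<in> flats M \<and> F \<subseteq> G. chi M F G * P (contraction M G))"
      using IH[of F] F rank_contraction[OF M flat_subset[of F M]] sum_flats_contraction[OF M, of F
        P]
      by (auto simp: kl_spec_def)
    finally show "rev_poly (rank M) (chi M (loops M) F * P (contraction M F))
      = rchi M (loops M) F * (\<Sum>G | G \<in> flats M \<and> F \<subseteq> G. chi M F G * P (contraction M G))" .
  qed
  also have "\<dots> = (\<Sum>(F, G)\<in>(SIGMA F:?L. {G. G \<in> flats M \<and> F \<subseteq> G}).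
      rchi M (loops M) F * chi M F G * P (contraction M G))"
    using finite_flats[OF M] by (simp add: sum_distrib_left mult.assoc sum.Sigma)
  also have "\<dots> = (\<Sum>(G, F)\<in>(SIGMA G:?L. {F \<in> ?L. F \<subseteq> G}).
      rchi M (loops M) F * chi M F G * P (contraction M G))"
    by (rule sum.reindex_bij_witness[of _ "\<lambda>(G, F). (F, G)" "\<lambda>(F, G). (G, F)"])
      (use loops_subset_flat[OF M] in auto)
  also have "\<dots> = (\<Sum>G\<in>?L. (\<Sum>F | F \<in> ?L \<and> F \<subseteq> G. rchi M (loops M) F * chi M F G)
    * P (contraction M G))"
    using finite_flats[OF M] by (simp add: sum_distrib_right sum.Sigma)
  also have "\<dots> = (\<Sum>G\<in>?L. - chi M (loops M) G * P (contraction M G))"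
  proof (rule sum.cong[OF refl])
    fix G assume G: "G \<in> ?L"
    let ?I = "{F. F \<in> flats M \<and> loops M \<subseteq> F \<and> F \<subseteq> G}"
    have "0 = (\<Sum>F\<in>?I. rchi M (loops M) F * chi M F G)"
      using rchi_chi[OF M loops_flat[OF M], of G] G loops_subset_flat[OF M, of G] by auto
    also have "\<dots> = rchi M (loops M) (loops M) * chi M (loops M) G
        + (\<Sum>F\<in>?I - {loops M}. rchi M (loops M) F * chi M F G)"
      by (rule sum.remove) (use finite_flats[OF M] G loops_flat[OF M] loops_subset_flat[OF M, of G]
        in auto)
    also have "?I - {loops M} = {F. F \<in> ?L \<and> F \<subseteq> G}" using loops_subset_flat[OF M] by blast
    finally have "(\<Sum>F | F \<in> ?L \<and> F \<subseteq> G. rchi M (loops M) F * chi M F G) = - chi M (loops M) G"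
      by (simp add: rchi_refl[OF loops_flat[OF M]] eq_neg_iff_add_eq_0 add.commute)
    thus "(\<Sum>F | F \<in> ?L \<and> F \<subseteq> G. rchi M (loops M) F * chi M F G) * P (contraction M G)
        = - chi M (loops M) G * P (contraction M G)" by simp
  qed
  finally show "rev_poly (rank M) (kl_rest P M) = - kl_rest P M" by (simp add: kl_rest_def sum_negf)
qed


lemma rank_contraction_loops: assumes "matroid M" shows "rank (contraction M (loops M)) = rank M"
  using rank_contraction[OF assms flat_subset[OF loops_flat[OF assms]]] rk_loops[OF assms] by simp


lemma kl_rec_unfold:
  assumes M: "matroid M" and r: "rank M > 0"
  shows "kl_rec M = - (\<Sum>k | 2 * k < rank M. monom (coeff (kl_rest kl_rec M) k) k)"
proof -
  have "{F. F \<in> flats M \<and> rank (contraction M F) < rank M} = {F. F \<in> flats M \<and> F \<noteq> loops M}"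
  proof (rule Collect_cong, rule conj_cong[OF refl])
    fix F assume F: "F \<in> flats M"
    thus "rank (contraction M F) < rank M \<longleftrightarrow> F \<noteq> loops M"
      using rank_contraction[OF M flat_subset[OF F]] rk_flat_0_iff[OF M F] r by auto
  qed
  moreover have "(\<Sum>F | F \<in> flats M \<and> F \<noteq> loops M. charpoly (localization M F)
    * kl_rec (contraction M F))
      = kl_rest kl_rec M"
    unfolding kl_rest_def by (rule sum.cong) (auto simp: charpoly_localization[OF M])
  ultimately show ?thesis using r by (subst kl_rec.simps) simp
qed

lemma kl_rest_rank_0:
  assumes M: "matroid M" and r: "rank M = 0" shows "kl_rest P M = 0"
proof -
  have "F = loops M" if F: "F \<in> flats M" for F
    using rk_flat_0_iff[OF M F] rk_mono[OF M flat_subset[OF F]] r by simp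
  thus ?thesis unfolding kl_rest_def by (intro sum.neutral) auto
qed

text \<open>\<open>kl_rec M\<close> is minus the lower half of \<open>kl_rest\<close>. Adding it to
  \<open>kl_rest\<close> leaves the upper half, which by antisymmetry is the reversal of what was
  added.\<close>

lemma kl_rec_spec: "matroid M \<Longrightarrow> kl_spec kl_rec M"
proof (induction "rank M" arbitrary: M rule: less_induct)
  case less
  note M = less.prems
  let ?N = "contraction M (loops M)" and ?R = "kl_rest kl_rec M"
  have N: "matroid ?N" by (rule matroid_contraction[OF M flat_subset[OF loops_flat[OF M]]])
  note rN = rank_contraction_loops[OF M]
  show ?case
  proof (cases "rank M = 0")
    case True
    hence "kl_rec M = 1" "kl_rec ?N = 1" using rN
      by (simp_all add: kl_rec.simps[of M] kl_rec.simps[of ?N])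
    thus ?thesis
      using True by (simp add: kl_spec_def kl_sum_eq[OF M] kl_rest_rank_0[OF M True] rev_poly_def
        monom_0 one_pCons)
  next
    case False
    have IH: "kl_spec kl_rec (contraction M F)" if F: "F \<in> flats M" "F \<noteq> loops M" for F
    proof (rule less.hyps)
      show "rank (contraction M F) < rank M"
        using rank_contraction[OF M flat_subset[OF F(1)]] rk_flat_0_iff[OF M F(1)] F False by auto
      show "matroid (contraction M F)" by (rule matroid_contraction[OF M flat_subset[OF F(1)]])
    qed
    note anti = kl_rest_antisym[OF M IH]
    have K: "kl_rec M = - (\<Sum>k | 2 * k < rank M. monom (coeff ?R k) k)"
      using kl_rec_unfold[OF M] False by simp
    have KN: "kl_rec ?N = kl_rec M"
      using kl_rec_unfold[OF N] K False rN kl_rest_contraction_loops[OF M, of kl_rec] by simp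
    have fin: "finite {k. 2 * k < rank M}" by (rule finite_subset[of _ "{..rank M}"]) auto
    have cK: "coeff (kl_rec M) k = (if 2 * k < rank M then - coeff ?R k else 0)" for k
      unfolding K using fin by (simp add: coeff_sum if_distrib[of uminus] cong: if_cong)
    have deg: "2 * degree (kl_rec M) < rank M"
    proof -
      have "degree (kl_rec M) \<le> (rank M - 1) div 2"
        by (rule degree_le) (auto simp: cK)
      thus ?thesis using False by linarith
    qed
    have "rev_poly (rank M) (kl_rec M) = kl_rec M + ?R"
    proof (rule poly_eqI)
      fix k
      have R: "(if k \<le> rank M then coeff ?R (rank M - k) else 0) = - coeff ?R k"
        using anti(2) coeff_rev_poly[OF anti(1), of k] by simp
      consider "2 * k < rank M" | "2 * k = rank M" | "rank M < 2 * k" "k \<le> rank M" | "rank M < k"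
        by linarith
      thus "coeff (rev_poly (rank M) (kl_rec M)) k = coeff (kl_rec M + ?R) k"
      proof cases
        case 2
        \<comment> \<open>The middle coefficient is its own negative, hence 0.\<close>
        hence "rank M - k = k" "k \<le> rank M" by simp_all
        thus ?thesis using R deg 2 by (simp add: coeff_rev_poly cK)
      qed (use R deg in \<open>auto simp: coeff_rev_poly cK\<close>)
    qed
    thus ?thesis using False deg KN by (simp add: kl_spec_def kl_sum_eq[OF M])
  qed
qed

text \<open>\<open>P M\<close> and the polynomial of the loopless contraction have the same reversal
  by \<open>kl_rest_contraction_loops\<close>, so they agree, and the recursion can be written in
  terms of \<open>P M\<close> alone.\<close>

lemma kl_spec_rev:
  assumes M: "matroid M" "kl_spec P M" "kl_spec P (contraction M (loops M))" and r: "rank M > 0"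
  shows "P (contraction M (loops M)) = P M" "rev_poly (rank M) (P M) - P M = kl_rest P M"
proof -
  let ?N = "contraction M (loops M)"
  note L = loops_flat[OF M(1)]
  have N: "matroid ?N" by (rule matroid_contraction[OF M(1) flat_subset[OF L]])
  note rN = rank_contraction_loops[OF M(1)]
  have NN: "contraction ?N (loops ?N) = ?N"
    using contraction_contraction[OF M(1) order_refl flat_subset[OF L]] loops_contraction[OF M(1) L]
      by simp
  have 1: "rev_poly (rank M) (P M) = P ?N + kl_rest P M"
    using M(2) by (simp add: kl_spec_def kl_sum_eq[OF M(1)])
  have 2: "rev_poly (rank M) (P ?N) = P ?N + kl_rest P M"
    using M(3) NN rN by (simp add: kl_spec_def kl_sum_eq[OF N] kl_rest_contraction_loops[OF M(1)])
  have deg: "degree (P M) \<le> rank M" "degree (P ?N) \<le> rank M"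
    using M(2,3) r rN by (auto simp: kl_spec_def)
  show 3: "P ?N = P M"
  proof (rule poly_eqI)
    fix k
    have "coeff (rev_poly (rank M) (P ?N)) (rank M - k)
      = coeff (rev_poly (rank M) (P M)) (rank M - k)"
      using 1 2 by simp
    thus "coeff (P ?N) k = coeff (P M) k"
      using deg by (cases "k \<le> rank M") (auto simp: coeff_rev_poly coeff_eq_0)
  qed
  show "rev_poly (rank M) (P M) - P M = kl_rest P M" using 1 3 by simp
qed

lemma kl_spec_unique:
  assumes "\<And>M. matroid M \<Longrightarrow> kl_spec P M" "\<And>M. matroid M \<Longrightarrow> kl_spec Q M"
  shows "matroid M \<Longrightarrow> P M = Q M"
proof (induction "rank M" arbitrary: M rule: less_induct)
  case less
  note M = less.prems
  show ?case
  proof (cases "rank M = 0")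
    case True
    thus ?thesis using assms[OF M] by (simp add: kl_spec_def)
  next
    case False
    have N: "matroid (contraction M (loops M))"
      by (rule matroid_contraction[OF M flat_subset[OF loops_flat[OF M]]])
    have "kl_rest P M = kl_rest Q M"
      unfolding kl_rest_def
    proof (intro sum.cong refl arg_cong2[where f = "(*)"])
      fix F assume F: "F \<in> {F \<in> flats M. F \<noteq> loops M}"
      hence Fs: "F \<subseteq> ground M" by (auto simp: flat_subset)
      show "P (contraction M F) = Q (contraction M F)"
      proof (rule less.hyps)
        show "rank (contraction M F) < rank M"
          using rank_contraction[OF M Fs] rk_flat_0_iff[OF M, of F] F False by auto
        show "matroid (contraction M F)" by (rule matroid_contraction[OF M Fs])
      qed
    qed
    moreover have "2 * degree (P M) < rank M" "2 * degree (Q M) < rank M"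
      using assms[OF M] False by (auto simp: kl_spec_def)
    moreover have "rev_poly (rank M) (P M) - P M = kl_rest P M"
      by (rule kl_spec_rev(2)[OF M assms(1)[OF M] assms(1)[OF N]]) (use False in simp)
    moreover have "rev_poly (rank M) (Q M) - Q M = kl_rest Q M"
      by (rule kl_spec_rev(2)[OF M assms(2)[OF M] assms(2)[OF N]]) (use False in simp)
    ultimately show ?thesis by (intro low_half_unique[of "P M" "rank M" "Q M"]) simp_all
  qed
qed

lemma kl_poly_eq_rec: "matroid M \<Longrightarrow> kl_poly M = kl_rec M"
  unfolding kl_poly_def
proof (rule the_equality)
  show "\<exists>P. kl_family P \<and> P M = kl_rec M" using kl_rec_spec by (auto simp: kl_family_iff)
  fix p assume M: "matroid M" and "\<exists>P. kl_family P \<and> P M = p"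
  then obtain P where "kl_family P" "P M = p" by blast
  thus "p = kl_rec M" using kl_spec_unique[of P kl_rec, OF _ kl_rec_spec M]
    by (auto simp: kl_family_iff)
qed

lemma kl_poly_spec: "matroid M \<Longrightarrow> kl_spec kl_poly M"
proof -
  assume M: "matroid M"
  have "(\<Sum>F\<in>flats M. charpoly (localization M F) * kl_poly (contraction M F))
      = (\<Sum>F\<in>flats M. charpoly (localization M F) * kl_rec (contraction M F))"
    by (rule sum.cong) (auto simp: kl_poly_eq_rec matroid_contraction[OF M] flat_subset)
  thus ?thesis using kl_rec_spec[OF M] by (simp add: kl_spec_def kl_poly_eq_rec[OF M])
qed

lemma kl_poly_rank_0: "\<lbrakk>matroid M; rank M = 0\<rbrakk> \<Longrightarrow> kl_poly M = 1"
  using kl_poly_spec[of M] by (simp add: kl_spec_def)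

lemma kl_poly_degree: "\<lbrakk>matroid M; rank M > 0\<rbrakk> \<Longrightarrow> 2 * degree (kl_poly M) < rank M"
  using kl_poly_spec[of M] by (simp add: kl_spec_def)

lemma coeff_kl_poly:
  assumes M: "matroid M" and i: "2 * i < rank M"
  shows "coeff (kl_poly M) i = coeff (kl_rest kl_poly M) (rank M - i)"
proof -
  have N: "matroid (contraction M (loops M))"
    by (rule matroid_contraction[OF M flat_subset[OF loops_flat[OF M]]])
  have deg: "2 * degree (kl_poly M) < rank M" using kl_poly_degree[OF M] i by simp
  have "kl_rest kl_poly M = rev_poly (rank M) (kl_poly M) - kl_poly M"
    using kl_spec_rev(2)[OF M kl_poly_spec[OF M] kl_poly_spec[OF N]] i by simp
  thus ?thesis using deg i by (simp add: coeff_rev_poly coeff_eq_0)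
qed

section \<open>The Kazhdan--Lusztig recursion for the tableau numbers\<close>

definition upoly :: "nat \<Rightarrow> nat \<Rightarrow> int poly" where
  "upoly m d = (\<Sum>k\<le>d. monom (u_coeff m d k) k)"

lemma coeff_upoly [simp]: "coeff (upoly m d) k = u_coeff m d k"
proof -
  have "coeff (upoly m d) k = (if k \<le> d then u_coeff m d k else 0)"
    by (simp add: upoly_def coeff_sum)
  thus ?thesis by (auto simp: u_coeff_zero)
qed

lemma upoly_low: "d \<le> 1 \<Longrightarrow> upoly m d = 1"
proof (rule poly_eqI)
  fix k assume "d \<le> 1"
  thus "coeff (upoly m d) k = coeff 1 k" using u_coeff_zero[of k d m] by (cases k) auto
qed

lemma coeff_linear_pow: "coeff ([:-1, 1:] ^ j) k
  = (if k \<le> j then (-1) ^ (j - k) * int (j choose k) else 0)"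
proof (induction j arbitrary: k)
  case (Suc j)
  have "coeff ([:-1, 1:] ^ Suc j) k = (case k of 0 \<Rightarrow> 0 | Suc k' \<Rightarrow> coeff ([:-1, 1:] ^ j) k')
    - coeff ([:-1, 1:] ^ j :: int poly) k"
    by (simp add: coeff_pCons split: nat.splits)
  thus ?case
  proof (cases k)
    case (Suc k')
    consider "k' < j" | "k' = j" | "k' > j" by linarith
    thus ?thesis
    proof cases
      case 1
      hence "j - k' = Suc (j - Suc k')" by simp
      thus ?thesis using 1 Suc Suc.IH \<open>coeff ([:-1, 1:] ^ Suc j) k = _\<close> by (simp add: algebra_simps)
    qed (use Suc Suc.IH \<open>coeff ([:-1, 1:] ^ Suc j) k = _\<close> in auto)
  qed (simp add: Suc.IH)
qed (auto simp: coeff_1)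

lemma coeff_linear_pow_Suc_mult:
  "coeff ([:-1, 1:] ^ Suc j * p) (Suc N)
    = coeff ([:-1, 1:] ^ j * p) N - coeff ([:-1, 1:] ^ j * p :: int poly) (Suc N)"
  unfolding power_Suc mult.assoc by simp

lemma coeff_linear_pow_mult_upoly:
  "coeff ([:-1, 1:] ^ j * upoly m l) N = (\<Sum>k\<le>N. coeff ([:-1, 1:] ^ j) (N - k) * u_coeff m l k)"
  unfolding coeff_mult by (rule sum.reindex_bij_witness[of _ "\<lambda>k. N - k" "\<lambda>k. N - k"]) auto

text \<open>The Kazhdan--Lusztig recursion of U_{m,d}: a \<open>j\<close>-subset is a flat with
  characteristic polynomial (t-1)^j and contraction U_{m,d-j}, and the first term belongs to the
  ground set. With v = d - j - k - 1 it becomes \<open>u_coeff_recursion\<close> by trinomial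
  revision. The case \<open>2 * i = d\<close> is included since
  \<open>q_coeff_poly_recursion\<close> uses the lemma for \<open>d - 1\<close>.\<close>

lemma u_coeff_poly_recursion:
  assumes "1 \<le> i" "2 * i \<le> d"
  shows "u_coeff m d i = (-1) ^ i * int (m + d choose i)
    + (\<Sum>j=1..d - 1. int (m + d choose j) * coeff ([:-1, 1:] ^ j * upoly m (d - j)) (d - i))"
proof -
  have "(\<Sum>j=1..d - 1. int (m + d choose j) * coeff ([:-1, 1:] ^ j * upoly m (d - j)) (d - i))
      = (\<Sum>j=1..d - 1. \<Sum>k\<le>d - i. int (m + d choose j) * (coeff ([:-1, 1:] ^ j)
        (d - i - k) * u_coeff m (d - j) k))"
    by (simp add: coeff_linear_pow_mult_upoly sum_distrib_left)
  also have "\<dots> = (\<Sum>k\<le>d - i. \<Sum>j=1..d - 1. int (m + d choose j) * (coeff ([:-1, 1:] ^ j) (d - i - k)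
    * u_coeff m (d - j) k))"
    by (rule sum.swap)
  also have "\<dots> = (\<Sum>k\<le>d - i. \<Sum>v\<in>{k..<i}. int (m + d choose (d - i - k)) * ((-1) ^ (i - 1 - v)
    * int (m + i + k choose (i - 1 - v)) * u_coeff m (v + k + 1) k))"
  proof (rule sum.cong[OF refl])
    fix k assume k: "k \<in> {..d - i}"
    let ?t = "\<lambda>j. int (m + d choose j) * (coeff ([:-1, 1:] ^ j) (d - i - k) * u_coeff m (d - j) k)"
    \<comment> \<open>If \<open>d - j\<close> is too large, (t-1)^j has too small a degree; if it is
      at most 2k, the degree bound makes \<open>u_coeff\<close> vanish.\<close>
    have zero: "?t j = 0" if j: "1 \<le> j" "j \<le> d - 1" "\<not> (2 * k + 1 \<le> d - j \<and> d - j \<le> i + k)" for j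
    proof (cases "d - i - k \<le> j")
      case True
      hence "d - j \<le> 2 * k" "1 \<le> k" using j k by auto
      thus ?thesis by (simp add: u_coeff_zero)
    qed (simp add: coeff_linear_pow)
    have "(\<Sum>j=1..d - 1. ?t j) = (\<Sum>j | 1 \<le> j \<and> j \<le> d - 1 \<and> 2 * k + 1 \<le> d - j \<and> d - j \<le> i + k. ?t j)"
      by (rule sum.mono_neutral_right) (use zero in auto)
    also have "\<dots> = (\<Sum>v\<in>{k..<i}. ?t (d - (v + k + 1)))"
      by (rule sum.reindex_bij_witness[of _ "\<lambda>v. d - (v + k + 1)" "\<lambda>j. d - j - k - 1"])
        (use assms in auto)
    also have "\<dots> = (\<Sum>v\<in>{k..<i}. int (m + d choose (d - i - k)) * ((-1) ^ (i - 1 - v) * int (m + i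
      + k choose (i - 1 - v)) * u_coeff m (v + k + 1) k))"
    proof (rule sum.cong[OF refl])
      fix v assume "v \<in> {k..<i}"
      hence v: "k \<le> v" "v \<le> i - 1" "k < i" by auto
      let ?j = "d - (v + k + 1)"
      have e: "d - ?j = v + k + 1" "d - i - k \<le> ?j" "?j - (d - i - k) = i - 1 - v" "?j \<le> m + d"
        "m + d - (d - i - k) = m + i + k"
        using v assms by auto
      have "(m + d choose ?j) * (?j choose (d - i - k))
        = (m + d choose (d - i - k)) * (m + i + k choose (i - 1 - v))"
        using choose_mult[OF e(2,4)] e by simp
      hence "int (m + d choose ?j) * int (?j choose (d - i - k))
        = int (m + d choose (d - i - k)) * int (m + i + k choose (i - 1 - v))"
        by (metis of_nat_mult)
      thus "?t ?j = int (m + d choose (d - i - k)) * ((-1) ^ (i - 1 - v) * int (m + i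
        + k choose (i - 1 - v)) * u_coeff m (v + k + 1) k)"
        unfolding e(1) coeff_linear_pow e(3) using e(2) by (simp add: mult_ac)
    qed
    finally show "(\<Sum>j=1..d - 1. ?t j) = \<dots>" .
  qed
  also have "\<dots> = (\<Sum>k<i. \<Sum>v=k..i - 1. int (m + d choose (d - i - k)) * ((-1) ^ (i - 1 - v) * int (m
    + i + k choose (i - 1 - v)) * u_coeff m (v + k + 1) k))"
  proof (rule sum.mono_neutral_cong_right)
    show "sum f {k..<i} = sum f {k..i - 1}" if "k \<in> {..<i}" for k and f :: "nat \<Rightarrow> int"
      using that by (intro sum.cong) auto
  qed (use assms in auto)
  finally show ?thesis using u_coeff_recursion[OF assms, of m] by (simp add: sum_distrib_left)
qed

definition qpoly :: "nat \<Rightarrow> int poly" where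
  "qpoly d = upoly 1 d - upoly 1 (d - 1)"

lemma coeff_qpoly [simp]: "coeff (qpoly d) i = q_coeff d i"
  by (simp add: qpoly_def q_coeff_def)

text \<open>The terms are the effect of one circuit-hyperplane: contractions of its subsets, its d
  subsets of size d - 1 that cease to be flats, and the set itself. In the difference of the two
  recursions, binomial(d+1, j) is split by Pascal's rule, and one factor t - 1 of the shifted part
  is expanded. The part with t cancels against the recursion of U_{1,d-1}; the other one completes
  U_{1,d-j} to Q_{d-j}.\<close>

lemma q_coeff_poly_recursion:
  assumes "1 \<le> i" "2 * i < d"
  shows "q_coeff d i = (\<Sum>j=1..d - 1. int (d choose j) * coeff ([:-1, 1:] ^ j * qpoly (d - j)) (d
    - i))
    + int d * coeff ([:-1, 1:] ^ (d - 1)) (d - i) - (-1) ^ (i - 1) * int (d choose (i - 1))"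
proof -
  define c where "c j l N = coeff ([:-1, 1:] ^ j * upoly 1 l) N" for j l N
  obtain N where N: "d - i = Suc N" using assms by (cases "d - i") auto
  obtain e where e: "d = Suc (Suc e)" using assms by (cases d; cases "d - 1") auto
  have de: "d - 1 = Suc e" using e by simp
  have N': "d - 1 - i = N" using N by simp
  have A: "u_coeff 1 d i = (-1) ^ i * int (Suc d choose i) + (\<Sum>j=1..Suc e. int (Suc d choose j)
    * c j (d - j) (Suc N))"
    by (rule u_coeff_poly_recursion[of i d 1, unfolded N de c_def[symmetric] plus_1_eq_Suc])
      (use assms in auto)
  have B: "u_coeff 1 (d - 1) i = (-1) ^ i * int (d choose i) + (\<Sum>j=1..e. int (d choose j) * c j (d
    - 1 - j) N)"
  proof -
    have "1 + (d - 1) = d" "d - 1 - 1 = e" using e by auto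
    thus ?thesis using u_coeff_poly_recursion[of i "d - 1" 1] assms unfolding c_def N' by simp
  qed
  have sgn: "(-1) ^ i * int (Suc d choose i) - (-1) ^ i * int (d choose i)
    = - ((-1) ^ (i - 1) * int (d choose (i - 1)))"
    using assms by (cases i) (auto simp: algebra_simps)
  have "(\<Sum>j=1..Suc e. int (Suc d choose j) * c j (d - j) (Suc N))
      = (\<Sum>j=1..Suc e. int (d choose j) * c j (d - j) (Suc N)) + (\<Sum>j=1..Suc e. int (d choose
        (j - 1)) * c j (d - j) (Suc N))"
    unfolding sum.distrib[symmetric]
  proof (rule sum.cong[OF refl])
    fix j assume "j \<in> {1..Suc e}"
    then obtain j' where "j = Suc j'" by (cases j) auto
    thus "int (Suc d choose j) * c j (d - j) (Suc N)
      = int (d choose j) * c j (d - j) (Suc N) + int (d choose (j - 1)) * c j (d - j) (Suc N)"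
      by (simp add: algebra_simps)
  qed
  also have "(\<Sum>j=1..Suc e. int (d choose (j - 1)) * c j (d - j) (Suc N))
    = (\<Sum>j=0..e. int (d choose j) * c (Suc j) (d - 1 - j) (Suc N))"
    by (rule sum.reindex_bij_witness[of _ Suc "\<lambda>j. j - 1"]) auto
  also have "\<dots> = (\<Sum>j=0..e. int (d choose j) * c j (d - 1 - j) N) - (\<Sum>j=0..e. int (d choose j)
    * c j (d - 1 - j) (Suc N))"
    unfolding sum_subtractf[symmetric]
    by (rule sum.cong) (simp_all only: c_def coeff_linear_pow_Suc_mult right_diff_distrib)
  also have "(\<Sum>j=0..e. int (d choose j) * c j (d - 1 - j) N)
    = (\<Sum>j=1..e. int (d choose j) * c j (d - 1 - j) N)"
  proof -
    \<comment> \<open>The shifted sum starts at j = 0, where U_{1,d-1} is read in a degree of at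
      least (d-1)/2.\<close>
    have "c 0 (d - 1) N = 0" using assms N e by (simp add: c_def u_coeff_zero)
    thus ?thesis by (simp add: sum.atLeast_Suc_atMost)
  qed
  also have "(\<Sum>j=0..e. int (d choose j) * c j (d - 1 - j) (Suc N))
    = (\<Sum>j=1..e. int (d choose j) * c j (d - 1 - j) (Suc N))"
  proof -
    have "c 0 (d - 1) (Suc N) = 0" using assms N e by (simp add: c_def u_coeff_zero)
    thus ?thesis by (simp add: sum.atLeast_Suc_atMost)
  qed
  \<comment> \<open>The shifted sum ends one index early; restoring j = d - 1 produces the term d
    (t-1)^(d-1).\<close>
  also have "(\<Sum>j=1..e. int (d choose j) * c j (d - 1 - j) (Suc N))
      = (\<Sum>j=1..Suc e. int (d choose j) * c j (d - 1 - j) (Suc N)) - int d * c (Suc e) 0 (Suc N)"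
    by (simp add: e)
  finally have C: "(\<Sum>j=1..Suc e. int (Suc d choose j) * c j (d - j) (Suc N))
    - (\<Sum>j=1..e. int (d choose j) * c j (d - 1 - j) N)
      = (\<Sum>j=1..Suc e. int (d choose j) * c j (d - j) (Suc N)) - (\<Sum>j=1..Suc e. int (d choose j) * c j
        (d - 1 - j) (Suc N))
        + int d * c (Suc e) 0 (Suc N)" by simp
  have D: "(\<Sum>j=1..Suc e. int (d choose j) * coeff ([:-1, 1:] ^ j * qpoly (d - j)) (Suc N))
      = (\<Sum>j=1..Suc e. int (d choose j) * c j (d - j) (Suc N)) - (\<Sum>j=1..Suc e. int (d choose j) * c j
        (d - 1 - j) (Suc N))"
    unfolding sum_subtractf[symmetric]
      by (rule sum.cong) (simp_all add: c_def qpoly_def right_diff_distrib)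
  have E: "c (Suc e) 0 (Suc N) = coeff ([:-1, 1:] ^ (d - 1)) (d - i)"
    unfolding c_def de N by (simp add: upoly_low del: power_Suc)
  show ?thesis
  proof -
    have gen: "a + s - (b + t) = w + x - y" if "s - t = p - q + x" "w = p - q" "a - b = - y"
      for a b p q s t w x y :: int using that by simp
    show ?thesis unfolding q_coeff_def A B E[symmetric] using gen[OF C D sgn] unfolding N de .
  qed
qed

section \<open>Sparse paving matroids\<close>

text \<open>Polymorphic and with any ground set, since the induction passes to contractions.\<close>

definition is_sparse_paving :: "nat \<Rightarrow> 'a set set \<Rightarrow> 'a set_system \<Rightarrow> bool" where
  "is_sparse_paving d CH M \<longleftrightarrow> matroid M \<and> rank M = d \<and>
     CH = {C. C \<subseteq> ground M \<and> card C = d} - bases M \<and>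
     (\<forall>C\<in>CH. \<forall>C'\<in>CH. C \<noteq> C' \<longrightarrow> card (sym_diff C C') \<ge> 4)"

text \<open>In degree \<open>rank M\<close> only the ground set contributes, with its monic
  characteristic polynomial; by the degree bounds all other terms are too short.\<close>

lemma coeff_kl_poly_0:
  assumes M: "matroid M" shows "coeff (kl_poly M) 0 = 1"
proof (cases "rank M = 0")
  case True
  thus ?thesis using kl_poly_rank_0[OF M] by simp
next
  case False
  let ?L = "{F. F \<in> flats M \<and> F \<noteq> loops M}" and ?E = "ground M"
  have fin: "finite ?L" using finite_flats[OF M] by simp
  have E: "?E \<in> ?L" using ground_flat[of M] rk_loops[OF M] False by auto
  have zero: "coeff (chi M (loops M) F * kl_poly (contraction M F)) (rank M) = 0"
    if F: "F \<in> ?L - {?E}" for F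
  proof -
    have Fs: "F \<subset> ?E" using F flat_subset[of F M] by auto
    have lt: "rk M F < rank M" using rk_less_flat[OF M _ Fs order_refl] F by blast
    have N: "matroid (contraction M F)" using matroid_contraction[OF M] Fs by blast
    have r: "rank (contraction M F) = rank M - rk M F" using rank_contraction[OF M] Fs by blast
    have "2 * degree (kl_poly (contraction M F)) < rank M - rk M F" using kl_poly_degree[OF N] r lt
      by simp
    moreover have "degree (chi M (loops M) F) \<le> rk M F"
      using degree_chi[OF M, of "loops M" F] by simp
    ultimately have "degree (chi M (loops M) F * kl_poly (contraction M F)) < rank M"
      using degree_mult_le[of "chi M (loops M) F" "kl_poly (contraction M F)"] by linarith
    thus ?thesis by (rule coeff_eq_0)
  qed
  have NE: "kl_poly (contraction M ?E) = 1"
    using kl_poly_rank_0[OF matroid_contraction[OF M order_refl]] rank_contraction[OF M order_refl]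
      by simp
  have "coeff (kl_poly M) 0 = coeff (kl_rest kl_poly M) (rank M)"
    using coeff_kl_poly[OF M, of 0] False by simp
  also have "\<dots> = coeff (chi M (loops M) ?E * kl_poly (contraction M ?E)) (rank M)"
  proof -
    have "(\<Sum>F\<in>?L - {?E}. coeff (chi M (loops M) F * kl_poly (contraction M F)) (rank M)) = 0"
      by (rule sum.neutral) (use zero in blast)
    thus ?thesis unfolding kl_rest_def sum.remove[OF fin E] coeff_add coeff_sum by simp
  qed
  also have "\<dots> = (\<Sum>H | H \<in> flats M \<and> loops M \<subseteq> H \<and> H \<subseteq> ?E. if rank M - rk M H
    = rank M then moebius (flats M) (loops M) H else 0)"
    by (simp add: NE chi_def coeff_sum)
  also have "\<dots> = (\<Sum>H | H \<in> flats M \<and> loops M \<subseteq> H \<and> H \<subseteq> ?E. if H = loops M then 1 else 0)"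
  proof (rule sum.cong[OF refl])
    fix H assume "H \<in> {H \<in> flats M. loops M \<subseteq> H \<and> H \<subseteq> ?E}"
    hence H: "H \<in> flats M" by simp
    have "rank M - rk M H = rank M \<longleftrightarrow> H = loops M"
      using rk_flat_0_iff[OF M H] rk_mono[OF M flat_subset[OF H]] False by auto
    thus "(if rank M - rk M H = rank M then moebius (flats M) (loops M) H else 0)
      = (if H = loops M then 1 else 0)"
      by simp
  qed
  also have "\<dots> = 1" using finite_flats[OF M] loops_flat[OF M] flat_subset[OF loops_flat[OF M]]
    by simp
  finally show ?thesis .
qed

lemma kl_poly_rank_1: "\<lbrakk>matroid M; rank M = 1\<rbrakk> \<Longrightarrow> kl_poly M = 1"
proof (rule poly_eqI)
  fix k assume M: "matroid M" and r: "rank M = 1"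
  have "degree (kl_poly M) = 0" using kl_poly_degree[OF M] r by simp
  thus "coeff (kl_poly M) k = coeff 1 k" using coeff_kl_poly_0[OF M]
    by (cases k) (auto simp: coeff_eq_0)
qed

lemma sum_Pow_alternating: "\<lbrakk>finite A; A \<noteq> {}\<rbrakk> \<Longrightarrow> (\<Sum>Z\<in>Pow A. (-1) ^ card Z) = (0 :: int)"
proof (induction A rule: finite_induct)
  case (insert x A)
  have inj: "inj_on (insert x) (Pow A)" using insert.hyps
    by (intro inj_onI) (auto simp: insert_ident)
  have "(\<Sum>Z\<in>Pow (insert x A). (-1) ^ card Z)
    = (\<Sum>Z\<in>Pow A. (-1) ^ card Z) + (\<Sum>Z\<in>insert x ` Pow A. (-1 :: int) ^ card Z)"
    unfolding Pow_insert using insert.hyps by (intro sum.union_disjoint) auto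
  also have "(\<Sum>Z\<in>insert x ` Pow A. (-1 :: int) ^ card Z) = (\<Sum>Z\<in>Pow A. - ((-1) ^ card Z))"
    unfolding sum.reindex[OF inj] comp_def
  proof (rule sum.cong[OF refl])
    fix Z assume "Z \<in> Pow A"
    hence "finite Z" "x \<notin> Z" using insert.hyps finite_subset by auto
    thus "(-1 :: int) ^ card (insert x Z) = - ((-1) ^ card Z)" by simp
  qed
  finally show ?case by (simp add: sum_negf)
qed simp

section \<open>Rank, flats and contractions of sparse paving matroids\<close>

context
  fixes d :: nat and CH :: "'a set set" and M :: "'a set_system"
  assumes sp: "is_sparse_paving d CH M"
begin

lemma sp_separated: "\<lbrakk>C \<in> CH; C' \<in> CH; C \<noteq> C'\<rbrakk> \<Longrightarrow> card (sym_diff C C') \<ge> 4"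
  by (rule sp[unfolded is_sparse_paving_def, THEN conjunct2, THEN conjunct2, THEN conjunct2,
        THEN bspec, THEN bspec, THEN mp])

lemma sp_matroid: "matroid M" and sp_rank: "rank M = d"
  using sp by (auto simp: is_sparse_paving_def)

lemma sp_finite: "finite (ground M)"
  using matroid_finite[OF sp_matroid] .

lemma sp_CH: "C \<in> CH \<longleftrightarrow> C \<subseteq> ground M \<and> card C = d \<and> C \<notin> indep M"
  using sp unfolding is_sparse_paving_def by (auto simp: bases_def basis_of_iff[OF sp_matroid])

lemma sp_CH_finite: "finite CH"
  by (rule finite_subset[of _ "Pow (ground M)"]) (auto simp: sp_CH sp_finite)

lemma sp_d_le: "d \<le> card (ground M)"
  using rk_le_card[OF sp_matroid sp_finite] sp_rank by simp

lemma sp_insert_eq: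
  assumes "insert x A \<in> CH" "insert y A \<in> CH" "x \<notin> A" "y \<notin> A" shows "x = y"
proof (rule ccontr)
  assume "x \<noteq> y"
  hence "sym_diff (insert x A) (insert y A) = {x, y}" using assms by auto
  hence "card (sym_diff (insert x A) (insert y A)) = 2" using \<open>x \<noteq> y\<close> by simp
  moreover have "insert x A \<noteq> insert y A" using assms \<open>x \<noteq> y\<close> by auto
  ultimately have "4 \<le> card (sym_diff (insert x A) (insert y A))"
    by (intro sp_separated assms(1,2))
  thus False using \<open>card (sym_diff (insert x A) (insert y A)) = 2\<close> by simp
qed

text \<open>If the ground set has more than \<open>d\<close> elements, then \<open>A\<close> has two
  one-element extensions, and at most one of them is in \<open>CH\<close>. Otherwise the ground set
  itself is a basis.\<close>

lemma sp_indep_pred: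
  assumes d: "1 \<le> d" and A: "A \<subseteq> ground M" "card A = d - 1" shows "A \<in> indep M"
proof (cases "card (ground M) = d")
  case True
  hence "ground M \<in> indep M" using indep_if_rk[OF sp_matroid sp_finite] sp_rank by simp
  thus ?thesis using indep_mono[OF sp_matroid] A by blast
next
  case False
  hence "card (ground M) \<ge> d + 1" using sp_d_le by simp
  moreover have fA: "finite A" using A sp_finite finite_subset by blast
  ultimately have "card (ground M - A) \<ge> 2" using A d by (simp add: card_Diff_subset)
  then obtain x y where xy: "x \<noteq> y" "x \<in> ground M - A" "y \<in> ground M - A"
    by (auto simp: numeral_2_eq_2 card_le_Suc_iff)
  have "\<not> (insert x A \<in> CH \<and> insert y A \<in> CH)" using sp_insert_eq xy by blast
  moreover have "card (insert x A) = d" "card (insert y A) = d" using xy fA A d by auto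
  ultimately have "insert x A \<in> indep M \<or> insert y A \<in> indep M" using xy A sp_CH by auto
  thus ?thesis using indep_mono[OF sp_matroid] by blast
qed

lemma sp_indep_less:
  assumes A: "A \<subseteq> ground M" "card A < d" shows "A \<in> indep M"
proof -
  have "card A \<le> d - 1" "d - 1 \<le> card (ground M)" using A sp_d_le by auto
  from exists_subset_between[OF this A(1) sp_finite]
  obtain B where "A \<subseteq> B" "B \<subseteq> ground M" "card B = d - 1" by blast
  thus ?thesis using sp_indep_pred[of B] A indep_mono[OF sp_matroid] by auto
qed

lemma sp_rk_less: "\<lbrakk>A \<subseteq> ground M; card A < d\<rbrakk> \<Longrightarrow> rk M A = card A"
  using rk_indep[OF sp_matroid sp_indep_less] .

lemma sp_rk_CH:
  assumes "C \<in> CH" shows "rk M C = d - 1" "1 \<le> d"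
proof -
  have C: "C \<subseteq> ground M" "card C = d" "C \<notin> indep M" using assms sp_CH by auto
  have fC: "finite C" using C sp_finite finite_subset by blast
  have "C \<noteq> {}" using C indep_empty[OF sp_matroid] by auto
  thus d: "1 \<le> d" using C fC by (auto simp: Suc_le_eq card_gt_0_iff)
  obtain x where "x \<in> C" using \<open>C \<noteq> {}\<close> by auto
  hence "rk M (C - {x}) = d - 1" using sp_rk_less[of "C - {x}"] C d fC by auto
  hence "d - 1 \<le> rk M C" using rk_mono[OF sp_matroid, of "C - {x}" C] by auto
  moreover have "rk M C \<noteq> d" using indep_if_rk[OF sp_matroid fC] C by auto
  moreover have "rk M C \<le> d" using rk_le_card[OF sp_matroid fC] C by simp
  ultimately show "rk M C = d - 1" by simp
qed

text \<open>A set with more than \<open>d\<close> elements contains two \<open>d\<close>-sets with a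
  common subset of size \<open>d - 1\<close>; at most one of them is in \<open>CH\<close>, so the
  other one is a basis.\<close>

lemma sp_rk_full:
  assumes A: "A \<subseteq> ground M" "d \<le> card A" "A \<notin> CH" shows "rk M A = d"
proof -
  have le: "rk M A \<le> d" using rk_mono[OF sp_matroid A(1)] sp_rank by simp
  have fA: "finite A" using A sp_finite finite_subset by blast
  show ?thesis
  proof (cases "card A = d")
    case True
    hence "A \<in> indep M" using A sp_CH by blast
    thus ?thesis using rk_indep[OF sp_matroid] True by simp
  next
    case False
    show ?thesis
    proof (cases "d = 0")
      case False
      have "d - 1 \<le> card A" using A by simp
      then obtain B where B: "B \<subseteq> A" "card B = d - 1" by (rule obtain_subset_with_card_n)
      have "card (A - B) \<ge> 2" using B A \<open>card A \<noteq> d\<close> False fA finite_subset[OF B(1)]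
        by (simp add: card_Diff_subset)
      then obtain x y where xy: "x \<noteq> y" "x \<in> A - B" "y \<in> A - B"
        by (auto simp: numeral_2_eq_2 card_le_Suc_iff)
      have "\<not> (insert x B \<in> CH \<and> insert y B \<in> CH)" using sp_insert_eq xy by blast
      moreover have card: "card (insert x B) = d" "card (insert y B) = d"
        using xy finite_subset[OF B(1) fA] B False by auto
      ultimately obtain z where z: "z \<in> {x, y}" "insert z B \<in> indep M" using xy A B sp_CH by auto
      have "card (insert z B) \<le> rk M A"
        by (rule card_le_rk[OF sp_matroid z(2)]) (use z xy B in auto)
      thus ?thesis using le z card by auto
    qed (use le in simp)
  qed
qed

lemma sp_flats:
  assumes d: "2 \<le> d"
  shows "flats M = {F. F \<subseteq> ground M \<and> card F \<le> d - 2}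
    \<union> {F. F \<subseteq> ground M \<and> card F = d - 1 \<and> (\<forall>C\<in>CH. \<not> F \<subseteq> C)} \<union> CH \<union> {ground M}"
proof (intro equalityI subsetI)
  fix F assume F: "F \<in> flats M"
  hence FE: "F \<subseteq> ground M" by (rule flat_subset)
  have fF: "finite F" using FE sp_finite finite_subset by blast
  consider "card F \<le> d - 2" | "card F = d - 1" | "d \<le> card F" "F \<in> CH" | "d \<le> card F" "F \<notin> CH"
    by linarith
  thus "F \<in> {F. F \<subseteq> ground M \<and> card F \<le> d - 2}
    \<union> {F. F \<subseteq> ground M \<and> card F = d - 1 \<and> (\<forall>C\<in>CH. \<not> F \<subseteq> C)} \<union> CH \<union> {ground M}"
  proof cases
    case 2
    have False if C: "C \<in> CH" "F \<subseteq> C" for C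
    proof -
      have "card C = d" "C \<subseteq> ground M" using C sp_CH by blast+
      moreover have "\<not> C \<subseteq> F"
      proof
        assume "C \<subseteq> F"
        thus False using card_mono[OF fF, of C] 2 d \<open>card C = d\<close> by simp
      qed
      ultimately obtain x where x: "x \<in> C - F" by blast
      have "rk M F < rk M (insert x F)" using F x \<open>C \<subseteq> ground M\<close> by (auto simp: flat_iff)
      also have "\<dots> \<le> rk M C" using x C by (intro rk_mono[OF sp_matroid]) auto
      finally show False using sp_rk_CH[OF C(1)] sp_rk_less[OF FE] 2 d by simp
    qed
    thus ?thesis using FE 2 by blast
  next
    case 4
    have "F = ground M"
    proof (rule ccontr)
      assume "F \<noteq> ground M"
      hence "rk M F < rank M" using rk_less_flat[OF sp_matroid F _ order_refl] FE by blast
      thus False using sp_rk_full[OF FE 4] sp_rank by simp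
    qed
    thus ?thesis by simp
  qed (use FE in auto)
next
  fix F assume F: "F \<in> {F. F \<subseteq> ground M \<and> card F \<le> d - 2}
    \<union> {F. F \<subseteq> ground M \<and> card F = d - 1 \<and> (\<forall>C\<in>CH. \<not> F \<subseteq> C)} \<union> CH \<union> {ground M}"
  hence FE: "F \<subseteq> ground M" using sp_CH by auto
  have fF: "finite F" using FE sp_finite finite_subset by blast
  have "rk M F < rk M (insert x F)" if x: "x \<in> ground M - F" for x
  proof -
    have xF: "insert x F \<subseteq> ground M" "card (insert x F) = Suc (card F)" using x FE fF by auto
    consider "card F \<le> d - 2" | "card F = d - 1" "\<forall>C\<in>CH. \<not> F \<subseteq> C" | "F \<in> CH" using F x by auto
    thus ?thesis
    proof cases
      case 1
      thus ?thesis using sp_rk_less[OF FE] sp_rk_less[OF xF(1)] xF d by simp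
    next
      case 2
      have "insert x F \<notin> CH" using 2 by blast
      thus ?thesis using sp_rk_less[OF FE] sp_rk_full[OF xF(1)] xF d 2 by auto
    next
      case 3
      have "insert x F \<notin> CH" using 3 sp_CH xF by auto
      thus ?thesis using sp_rk_CH[OF 3] sp_rk_full[OF xF(1)] xF 3 sp_CH by auto
    qed
  qed
  thus "F \<in> flats M" using FE by (auto simp: flat_iff)
qed

lemma sp_loops: "2 \<le> d \<Longrightarrow> loops M = {}"
proof -
  assume "2 \<le> d"
  hence "rk M {x} = 1" if "x \<in> ground M" for x using sp_rk_less[of "{x}"] that by simp
  thus ?thesis by (auto simp: loops_def)
qed

text \<open>\<open>F\<close> is independent by its size, hence its own basis. Removing the common
  part \<open>F\<close> does not change symmetric differences.\<close>

lemma sp_contraction: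
  assumes F: "F \<subseteq> ground M" "card F < d"
  shows "is_sparse_paving (d - card F) ((\<lambda>C. C - F) ` {C \<in> CH. F \<subseteq> C}) (contraction M F)"
  unfolding is_sparse_paving_def
proof (intro conjI)
  let ?N = "contraction M F" and ?CH = "(\<lambda>C. C - F) ` {C \<in> CH. F \<subseteq> C}"
  show N: "matroid ?N" by (rule matroid_contraction[OF sp_matroid F(1)])
  have rF: "rk M F = card F" by (rule sp_rk_less[OF F])
  show r: "rank ?N = d - card F" using rank_contraction[OF sp_matroid F(1)] rF sp_rank by simp
  have fF: "finite F" using F sp_finite finite_subset by blast
  have bF: "basis_of M F F" using sp_indep_less[OF F] by (auto simp: basis_of_def)
  note ind = indep_contraction_basis[OF sp_matroid F(1) bF]
  show "?CH = {C. C \<subseteq> ground ?N \<and> card C = d - card F} - bases ?N"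
  proof (intro equalityI subsetI)
    fix D assume "D \<in> ?CH"
    then obtain C where C: "C \<in> CH" "F \<subseteq> C" "D = C - F" by blast
    hence "D \<union> F = C" by auto
    hence "D \<notin> indep ?N" using ind C sp_CH by auto
    moreover have "card D = d - card F" using C fF sp_CH by (auto simp: card_Diff_subset)
    ultimately show "D \<in> {C. C \<subseteq> ground ?N \<and> card C = d - card F} - bases ?N"
      using C sp_CH by (auto simp: bases_def basis_of_def)
  next
    fix D assume D: "D \<in> {C. C \<subseteq> ground ?N \<and> card C = d - card F} - bases ?N"
    hence "D \<notin> indep ?N" using r by (auto simp: bases_def basis_of_iff[OF N])
    hence "D \<union> F \<notin> indep M" using ind D by auto
    moreover have "finite D" using D sp_finite finite_subset[of D "ground M - F"] by auto
    hence "card (D \<union> F) = d" using D F fF by (subst card_Un_disjoint) auto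
    ultimately have "D \<union> F \<in> CH" using D F sp_CH by auto
    moreover have "D = (D \<union> F) - F" using D by auto
    ultimately show "D \<in> ?CH" by blast
  qed
  show "\<forall>C\<in>?CH. \<forall>C'\<in>?CH. C \<noteq> C' \<longrightarrow> 4 \<le> card (sym_diff C C')"
  proof (intro ballI impI)
    fix D D' assume "D \<in> ?CH" "D' \<in> ?CH" "D \<noteq> D'"
    then obtain C C' where C: "C \<in> CH" "C' \<in> CH" "F \<subseteq> C" "F \<subseteq> C'" "D = C - F" "D' = C' - F" "C \<noteq> C'"
      by blast
    hence "sym_diff D D' = sym_diff C C'" by auto
    thus "4 \<le> card (sym_diff D D')" using sp_separated[OF C(1,2,7)] by simp
  qed
qed

lemma sp_card_CH_contraction:
  "card ((\<lambda>C. C - F) ` {C \<in> CH. F \<subseteq> C}) = card {C \<in> CH. F \<subseteq> C}"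
  by (rule card_image) (auto simp: inj_on_def)

lemma sp_moebius:
  assumes "2 \<le> d" "H \<subseteq> ground M" "card H \<le> d - 2"
  shows "moebius (flats M) {} H = (-1) ^ card H"
  using assms(2,3)
proof (induction "card H" arbitrary: H rule: less_induct)
  case less
  have fH: "finite H" using less.prems sp_finite finite_subset by blast
  show ?case
  proof (cases "H = {}")
    case False
    have "moebius (flats M) {} H = - (\<Sum>Z | Z \<in> flats M \<and> {} \<subseteq> Z \<and> Z \<subset> H. moebius (flats M) {} Z)"
      using False finite_flats[OF sp_matroid] by (intro moebius_less) auto
    also have "(\<Sum>Z | Z \<in> flats M \<and> {} \<subseteq> Z \<and> Z \<subset> H. moebius (flats M) {} Z)
      = (\<Sum>Z\<in>Pow H - {H}. (-1) ^ card Z)"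
    proof (rule sum.cong)
      have "Z \<in> flats M" if "Z \<subset> H" for Z
        using that less.prems card_mono[OF fH, of Z] unfolding sp_flats[OF assms(1)] by auto
      thus "{Z \<in> flats M. {} \<subseteq> Z \<and> Z \<subset> H} = Pow H - {H}" by auto
      fix Z assume "Z \<in> Pow H - {H}"
      hence "Z \<subset> H" by auto
      thus "moebius (flats M) {} Z = (-1) ^ card Z"
        using less.hyps[of Z] less.prems psubset_card_mono[OF fH, of Z] by auto
    qed
    also have "\<dots> = - ((-1) ^ card H)"
      using sum_Pow_alternating[OF fH False] fH by (simp add: sum_diff1)
    finally show ?thesis by simp
  qed simp
qed

lemma sp_coeff_chi:
  assumes d: "2 \<le> d" and F: "F \<in> flats M" and s: "s \<le> d - 2" "s \<le> rk M F"
  shows "coeff (chi M {} F) (rk M F - s) = (-1) ^ s * int (card F choose s)"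
proof -
  have fF: "finite F" using F flat_subset sp_finite finite_subset by blast
  let ?I = "{H \<in> flats M. {} \<subseteq> H \<and> H \<subseteq> F}"
  have "coeff (chi M {} F) (rk M F - s) = (\<Sum>H\<in>?I. if rk M F - rk M H
    = rk M F - s then moebius (flats M) {} H else 0)"
    by (simp add: chi_def coeff_sum)
  also have "\<dots> = (\<Sum>H | H \<subseteq> F \<and> card H = s. (-1) ^ s)"
  proof (rule sum.mono_neutral_cong_right)
    show "finite ?I" using finite_flats[OF sp_matroid] by simp
    have FE: "F \<subseteq> ground M" by (rule flat_subset[OF F])
    have rkH: "rk M H = s \<longleftrightarrow> card H = s" if "H \<in> ?I" for H
    proof -
      have H: "H \<subseteq> ground M" using that FE by auto
      show ?thesis
      proof (cases "card H < d")
        case False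
        have "d - 1 \<le> rk M H" using sp_rk_full[OF H] sp_rk_CH[of H] False by (cases "H \<in> CH") auto
        thus ?thesis using False s d by auto
      qed (simp add: sp_rk_less[OF H])
    qed
    have le: "rk M H \<le> rk M F" if "H \<in> ?I" for H using that by (auto intro: rk_mono[OF sp_matroid])
    show "{H. H \<subseteq> F \<and> card H = s} \<subseteq> ?I"
      using s FE unfolding sp_flats[OF d] by auto
    show "\<forall>H\<in>?I - {H. H \<subseteq> F \<and> card H = s}. (if rk M F - rk M H
      = rk M F - s then moebius (flats M) {} H else 0) = 0"
    proof
      fix H assume H: "H \<in> ?I - {H. H \<subseteq> F \<and> card H = s}"
      hence "rk M H \<noteq> s" using rkH[of H] by auto
      thus "(if rk M F - rk M H = rk M F - s then moebius (flats M) {} H else 0) = 0"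
        using le[of H] H s by auto
    qed
    fix H assume H: "H \<in> {H. H \<subseteq> F \<and> card H = s}"
    hence "H \<subseteq> ground M" "card H \<le> d - 2" using FE s by auto
    moreover from this have "rk M H = s" using sp_rk_less[of H] H d by auto
    ultimately show "(if rk M F - rk M H = rk M F - s then moebius (flats M) {} H else 0)
      = (-1) ^ s"
      using sp_moebius[OF d, of H] H by simp
  qed
  also have "\<dots> = (-1) ^ s * int (card F choose s)"
    using n_subsets[OF fF, of s] by simp
  finally show ?thesis .
qed

end

section \<open>Counting circuit-hyperplanes and summing over the flats\<close>

context
  fixes d :: nat and CH :: "'a set set" and M :: "'a set_system"
  assumes sp: "is_sparse_paving d CH M"
begin

text \<open>Deleting an element from a circuit-hyperplane is injective on pairs: two preimages of a
  set would differ in at most two elements. The next lemma is the dual count by insertion.\<close>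

lemma sp_card_pred_le: "d * card CH \<le> card (ground M) choose (d - 1)"
proof -
  have fE: "finite (ground M)" by (rule sp_finite[OF sp])
  let ?f = "\<lambda>(C, x). C - {x}"
  have CH: "C \<subseteq> ground M" "card C = d" "finite C" if "C \<in> CH" for C
    using that sp_CH[OF sp] finite_subset[OF _ fE] by auto
  have "inj_on ?f (SIGMA C:CH. C)"
  proof (intro inj_onI, clarify)
    fix C x C' x' assume C: "C \<in> CH" "x \<in> C" "C' \<in> CH" "x' \<in> C'" "C - {x} = C' - {x'}"
    have "C = C'"
    proof (rule ccontr)
      assume "C \<noteq> C'"
      hence "4 \<le> card (sym_diff C C')" using sp_separated[OF sp] C by blast
      moreover have "card (sym_diff C C') \<le> card {x, x'}" using C by (intro card_mono) auto
      moreover have "card {x, x'} \<le> 2" by (simp add: card_insert_if)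
      ultimately show False by simp
    qed
    thus "C = C' \<and> x = x'" using C by auto
  qed
  moreover have "?f ` (SIGMA C:CH. C) \<subseteq> {F. F \<subseteq> ground M \<and> card F = d - 1}"
    using CH by auto
  moreover have "finite {F. F \<subseteq> ground M \<and> card F = d - 1}" using fE by simp
  ultimately have "card (SIGMA C:CH. C) \<le> card {F. F \<subseteq> ground M \<and> card F = d - 1}"
    by (rule card_inj_on_le)
  moreover have "card (SIGMA C:CH. C) = d * card CH"
    using CH sp_CH_finite[OF sp] by (subst card_SigmaI) auto
  ultimately show ?thesis using n_subsets[OF fE, of "d - 1"] by simp
qed

lemma sp_card_succ_le: "(card (ground M) - d) * card CH \<le> card (ground M) choose (d + 1)"
proof -
  have fE: "finite (ground M)" by (rule sp_finite[OF sp])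
  let ?f = "\<lambda>(C, x). insert x C"
  have CH: "C \<subseteq> ground M" "card C = d" "finite C" if "C \<in> CH" for C
    using that sp_CH[OF sp] finite_subset[OF _ fE] by auto
  have "inj_on ?f (SIGMA C:CH. ground M - C)"
  proof (intro inj_onI, clarify)
    fix C x C' x' assume C: "C \<in> CH" "x \<notin> C" "C' \<in> CH" "x' \<notin> C'" "insert x C = insert x' C'"
    have "C = C'"
    proof (rule ccontr)
      assume "C \<noteq> C'"
      hence "4 \<le> card (sym_diff C C')" using sp_separated[OF sp] C by blast
      moreover have "card (sym_diff C C') \<le> card {x, x'}" using C by (intro card_mono) auto
      moreover have "card {x, x'} \<le> 2" by (simp add: card_insert_if)
      ultimately show False by simp
    qed
    thus "C = C' \<and> x = x'" using C by auto
  qed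
  moreover have "?f ` (SIGMA C:CH. ground M - C) \<subseteq> {F. F \<subseteq> ground M \<and> card F = d + 1}"
    using CH by auto
  moreover have "finite {F. F \<subseteq> ground M \<and> card F = d + 1}" using fE by simp
  ultimately have "card (SIGMA C:CH. ground M - C) \<le> card {F. F \<subseteq> ground M \<and> card F = d + 1}"
    by (rule card_inj_on_le)
  moreover have "card (SIGMA C:CH. ground M - C) = (card (ground M) - d) * card CH"
    using CH sp_CH_finite[OF sp] fE by (subst card_SigmaI) (auto simp: card_Diff_subset)
  ultimately show ?thesis using n_subsets[OF fE, of "d + 1"] by simp
qed

text \<open>Expressed through binomial(m+d, d), the bound by deletion gives the factor m + 1 and the
  one by insertion the factor d + 1.\<close>

lemma sp_card_CH_le:
  assumes "1 \<le> d" "1 \<le> m" "card (ground M) = m + d"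
  shows "(max m d + 1) * card CH \<le> m + d choose d"
proof -
  have "d * card CH \<le> m + d choose (d - 1)" using sp_card_pred_le assms by simp
  moreover have "(m + d choose (d - 1)) * (m + 1) = d * (m + d choose d)"
    using binomial_absorb_comp[of "m + d" "d - 1"] assms Suc_times_binomial_eq[of "m + d - 1" "d
      - 1"] by (simp add: algebra_simps)
  ultimately have "d * card CH * (m + 1) \<le> d * (m + d choose d)" using mult_le_mono1 by metis
  hence "d * ((m + 1) * card CH) \<le> d * (m + d choose d)" by (simp only: mult_ac)
  hence A: "(m + 1) * card CH \<le> m + d choose d" using assms by simp
  have "m * card CH \<le> m + d choose (d + 1)" using sp_card_succ_le assms by simp
  moreover have "(m + d choose (d + 1)) * (d + 1) = m * (m + d choose d)"
    using binomial_absorb_comp[of "m + d" d] assms Suc_times_binomial_eq[of "m + d - 1" d]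
      by (simp add: algebra_simps)
  ultimately have "m * card CH * (d + 1) \<le> m * (m + d choose d)" using mult_le_mono1 by metis
  hence "m * ((d + 1) * card CH) \<le> m * (m + d choose d)" by (simp only: mult_ac)
  hence B: "(d + 1) * card CH \<le> m + d choose d" using assms by simp
  show ?thesis using A B by (simp add: max_def)
qed

lemma sp_sum_card_CH:
  "(\<Sum>F | F \<subseteq> ground M \<and> card F = j. card {C \<in> CH. F \<subseteq> C}) = card CH * (d choose j)"
proof -
  have fE: "finite (ground M)" by (rule sp_finite[OF sp])
  note fCH = sp_CH_finite[OF sp]
  have fS: "finite {F. F \<subseteq> ground M \<and> card F = j}" using fE by simp
  have "(\<Sum>F | F \<subseteq> ground M \<and> card F = j. card {C \<in> CH. F \<subseteq> C})
      = (\<Sum>F | F \<subseteq> ground M \<and> card F = j. \<Sum>C\<in>CH. if F \<subseteq> C then 1 else 0)"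
    using fCH by (simp add: sum.If_cases Int_def)
  also have "\<dots> = (\<Sum>C\<in>CH. \<Sum>F | F \<subseteq> ground M \<and> card F = j. if F \<subseteq> C then 1 else 0)"
    by (rule sum.swap)
  also have "\<dots> = (\<Sum>C\<in>CH. d choose j)"
  proof (rule sum.cong[OF refl])
    fix C assume "C \<in> CH"
    hence C: "C \<subseteq> ground M" "card C = d" "finite C" using sp_CH[OF sp] finite_subset[OF _ fE]
      by auto
    have "(\<Sum>F | F \<subseteq> ground M \<and> card F = j. if F \<subseteq> C then 1 else 0) = card {F. F \<subseteq> C \<and> card F = j}"
    proof -
      have "{F. F \<subseteq> ground M \<and> card F = j} \<inter> {F. F \<subseteq> C} = {F. F \<subseteq> C \<and> card F = j}" using C by auto
      thus ?thesis using fS by (simp add: sum.If_cases)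
    qed
    thus "(\<Sum>F | F \<subseteq> ground M \<and> card F = j. if F \<subseteq> C then 1 else 0) = (d choose j)"
      using n_subsets[OF C(3), of j] C by simp
  qed
  finally show ?thesis by simp
qed

text \<open>Every subset of size \<open>d - 1\<close> lies in at most one circuit-hyperplane, and
  every circuit-hyperplane contains \<open>d\<close> of them.\<close>

lemma sp_card_free_hyperplanes:
  assumes "1 \<le> d"
  shows "int (card {F. F \<subseteq> ground M \<and> card F = d - 1 \<and> (\<forall>C\<in>CH. \<not> F \<subseteq> C)})
    = int (card (ground M) choose (d - 1)) - int d * int (card CH)"
proof -
  have fE: "finite (ground M)" by (rule sp_finite[OF sp])
  let ?S = "{F. F \<subseteq> ground M \<and> card F = d - 1}"
  let ?T = "{F. F \<subseteq> ground M \<and> card F = d - 1 \<and> (\<forall>C\<in>CH. \<not> F \<subseteq> C)}"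
  have one: "card {C \<in> CH. F \<subseteq> C} = (if F \<in> ?T then 0 else 1)" if F: "F \<in> ?S" for F
  proof (cases "F \<in> ?T")
    case True
    hence e: "{C \<in> CH. F \<subseteq> C} = {}" by auto
    show ?thesis using True unfolding e by simp
  next
    case False
    then obtain C where C: "C \<in> CH" "F \<subseteq> C" using F by auto
    have "C' = C" if C': "C' \<in> CH" "F \<subseteq> C'" for C'
    proof -
      have ins: "\<exists>x. x \<notin> F \<and> D = insert x F" if D: "D \<in> CH" "F \<subseteq> D" for D
      proof -
        have "card D = d" "finite D" using D sp_CH[OF sp] finite_subset[OF _ fE] by auto
        hence "card (D - F) = 1" using F D assms finite_subset[OF D(2)]
          by (simp add: card_Diff_subset)
        then obtain x where "D - F = {x}" by (auto simp: card_1_singleton_iff)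
        thus ?thesis using D by (intro exI[of _ x]) auto
      qed
      obtain x where x: "x \<notin> F" "C = insert x F" using ins[OF C] by blast
      obtain y where y: "y \<notin> F" "C' = insert y F" using ins[OF C'] by blast
      show ?thesis using sp_insert_eq[OF sp, of x F y] C(1) C'(1) x y by simp
    qed
    hence e: "{C \<in> CH. F \<subseteq> C} = {C}" using C by blast
    show ?thesis using False unfolding e by simp
  qed
  have "card CH * (d choose (d - 1)) = (\<Sum>F\<in>?S. if F \<in> ?T then 0 else 1)"
    unfolding sp_sum_card_CH[symmetric] by (rule sum.cong[OF refl one])
  also have "\<dots> = card (?S - ?T)"
  proof -
    have "finite ?S" using fE by simp
    moreover have "?S \<inter> - {F. F \<in> ?T} = ?S - ?T" by blast
    ultimately show ?thesis by (simp add: sum.If_cases del: mem_Collect_eq)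
  qed
  also have "?T \<subseteq> ?S" by auto
  hence "card (?S - ?T) = card ?S - card ?T" using fE by (intro card_Diff_subset) auto
  finally have "card CH * d = (card (ground M) choose (d - 1)) - card ?T"
    using n_subsets[OF fE, of "d - 1"] assms binomial_symmetric[of "d - 1" d] by simp
  moreover have "card ?T \<le> card (ground M) choose (d - 1)"
    using n_subsets[OF fE, of "d - 1"] card_mono[of ?S ?T] fE by auto
  ultimately have "card CH * d + card ?T = card (ground M) choose (d - 1)" by simp
  hence "int (card CH * d + card ?T) = int (card (ground M) choose (d - 1))" by simp
  thus ?thesis by (simp add: mult.commute)
qed

lemma sp_chi_small:
  assumes d: "2 \<le> d" and F: "F \<subseteq> ground M" "card F \<le> d - 2"
  shows "chi M {} F = [:-1, 1:] ^ card F"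
proof (rule poly_eqI)
  fix k
  have fl: "F \<in> flats M" using F unfolding sp_flats[OF sp d] by simp
  have r: "rk M F = card F" using sp_rk_less[OF sp F(1)] F d by simp
  show "coeff (chi M {} F) k = coeff ([:-1, 1:] ^ card F) k"
  proof (cases "k \<le> card F")
    case True
    have "coeff (chi M {} F) (rk M F - (card F - k))
      = (-1) ^ (card F - k) * int (card F choose (card F - k))"
      by (rule sp_coeff_chi[OF sp d fl]) (use F r in auto)
    thus ?thesis using True r binomial_symmetric[OF True] by (simp add: coeff_linear_pow)
  next
    case False
    have "degree (chi M {} F) \<le> card F" using degree_chi[OF sp_matroid[OF sp], of "{}" F] r by simp
    thus ?thesis using False by (simp add: coeff_linear_pow coeff_eq_0)
  qed
qed

text \<open>The four terms belong to the ground set, the circuit-hyperplanes, the sets of size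
  \<open>d - 1\<close> in no circuit-hyperplane, and the smaller nonempty sets. In the first three
  cases the contraction has rank 0 or 1 and polynomial 1, so only top coefficients of characteristic
  polynomials enter.\<close>

lemma sp_kl_coeff_recursion:
  assumes i: "1 \<le> i" "2 * i < d"
  shows "coeff (kl_poly M) i = (-1) ^ i * int (card (ground M) choose i)
    + (-1) ^ (i - 1) * int (d choose (i - 1)) * int (card CH)
    + (int (card (ground M) choose (d - 1)) - int d * int (card CH)) * coeff ([:-1, 1:] ^ (d - 1))
      (d - i)
    + (\<Sum>j=1..d - 2. \<Sum>F | F \<subseteq> ground M \<and> card F = j. coeff ([:-1, 1:] ^ j * kl_poly
      (contraction M F)) (d - i))"
proof -
  have d: "2 \<le> d" using i by simp
  note M = sp_matroid[OF sp] and rank = sp_rank[OF sp]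
  have fE: "finite (ground M)" by (rule sp_finite[OF sp])
  let ?E = "ground M"
  let ?T = "{F. F \<subseteq> ?E \<and> card F = d - 1 \<and> (\<forall>C\<in>CH. \<not> F \<subseteq> C)}"
  let ?A = "{F. F \<subseteq> ?E \<and> 1 \<le> card F \<and> card F \<le> d - 2}"
  let ?t = "\<lambda>F. coeff (chi M {} F * kl_poly (contraction M F)) (d - i)"
  have fin: "finite ?T" "finite ?A" "finite CH" using fE sp_CH_finite[OF sp] by auto
  have ECH: "?E \<notin> CH" using sp_rk_CH[OF sp, of ?E] rank by auto
  have nd: "d \<le> card ?E" by (rule sp_d_le[OF sp])
  have set: "{F. F \<in> flats M \<and> F \<noteq> {}} = insert ?E (CH \<union> (?T \<union> ?A))"
  proof -
    have "card F \<ge> 1 \<longleftrightarrow> F \<noteq> {}" if "F \<subseteq> ?E" for F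
      using that finite_subset[OF that fE] by (auto simp: Suc_le_eq card_gt_0_iff)
    moreover have "C \<noteq> {}" if "C \<in> CH" for C using that sp_CH[OF sp] d by auto
    moreover have "F \<noteq> {}" if "F \<in> ?T" for F using that d by auto
    moreover have "?E \<noteq> {}" using nd d by auto
    ultimately show ?thesis unfolding sp_flats[OF sp d] by blast
  qed
  have CHc: "card C = d" if "C \<in> CH" for C using that sp_CH[OF sp] by blast
  have disj: "?E \<notin> CH \<union> (?T \<union> ?A)" "CH \<inter> (?T \<union> ?A) = {}" "?T \<inter> ?A = {}"
    using ECH nd d CHc by auto
  have rank1: "kl_poly (contraction M F) = 1" if "F \<subseteq> ?E" "rk M F = d - 1" for F
    using kl_poly_rank_1[OF matroid_contraction[OF M that(1)]] rank_contraction[OF M that(1)] that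
      rank d by simp
  have flat: "F \<in> flats M" if "F \<in> insert ?E (CH \<union> (?T \<union> ?A))" for F using that
    unfolding set[symmetric] by simp
  have 1: "?t ?E = (-1) ^ i * int (card ?E choose i)"
  proof -
    have "kl_poly (contraction M ?E) = 1"
      using kl_poly_rank_0[OF matroid_contraction[OF M order_refl]] rank_contraction[OF M
        order_refl] by simp
    thus ?thesis using sp_coeff_chi[OF sp d flat, of ?E i] rank i by simp
  qed
  have 2: "?t C = (-1) ^ (i - 1) * int (d choose (i - 1))" if C: "C \<in> CH" for C
  proof -
    have "rk M C - (i - 1) = d - i" using sp_rk_CH[OF sp C] i by simp
    thus ?thesis using sp_coeff_chi[OF sp d flat, of C "i
      - 1"] rank1[of C] sp_rk_CH[OF sp C] i C sp_CH[OF sp, of C] by simp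
  qed
  have 3: "?t F = coeff ([:-1, 1:] ^ (d - 1)) (d - i)" if F: "F \<in> ?T" for F
  proof -
    have r: "rk M F = d - 1" using sp_rk_less[OF sp, of F] F d by simp
    have "?t F = coeff (chi M {} F) (rk M F - (i - 1))" using rank1[of F] F r i by simp
    also have "\<dots> = (-1) ^ (i - 1) * int (d - 1 choose (i - 1))"
      using sp_coeff_chi[OF sp d flat, of F "i - 1"] F r i by simp
    also have "\<dots> = coeff ([:-1, 1:] ^ (d - 1)) (d - i)"
    proof -
      have "d - 1 - (d - i) = i - 1" "d - i \<le> d - 1" "d - 1 - (i - 1) = d - i" "i - 1 \<le> d - 1"
        using i by auto
      thus ?thesis using binomial_symmetric[of "i - 1" "d - 1"] by (simp add: coeff_linear_pow)
    qed
    finally show ?thesis .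
  qed
  have "coeff (kl_poly M) i = coeff (kl_rest kl_poly M) (d - i)"
    using coeff_kl_poly[OF M, of i] i rank by simp
  also have "\<dots> = (\<Sum>F\<in>insert ?E (CH \<union> (?T \<union> ?A)). ?t F)"
    unfolding kl_rest_def sp_loops[OF sp d] set by (rule coeff_sum)
  also have "\<dots> = ?t ?E + ((\<Sum>F\<in>CH. ?t F) + ((\<Sum>F\<in>?T. ?t F) + (\<Sum>F\<in>?A. ?t F)))"
    using fin disj by (simp only: sum.insert sum.union_disjoint finite_Un finite_insert simp_thms)
  also have "(\<Sum>F\<in>CH. ?t F) = (-1) ^ (i - 1) * int (d choose (i - 1)) * int (card CH)"
    using 2 by simp
  also have "(\<Sum>F\<in>?T. ?t F) = (int (card ?E choose (d - 1)) - int d * int (card CH))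
    * coeff ([:-1, 1:] ^ (d - 1)) (d - i)"
  proof -
    have "(\<Sum>F\<in>?T. ?t F) = int (card ?T) * coeff ([:-1, 1:] ^ (d - 1)) (d - i)" using 3 by simp
    thus ?thesis using sp_card_free_hyperplanes d by simp
  qed
  also have "(\<Sum>F\<in>?A. ?t F) = (\<Sum>j=1..d - 2. \<Sum>F | F \<subseteq> ?E \<and> card F
    = j. coeff ([:-1, 1:] ^ j * kl_poly (contraction M F)) (d - i))"
  proof -
    have "?A = (\<Union>j\<in>{1..d - 2}. {F. F \<subseteq> ?E \<and> card F = j})" by auto
    hence "(\<Sum>F\<in>?A. ?t F) = (\<Sum>F\<in>(\<Union>j\<in>{1..d - 2}. {F. F \<subseteq> ?E \<and> card F = j}). ?t F)" by simp
    also have "\<dots> = (\<Sum>j=1..d - 2. \<Sum>F | F \<subseteq> ?E \<and> card F = j. ?t F)"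
      using fE by (intro sum.UNION_disjoint) auto
    also have "\<dots> = (\<Sum>j=1..d - 2. \<Sum>F | F \<subseteq> ?E \<and> card F
      = j. coeff ([:-1, 1:] ^ j * kl_poly (contraction M F)) (d - i))"
      by (intro sum.cong refl) (auto simp: sp_chi_small[OF d])
    finally show ?thesis .
  qed
  finally show ?thesis using 1 by simp
qed

end

text \<open>The contraction by a \<open>j\<close>-subset \<open>F\<close> has corank
  \<open>m\<close>, and its circuit-hyperplanes correspond to those containing \<open>F\<close>. By
  \<open>sp_sum_card_CH\<close> their numbers add up to \<open>card CH\<close> times binomial(d, j),
  so the recursion is affine in \<open>card CH\<close>, with the recursions of U_{m,d} and Q_d as
  its two parts.\<close>

theorem kl_poly_sparse:
  assumes "is_sparse_paving d CH M"
  shows "kl_poly M = upoly (card (ground M) - d) d - smult (int (card CH)) (qpoly d)"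
  using assms
proof (induction d arbitrary: CH M rule: less_induct)
  case (less d)
  note sp = less.prems
  note M = sp_matroid[OF sp] and rank = sp_rank[OF sp]
  let ?E = "ground M" and ?c = "int (card CH)"
  define m where "m = card ?E - d"
  have n: "card ?E = m + d" using sp_d_le[OF sp] by (simp add: m_def)
  have fE: "finite ?E" by (rule sp_finite[OF sp])
  show ?case
  proof (rule poly_eqI)
    fix i
    consider "i = 0" | "1 \<le> i" "d \<le> 2 * i" | "1 \<le> i" "2 * i < d" by linarith
    thus "coeff (kl_poly M) i = coeff (upoly (card ?E - d) d - smult ?c (qpoly d)) i"
    proof cases
      case 1
      thus ?thesis using coeff_kl_poly_0[OF M] by (simp add: q_coeff_def)
    next
      case 2
      have "degree (kl_poly M) < i"
      proof (cases "d = 0")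
        case True
        thus ?thesis using kl_poly_rank_0[OF M] rank 2 by simp
      next
        case False
        thus ?thesis using kl_poly_degree[OF M] rank 2 by simp
      qed
      moreover have "u_coeff m' d i = 0" "u_coeff 1 (d - 1) i = 0" for m'
        using 2 by (auto simp: u_coeff_zero)
      ultimately show ?thesis by (simp add: coeff_eq_0 q_coeff_def)
    next
      case 3
      let ?b = "\<lambda>j p. coeff ([:-1, 1:] ^ j * p) (d - i)"
      have layer: "(\<Sum>F | F \<subseteq> ?E \<and> card F = j. ?b j (kl_poly (contraction M F)))
          = int (m + d choose j) * ?b j (upoly m (d - j)) - ?c * (int (d choose j) * ?b j (qpoly
            (d - j)))"
        if j: "j \<in> {1..d - 2}" for j
      proof -
        have "(\<Sum>F | F \<subseteq> ?E \<and> card F = j. ?b j (kl_poly (contraction M F)))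
            = (\<Sum>F | F \<subseteq> ?E \<and> card F = j. ?b j (upoly m (d - j)) - int (card {C \<in> CH. F \<subseteq> C}) * ?b j
              (qpoly (d - j)))"
        proof (rule sum.cong[OF refl])
          fix F assume "F \<in> {F. F \<subseteq> ?E \<and> card F = j}"
          hence F: "F \<subseteq> ?E" "card F = j" "finite F" using finite_subset[OF _ fE] by auto
          have "kl_poly (contraction M F) = upoly (card (?E - F) - (d - j)) (d - j)
              - smult (int (card {C \<in> CH. F \<subseteq> C})) (qpoly (d - j))"
          proof -
            have lt: "d - card F < d" "card F < d" using F j by auto
            show ?thesis
              using less.IH[OF lt(1) sp_contraction[OF sp F(1) lt(2)]]
              unfolding F(2) sp_card_CH_contraction[OF sp] ground_contraction .
          qed
          moreover have "card (?E - F) - (d - j) = m"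
          proof -
            have "card (?E - F) = m + d - j" using F n by (simp add: card_Diff_subset)
            moreover have "m + d - j - (d - j) = m" using j by auto
            ultimately show ?thesis by simp
          qed
          ultimately show "?b j (kl_poly (contraction M F))
              = ?b j (upoly m (d - j)) - int (card {C \<in> CH. F \<subseteq> C}) * ?b j (qpoly (d - j))"
            by (simp add: right_diff_distrib)
        qed
        also have "\<dots> = int (card {F. F \<subseteq> ?E \<and> card F = j}) * ?b j (upoly m (d - j))
            - int (\<Sum>F | F \<subseteq> ?E \<and> card F = j. card {C \<in> CH. F \<subseteq> C}) * ?b j (qpoly (d - j))"
          by (simp add: sum_subtractf sum_distrib_right)
        finally show ?thesis using n_subsets[OF fE, of j] sp_sum_card_CH[OF sp, of j] n by simp
      qed
      \<comment> \<open>The layer j = d - 1 is split off because not all of its sets are flats;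
        there \<open>upoly m 1 = 1\<close> and \<open>qpoly 1 = 0\<close>.\<close>
      have last: "(\<Sum>j=1..d - 1. f j) = (\<Sum>j=1..d - 2. f j) + f (d - 1)" for f :: "nat \<Rightarrow> int"
      proof -
        obtain e where "d = Suc (Suc e)" using 3 by (cases d; cases "d - 1") auto
        thus ?thesis by simp
      qed
      have dd: "d - (d - 1) = 1" using 3 by simp
      have A: "coeff (kl_poly M) i = (-1) ^ i * int (m + d choose i)
          + (-1) ^ (i - 1) * int (d choose (i - 1)) * ?c
          + (int (m + d choose (d - 1)) - int d * ?c) * coeff ([:-1, 1:] ^ (d - 1)) (d - i)
          + ((\<Sum>j=1..d - 2. int (m + d choose j) * ?b j (upoly m (d - j)))
             - ?c * (\<Sum>j=1..d - 2. int (d choose j) * ?b j (qpoly (d - j))))"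
        unfolding sp_kl_coeff_recursion[OF sp 3] n
          by (simp add: layer sum_subtractf sum_distrib_left)
      have B: "u_coeff m d i = (-1) ^ i * int (m + d choose i)
          + (\<Sum>j=1..d - 2. int (m + d choose j) * ?b j (upoly m (d - j)))
          + int (m + d choose (d - 1)) * coeff ([:-1, 1:] ^ (d - 1)) (d - i)"
        using u_coeff_poly_recursion[of i d m, unfolded last dd] 3 upoly_low[of 1 m] by simp
      have C: "q_coeff d i = (\<Sum>j=1..d - 2. int (d choose j) * ?b j (qpoly (d - j)))
          + int d * coeff ([:-1, 1:] ^ (d - 1)) (d - i) - (-1) ^ (i - 1) * int (d choose (i - 1))"
      proof -
        have "qpoly 1 = 0" by (simp add: qpoly_def upoly_low)
        thus ?thesis using q_coeff_poly_recursion[OF 3, unfolded last dd] by simp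
      qed
      have gen: "K = u - c * q"
        if "K = x + y * c + (N - D * c) * b + (U - c * Q)" "u = x + U + N * b" "q = Q + D * b - y"
        for K u c q x y N D b U Q :: int unfolding that by (simp add: algebra_simps)
      have "coeff (upoly (card ?E - d) d - smult ?c (qpoly d)) i = u_coeff m d i - ?c * q_coeff d i"
        by (simp add: m_def)
      thus ?thesis using gen[OF A B C] by simp
    qed
  qed
qed

theorem kl_poly_sparse_nonneg:
  assumes sp: "is_sparse_paving d CH M"
  shows "coeff (kl_poly M) i \<ge> 0"
proof -
  let ?E = "ground M" and ?c = "card CH"
  define m where "m = card ?E - d"
  have n: "card ?E = m + d" using sp_d_le[OF sp] by (simp add: m_def)
  have c: "coeff (kl_poly M) i = u_coeff m d i - int ?c * q_coeff d i"
    unfolding kl_poly_sparse[OF sp] m_def by simp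
  consider "i = 0" | "1 \<le> i" "d \<le> 2 * i" | "1 \<le> i" "2 * i < d" "m = 0" | "m = 3" "d = 3" "i = 1"
    | "1 \<le> i" "2 * i < d" "1 \<le> m" "\<not> (m = 3 \<and> d = 3 \<and> i = 1)" by linarith
  thus ?thesis
  proof cases
    case 1
    thus ?thesis using coeff_kl_poly_0[OF sp_matroid[OF sp]] by simp
  next
    case 2
    thus ?thesis by (simp add: c q_coeff_def u_coeff_zero)
  next
    case 3
    have "CH = {}"
    proof (rule ccontr)
      assume "CH \<noteq> {}"
      then obtain C where C: "C \<in> CH" by blast
      hence "C = ?E" using sp_CH[OF sp] n 3 card_subset_eq[OF sp_finite[OF sp]] by auto
      thus False using sp_rk_CH[OF sp C] sp_rank[OF sp] by simp
    qed
    thus ?thesis by (simp add: c u_coeff_nonneg)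
  next
    case 4
    have fE: "finite ?E" by (rule sp_finite[OF sp])
    \<comment> \<open>The general bound only gives \<open>card CH \<le> 5\<close>, and 9 - 5 * 2 is
      negative. Contracting \<open>x\<close> leaves rank 2 on five elements, where the
      circuit-hyperplanes are disjoint pairs; so each of the six elements lies in at most two
      circuit-hyperplanes, and 3 * \<open>card CH\<close> is at most 12.\<close>
    have two: "card {C \<in> CH. {x} \<subseteq> C} \<le> 2" if "x \<in> ?E" for x
    proof -
      let ?N = "contraction M {x}" and ?CH = "(\<lambda>C. C - {x}) ` {C \<in> CH. {x} \<subseteq> C}"
      have sN: "is_sparse_paving 2 ?CH ?N" using sp_contraction[OF sp, of "{x}"] that 4 by simp
      have "2 * card ?CH \<le> card (ground ?N) choose (2 - 1)" by (rule sp_card_pred_le[OF sN])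
      moreover have "card (ground ?N) = 5" using that n 4 fE by simp
      ultimately show ?thesis using sp_card_CH_contraction[OF sp, of "{x}"] by simp
    qed
    have "?c * (d choose 1) = (\<Sum>F | F \<subseteq> ?E \<and> card F = 1. card {C \<in> CH. F \<subseteq> C})"
      by (rule sp_sum_card_CH[OF sp, symmetric])
    also have "\<dots> \<le> (\<Sum>F | F \<subseteq> ?E \<and> card F = 1. 2)"
      by (rule sum_mono) (use two in \<open>auto simp: card_1_singleton_iff\<close>)
    also have "\<dots> = 12" using n_subsets[OF fE, of 1] n 4 by simp
    finally have "?c \<le> 4" using 4 by simp
    thus ?thesis unfolding c using u_coeff_3_3_1 4 by simp
  next
    case 5
    have "(max m d + 1) * ?c \<le> m + d choose d"
      by (rule sp_card_CH_le[OF sp]) (use 5 n in auto)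
    hence "real ((max m d + 1) * ?c) \<le> real (m + d choose d)" by (simp only: of_nat_le_iff)
    hence "real ((max m d + 1) * ?c) * of_int (q_coeff d i)
      \<le> real (m + d choose d) * of_int (q_coeff d i)"
      by (rule mult_right_mono) (use q_coeff_pos[OF 5(1,2)] in simp)
    hence "real (max m d + 1) * (real ?c * of_int (q_coeff d i))
      \<le> real (m + d choose d) * of_int (q_coeff d i)"
      by (simp only: of_nat_mult mult.assoc)
    also have "\<dots> \<le> real (max m d + 1) * of_int (u_coeff m d i)"
      using u_coeff_ge[OF 5] by (simp add: add.commute)
    finally have "real ?c * of_int (q_coeff d i) \<le> of_int (u_coeff m d i)"
      by (subst (asm) mult_le_cancel_left_pos) auto
    hence "of_int (int ?c * q_coeff d i) \<le> (of_int (u_coeff m d i) :: real)" by simp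
    thus ?thesis unfolding c by linarith
  qed
qed

theorem theorem1p1:
  fixes m d i :: nat and CH :: "nat set set" and M :: "nat set_system"
  assumes "sparse_paving m d CH M"
  shows "coeff (kl_poly M) i =
           int (skyt (int m + 1) i (int d - 2 * int i + 1))
           - int (card CH) * int (skyt_bar i (int d - 2 * int i + 1))
         \<and> coeff (kl_poly M) i \<ge> 0"
proof
  have sp: "is_sparse_paving d CH M" and E: "ground M = {1..m + d}"
    using assms by (auto simp: sparse_paving_def is_sparse_paving_def)
  show "coeff (kl_poly M) i \<ge> 0" by (rule kl_poly_sparse_nonneg[OF sp])
  \<comment> \<open>Outside of the range \<open>1 \<le> i\<close>, \<open>2 * i < d\<close> both
    sides are 0: for \<open>i = 0\<close> two constant terms 1 cancel, and for
    \<open>d \<le> 2 * i\<close> the column height is at most 1.\<close>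
  have "int (skyt_bar i (int d - 2 * int i + 1)) = q_coeff d i"
  proof (cases "1 \<le> i \<and> 2 * i < d")
    case True
    have "int (d - 1) - 2 * int i + 1 = int d - 2 * int i + 1 - 1" using True by simp
    thus ?thesis using skyt_bar_eq[of i "int d - 2 * int i + 1"] True
      unfolding q_coeff_def u_coeff_def by simp
  next
    case False
    thus ?thesis by (cases "i = 0") (auto simp: skyt_bar_def q_coeff_def u_coeff_zero)
  qed
  thus "coeff (kl_poly M) i = int (skyt (int m + 1) i (int d - 2 * int i + 1))
      - int (card CH) * int (skyt_bar i (int d - 2 * int i + 1))"
    unfolding kl_poly_sparse[OF sp] E by (simp add: u_coeff_def)
qed

end
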